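(* Let $s\in(0,1)$, $N\ge 1$ with $N\le 2s$, and let $\Omega\subset\mathbb{R}^N$ be a bounded domain with Lipschitz boundary. Let $f:\Omega\times\mathbb{R}\to\mathbb{R}$ be a Carathéodory function, $F(x,t)=\int_0^t f(x,\tau)\,d\tau$, such that: (a) there exist $r\in(1,\frac{N}{N-s})$ and $C>0$ with $|f(x,t)|\le C|t|^{r-1}$ for all $(x,t)\in\Omega\times\mathbb{R}$; (b) there exists $\theta>1$ with $0<\theta F(x,t)\le t f(x,t)$ for all $x\in\Omega$, $t\neq 0$; (c) $f(x,\cdot)\in C^1(\mathbb{R})$ for all $x\in\Omega$ and there exists $\Theta>1$ with $(\Theta-1)f(x,t)t<t^2f'(x,t)$ for all $x\in\Omega$, $t\ne 0$ (where $f'=\partial_t f$); (d) $r<1+\frac{N}{2(N-s)}$. Let $u_0\in W_0^{s,1}(\Omega)$ and let $u$ denote the strong solution of problem (P) with initial datum $u_0$. Write $(z)_+=\max\{z,0\}$. Then there exist constants $\delta'\in(0,1)$ and $C_{Sob}>0$ such that the following hold. (i) If $E(u_0)<d$ and $I(u_0)>0$, then for all $t\ge 0$, $\|u(\cdot,t)\|_{L^2(\Omega)}\le\big(\|u_0\|_{L^2(\Omega)}+(\delta'-1)C_{Sob}\,t\big)_+$. In particular, the solution vanishes in finite time $t^*=\frac{\|u_0\|_{L^2(\Omega)}}{(1-\delta')C_{Sob}}$. (ii) If $E(u_0)=d$, then either $I(u(\cdot,t))=0$ and $\|u(\cdot,t)\|_{L^2(\Omega)}=\|u_0\|_{L^2(\Omega)}$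 for all $t\in(0,\infty)$, or there exists $t_0>0$ such that $I(u(\cdot,t_0))>0$ and $\|u(\cdot,t)\|_{L^2(\Omega)}\le\big(\|u(\cdot,t_0)\|_{L^2(\Omega)}+(\delta'-1)C_{Sob}(t-t_0)\big)_+$ for all $t\ge t_0$; in the latter case, in particular, the solution vanishes in finite time $t^{**}=t_0+\frac{\|u(\cdot,t_0)\|_{L^2(\Omega)}}{(1-\delta')C_{Sob}}$.
   Context: Let $\mathcal{C}\Omega=\mathbb{R}^N\setminus\Omega$, $Q=(\mathbb{R}^N\times\mathbb{R}^N)\setminus(\mathcal{C}\Omega\times\mathcal{C}\Omega)$, and $W_0^{s,1}(\Omega)=\{u: u\in L^1(\Omega),\ u=0 \text{ in }\mathcal{C}\Omega,\ \frac{|u(x)-u(y)|}{|x-y|^{N+s}}\in L^1(Q)\}$ with norm $\|u\|_{W_0^{s,1}(\Omega)}=\iint_Q\frac{|u(x)-u(y)|}{|x-y|^{N+s}}dxdy$. Set $1_s^*=\frac{N}{N-s}$. Functionals on $W_0^{s,1}(\Omega)$: $E(u)=\|u\|_{W_0^{s,1}(\Omega)}-\int_\Omega F(x,u)dx$, $I(u)=\|u\|_{W_0^{s,1}(\Omega)}-\int_\Omega f(x,u)u\,dx$. Nehari manifold $\mathcal{N}=\{u\in W_0^{s,1}(\Omega)\setminus\{0\}: I(u)=0\}$, and $d=\inf_{u\in\mathcal{N}}E(u)$. Problem (P): $u_t+(-\Delta)_1^s u=f(x,u)$ in $\Omega\times(0,T)$, $u=0$ in $(\mathbb{R}^N\setminus\Omega)\times(0,T)$,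 $u(\cdot,0)=u_0$ in $\Omega$, where $(-\Delta)^s_1$ is the fractional 1-Laplacian (formally $\mathrm{P.V.}\int_{\mathbb{R}^N}\frac{u(x)-u(y)}{|u(x)-u(y)|}\frac{dy}{|x-y|^{N+s}}$). Weak solution on $(0,T)$: a function $u\in L^\infty(0,T;W_0^{s,1}(\Omega)\cap L^2(\Omega))$ with $u_t\in L^2(0,T;L^2(\Omega))$ such that (1) $u(\cdot,0)=u_0$ a.e. in $\Omega$; (2) there exists $\eta(\cdot,\cdot,t)\in L^\infty(\mathbb{R}^N\times\mathbb{R}^N)$, antisymmetric ($\eta(x,y,t)=-\eta(y,x,t)$ for a.e. $(x,y)$), with $\|\eta(\cdot,\cdot,t)\|_{L^\infty}\le 1$ and $\eta(x,y,t)\in\operatorname{sign}(u(x,t)-u(y,t))$ for a.e. $(x,y,t)\in\mathbb{R}^N\times\mathbb{R}^N\times[0,T]$ (multivalued sign, $\operatorname{sign}(0)=[-1,1]$), such that $\int_\Omega u_t\phi\,dx+\iint_Q\eta(x,y,t)\frac{\phi(x)-\phi(y)}{|x-y|^{N+s}}dxdy=\int_\Omega f(x,u)\phi\,dx$ for all $\phi\in W_0^{s,1}(\Omega)\cap L^2(\Omega)$ and a.e. $t\in[0,T]$; (3) $u\in C(0,T;L^\kappa(\Omega))$ for $\kappa\in[1,1_s^* )$ and $\int_0^t\|u_t(\cdot,\tau)\|_{L^2(\Omega)}^2d\tau+E(u(\cdot,t))\le E(u_0)$ for a.e. $t\in[0,T)$. Strong solution: a weak solution for which $\int_0^t\|u_t(\cdot,\tau)\|_{L^2(\Omega)}^2d\tau+E(u(\cdot,t))=E(u(\cdot,0))$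 for every $[0,t]\subset[0,T)$. *)

theory Defs
  imports "HOL-Analysis.Analysis"
begin

section \<open>Domains and nonlinearities\<close>

text \<open>Near every boundary point, after a rotation, \<open>\<Omega>\<close> is the strict epigraph of a Lipschitz
  function of the coordinates orthogonal to the unit vector \<open>e\<close>.\<close>

definition lipschitz_boundary :: "(real^'n) set \<Rightarrow> bool" where
  "lipschitz_boundary \<Omega> \<longleftrightarrow>
     (\<forall>p\<in>frontier \<Omega>. \<exists>\<rho>>0. \<exists>e g L. norm e = 1 \<and> L-lipschitz_on {y. y \<bullet> e = 0} g \<and>
        \<Omega> \<inter> ball p \<rho> = {x \<in> ball p \<rho>. g (x - (x \<bullet> e) *\<^sub>R e) < x \<bullet> e})"

definition bounded_lipschitz_domain :: "(real^'n) set \<Rightarrow> bool" where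
  "bounded_lipschitz_domain \<Omega> \<longleftrightarrow>
     \<Omega> \<noteq> {} \<and> open \<Omega> \<and> connected \<Omega> \<and> bounded \<Omega> \<and> lipschitz_boundary \<Omega>"

definition caratheodory :: "(real^'n) set \<Rightarrow> (real^'n \<Rightarrow> real \<Rightarrow> real) \<Rightarrow> bool" where
  "caratheodory \<Omega> f \<longleftrightarrow>
     (\<forall>t. (\<lambda>x. f x t) \<in> borel_measurable (lebesgue_on \<Omega>)) \<and>
     (AE x in lebesgue_on \<Omega>. continuous_on UNIV (f x))"

text \<open>The interval integral is signed, as needed for \<open>t < 0\<close>.\<close>

definition primitive :: "(real^'n \<Rightarrow> real \<Rightarrow> real) \<Rightarrow> real^'n \<Rightarrow> real \<Rightarrow> real" where
  "primitive f x t = (LBINT \<tau>=ereal 0..ereal t. f x \<tau>)"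


section \<open>Function spaces\<close>

text \<open>Elements of function spaces are represented by functions; equality in the space is equality
  almost everywhere, so the norms below are seminorms on representatives.\<close>

definition Lp :: "real \<Rightarrow> (real^'n) set \<Rightarrow> (real^'n \<Rightarrow> real) set" where
  "Lp p \<Omega> = {u. u \<in> borel_measurable (lebesgue_on \<Omega>) \<and>
                 integrable (lebesgue_on \<Omega>) (\<lambda>x. \<bar>u x\<bar> powr p)}"

definition Lp_norm :: "real \<Rightarrow> (real^'n) set \<Rightarrow> (real^'n \<Rightarrow> real) \<Rightarrow> real" where
  "Lp_norm p \<Omega> u = (\<integral>x. \<bar>u x\<bar> powr p \<partial>lebesgue_on \<Omega>) powr (1 / p)"

definition Qset :: "(real^'n) set \<Rightarrow> ((real^'n) \<times> (real^'n)) set" where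
  "Qset \<Omega> = UNIV - (UNIV - \<Omega>) \<times> (UNIV - \<Omega>)"

definition kernel :: "real \<Rightarrow> real^'n \<Rightarrow> real^'n \<Rightarrow> real" where
  "kernel s x y = norm (x - y) powr (real CARD('n) + s)"

definition Ws1 :: "real \<Rightarrow> (real^'n) set \<Rightarrow> (real^'n \<Rightarrow> real) set" where
  "Ws1 s \<Omega> = {u. u \<in> Lp 1 \<Omega> \<and> (AE x in lebesgue. x \<notin> \<Omega> \<longrightarrow> u x = 0) \<and>
                  set_integrable lebesgue (Qset \<Omega>) (\<lambda>(x, y). \<bar>u x - u y\<bar> / kernel s x y)}"

definition Ws1_norm :: "real \<Rightarrow> (real^'n) set \<Rightarrow> (real^'n \<Rightarrow> real) \<Rightarrow> real" where
  "Ws1_norm s \<Omega> u =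
     set_lebesgue_integral lebesgue (Qset \<Omega>) (\<lambda>(x, y). \<bar>u x - u y\<bar> / kernel s x y)"


section \<open>Functionals and the Nehari manifold\<close>

definition energy ::
  "real \<Rightarrow> (real^'n) set \<Rightarrow> (real^'n \<Rightarrow> real \<Rightarrow> real) \<Rightarrow> (real^'n \<Rightarrow> real) \<Rightarrow> real" where
  "energy s \<Omega> f u = Ws1_norm s \<Omega> u - (\<integral>x. primitive f x (u x) \<partial>lebesgue_on \<Omega>)"

definition nehari_functional ::
  "real \<Rightarrow> (real^'n) set \<Rightarrow> (real^'n \<Rightarrow> real \<Rightarrow> real) \<Rightarrow> (real^'n \<Rightarrow> real) \<Rightarrow> real" where
  "nehari_functional s \<Omega> f u = Ws1_norm s \<Omega> u - (\<integral>x. f x (u x) * u x \<partial>lebesgue_on \<Omega>)"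

definition nehari_manifold ::
  "real \<Rightarrow> (real^'n) set \<Rightarrow> (real^'n \<Rightarrow> real \<Rightarrow> real) \<Rightarrow> (real^'n \<Rightarrow> real) set" where
  "nehari_manifold s \<Omega> f =
     {u \<in> Ws1 s \<Omega>. \<not> (AE x in lebesgue. u x = 0) \<and> nehari_functional s \<Omega> f u = 0}"

definition well_depth :: "real \<Rightarrow> (real^'n) set \<Rightarrow> (real^'n \<Rightarrow> real \<Rightarrow> real) \<Rightarrow> real" where
  "well_depth s \<Omega> f = (INF u\<in>nehari_manifold s \<Omega> f. energy s \<Omega> f u)"


section \<open>Bochner spaces\<close>

text \<open>A Banach space of functions is given by a carrier \<open>X\<close> and its norm \<open>nrm\<close>; \<open>J\<close> is a time
  interval. Strong measurability is almost everywhere approximability by simple functions.\<close>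

definition strongly_measurable ::
  "(real^'n \<Rightarrow> real) set \<Rightarrow> ((real^'n \<Rightarrow> real) \<Rightarrow> real) \<Rightarrow> real set \<Rightarrow>
     (real \<Rightarrow> real^'n \<Rightarrow> real) \<Rightarrow> bool" where
  "strongly_measurable X nrm J u \<longleftrightarrow>
     (\<exists>S. (\<forall>k. simple_function (lebesgue_on J) (S k) \<and> S k ` J \<subseteq> X) \<and>
          (AE t in lebesgue_on J. (\<lambda>k::nat. nrm (\<lambda>x. S k t x - u t x)) \<longlonglongrightarrow> 0))"

definition bochner_Linf ::
  "(real^'n \<Rightarrow> real) set \<Rightarrow> ((real^'n \<Rightarrow> real) \<Rightarrow> real) \<Rightarrow> real set \<Rightarrow>
     (real \<Rightarrow> real^'n \<Rightarrow> real) \<Rightarrow> bool" where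
  "bochner_Linf X nrm J u \<longleftrightarrow>
     (AE t in lebesgue_on J. u t \<in> X) \<and> strongly_measurable X nrm J u \<and>
     (\<exists>M. AE t in lebesgue_on J. nrm (u t) \<le> M)"

definition bochner_L2 ::
  "(real^'n \<Rightarrow> real) set \<Rightarrow> ((real^'n \<Rightarrow> real) \<Rightarrow> real) \<Rightarrow> real set \<Rightarrow>
     (real \<Rightarrow> real^'n \<Rightarrow> real) \<Rightarrow> bool" where
  "bochner_L2 X nrm J u \<longleftrightarrow>
     (AE t in lebesgue_on J. u t \<in> X) \<and> strongly_measurable X nrm J u \<and>
     integrable (lebesgue_on J) (\<lambda>t. (nrm (u t))\<^sup>2)"

definition continuous_in_Lp ::
  "real \<Rightarrow> (real^'n) set \<Rightarrow> real set \<Rightarrow> (real \<Rightarrow> real^'n \<Rightarrow> real) \<Rightarrow> bool" where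
  "continuous_in_Lp p \<Omega> J u \<longleftrightarrow>
     (\<forall>t\<in>J. u t \<in> Lp p \<Omega>) \<and>
     (\<forall>t\<in>J. ((\<lambda>\<tau>. Lp_norm p \<Omega> (\<lambda>x. u \<tau> x - u t x)) \<longlongrightarrow> 0) (at t within J))"

definition test_function :: "real set \<Rightarrow> (real \<Rightarrow> real) \<Rightarrow> bool" where
  "test_function J \<psi> \<longleftrightarrow>
     (\<forall>k t. (deriv ^^ k) \<psi> field_differentiable at t) \<and>
     (\<exists>K. compact K \<and> K \<subseteq> J \<and> (\<forall>t. t \<notin> K \<longrightarrow> \<psi> t = 0))"

text \<open>\<open>v = u\<^sub>t\<close> as an \<open>L\<^sup>2(\<Omega>)\<close>-valued distribution on the open interval \<open>J\<close>. The identity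
  between \<open>L\<^sup>2(\<Omega>)\<close>-valued integrals of \<open>\<psi>' u\<close> and \<open>- \<psi> v\<close> is expressed by its inner
  products with all \<open>g\<close> in \<open>L\<^sup>2(\<Omega>)\<close>.\<close>

definition weak_time_derivative ::
  "(real^'n) set \<Rightarrow> real set \<Rightarrow> (real \<Rightarrow> real^'n \<Rightarrow> real) \<Rightarrow> (real \<Rightarrow> real^'n \<Rightarrow> real) \<Rightarrow> bool" where
  "weak_time_derivative \<Omega> J u v \<longleftrightarrow>
     (\<forall>\<psi>. test_function J \<psi> \<longrightarrow> (\<forall>g\<in>Lp 2 \<Omega>.
        (\<integral>t. deriv \<psi> t * (\<integral>x. u t x * g x \<partial>lebesgue_on \<Omega>) \<partial>lebesgue_on J) =
        - (\<integral>t. \<psi> t * (\<integral>x. v t x * g x \<partial>lebesgue_on \<Omega>) \<partial>lebesgue_on J)))"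


section \<open>Solutions\<close>

definition multi_sign :: "real \<Rightarrow> real set" where
  "multi_sign z = (if z = 0 then {-1..1} else {sgn z})"

text \<open>The final time \<open>T\<close> may be \<open>\<infinity>\<close>. These are the intervals \<open>(0,T)\<close>, \<open>[0,T)\<close> and \<open>[0,T]\<close>, the
  last one being \<open>[0,\<infinity>)\<close> for \<open>T = \<infinity>\<close>.\<close>

definition open_time :: "ereal \<Rightarrow> real set" where
  "open_time T = {t. 0 < t \<and> ereal t < T}"

definition half_open_time :: "ereal \<Rightarrow> real set" where
  "half_open_time T = {t. 0 \<le> t \<and> ereal t < T}"

definition closed_time :: "ereal \<Rightarrow> real set" where
  "closed_time T = {t. 0 \<le> t \<and> ereal t \<le> T}"

text \<open>The selection \<open>\<eta>\<close> of the sign of \<open>u(x,t) - u(y,t)\<close> together with the weak equation, the time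
  derivative being \<open>v\<close>.\<close>

definition satisfies_weak_equation ::
  "real \<Rightarrow> (real^'n) set \<Rightarrow> (real^'n \<Rightarrow> real \<Rightarrow> real) \<Rightarrow> ereal \<Rightarrow>
     (real \<Rightarrow> real^'n \<Rightarrow> real) \<Rightarrow> (real \<Rightarrow> real^'n \<Rightarrow> real) \<Rightarrow> bool" where
  "satisfies_weak_equation s \<Omega> f T u v \<longleftrightarrow>
     (\<exists>\<eta> :: real^'n \<Rightarrow> real^'n \<Rightarrow> real \<Rightarrow> real.
        (AE t in lebesgue_on (closed_time T).
           (\<lambda>(x, y). \<eta> x y t) \<in> borel_measurable lebesgue \<and>
           (AE (x, y) in lebesgue. \<eta> x y t = - \<eta> y x t) \<and>
           (AE (x, y) in lebesgue. \<bar>\<eta> x y t\<bar> \<le> 1)) \<and>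
        (AE (x, y, t) in lebesgue. t \<in> closed_time T \<longrightarrow> \<eta> x y t \<in> multi_sign (u t x - u t y)) \<and>
        (\<forall>\<phi> \<in> Ws1 s \<Omega> \<inter> Lp 2 \<Omega>. AE t in lebesgue_on (closed_time T).
           (\<integral>x. v t x * \<phi> x \<partial>lebesgue_on \<Omega>) +
           set_lebesgue_integral lebesgue (Qset \<Omega>)
             (\<lambda>(x, y). \<eta> x y t * ((\<phi> x - \<phi> y) / kernel s x y)) =
           (\<integral>x. f x (u t x) * \<phi> x \<partial>lebesgue_on \<Omega>)))"

text \<open>\<open>u\<close> is a weak solution on \<open>(0,T)\<close> with time derivative \<open>v\<close>, which \<open>u\<close> determines almost
  everywhere.\<close>

definition weak_solution_with ::
  "real \<Rightarrow> (real^'n) set \<Rightarrow> (real^'n \<Rightarrow> real \<Rightarrow> real) \<Rightarrow> ereal \<Rightarrow> (real^'n \<Rightarrow> real) \<Rightarrow>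
     (real \<Rightarrow> real^'n \<Rightarrow> real) \<Rightarrow> (real \<Rightarrow> real^'n \<Rightarrow> real) \<Rightarrow> bool" where
  "weak_solution_with s \<Omega> f T u0 u v \<longleftrightarrow>
     bochner_Linf (Ws1 s \<Omega> \<inter> Lp 2 \<Omega>) (\<lambda>\<phi>. Ws1_norm s \<Omega> \<phi> + Lp_norm 2 \<Omega> \<phi>) (open_time T) u \<and>
     bochner_L2 (Lp 2 \<Omega>) (Lp_norm 2 \<Omega>) (open_time T) v \<and>
     weak_time_derivative \<Omega> (open_time T) u v \<and>
     (AE x in lebesgue_on \<Omega>. u 0 x = u0 x) \<and>
     satisfies_weak_equation s \<Omega> f T u v \<and>
     (\<forall>\<kappa>. 1 \<le> \<kappa> \<and> \<kappa> < real CARD('n) / (real CARD('n) - s) \<longrightarrow>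
        continuous_in_Lp \<kappa> \<Omega> (closed_time T) u) \<and>
     (AE t in lebesgue_on (half_open_time T).
        (\<integral>\<tau>. (Lp_norm 2 \<Omega> (v \<tau>))\<^sup>2 \<partial>lebesgue_on {0..t}) + energy s \<Omega> f (u t) \<le> energy s \<Omega> f u0)"

definition weak_solution ::
  "real \<Rightarrow> (real^'n) set \<Rightarrow> (real^'n \<Rightarrow> real \<Rightarrow> real) \<Rightarrow> ereal \<Rightarrow> (real^'n \<Rightarrow> real) \<Rightarrow>
     (real \<Rightarrow> real^'n \<Rightarrow> real) \<Rightarrow> bool" where
  "weak_solution s \<Omega> f T u0 u \<longleftrightarrow> (\<exists>v. weak_solution_with s \<Omega> f T u0 u v)"

text \<open>The energy is a functional on \<open>W\<^sub>0\<^sup>s\<^sup>,\<^sup>1(\<Omega>)\<close> only, so an energy identity at every time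
  requires \<open>u(\<cdot>,t)\<close> to lie in that space at every time.\<close>

definition strong_solution ::
  "real \<Rightarrow> (real^'n) set \<Rightarrow> (real^'n \<Rightarrow> real \<Rightarrow> real) \<Rightarrow> ereal \<Rightarrow> (real^'n \<Rightarrow> real) \<Rightarrow>
     (real \<Rightarrow> real^'n \<Rightarrow> real) \<Rightarrow> bool" where
  "strong_solution s \<Omega> f T u0 u \<longleftrightarrow>
     (\<exists>v. weak_solution_with s \<Omega> f T u0 u v \<and>
        (\<forall>t\<in>half_open_time T. u t \<in> Ws1 s \<Omega> \<and>
           (\<integral>\<tau>. (Lp_norm 2 \<Omega> (v \<tau>))\<^sup>2 \<partial>lebesgue_on {0..t}) + energy s \<Omega> f (u t) =
           energy s \<Omega> f (u 0)))"

end

theory Submission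
  imports Defs
begin

text \<open>Since \<open>N \<le> 2s\<close>, the critical exponent \<open>N / (N - s)\<close> is at least 2, so \<open>W\<^sub>0\<^sup>s\<^sup>,\<^sup>1(\<Omega>)\<close> embeds
  into \<open>L\<^sup>2(\<Omega>)\<close>, by the coarea formula and a crude isoperimetric inequality for the fractional
  perimeter. The energy identity and the continuity of \<open>u\<close> in \<open>L\<^sup>r\<close> make \<open>E(u(t))\<close>, the norm of
  \<open>u(t)\<close> and \<open>I(u(t))\<close> continuous in time, and testing the equation with \<open>u(t)\<close> makes the squared
  \<open>L\<^sup>2\<close> norm differentiable with derivative \<open>-2 I(u(t))\<close>. Below the level \<open>d\<close> the sign of \<open>I\<close> is
  preserved. If it is nonnegative, scaling onto the Nehari manifold gives
  \<open>I(u) \<ge> (1 - \<delta>') \<parallel>u\<parallel>\<close>, and the Sobolev inequality turns this into a linear decay of the \<open>L\<^sup>2\<close>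
  norm. If it is negative, the same scaling gives \<open>-I(u) \<ge> d - E(u)\<close>, hence unbounded growth, which
  a global solution excludes. At the level \<open>d\<close> the energy is either constant, so that \<open>u\<^sub>t = 0\<close>, or
  passes through a value in \<open>(0,d)\<close>, where the previous case applies.\<close>

section \<open>Smooth cutoffs and weak derivatives on the half line\<close>

text \<open>Convergence in \<open>L\<^sup>r\<close> controls the nonlinear integrals, but under it
  the fractional seminorm is only lower semicontinuous; its continuity in time is obtained
  backwards, by solving the energy identity for it. The exponent 2 may be exactly critical, so
  continuity of \<open>u\<close> in \<open>L\<^sup>2\<close> is not part of the notion of solution
  and has to be proved. The weak equation holds for almost every time, with a null set that depends
  on the test function, whereas \<open>u(t)\<close> moves with time; strong measurability is what
  confines the tests to a countable set. In place of a chain rule for vector-valued weak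
  derivatives, increments of the inner product with one fixed function are computed: the choice
  \<open>u(a) + u(b)\<close> yields the increment of the squared norm, with an error of
  \<open>b - a\<close> times the energy drop, negligible once the energy is continuous.
  \<open>C\<^sub>S\<^sub>o\<^sub>b\<close> is the constant of the embedding into
  \<open>L\<^sup>2\<close>, and \<open>\<delta>'\<close> is a negative power of a lower bound,
  greater than 1, for the factors that carry a function of the given energy onto the Nehari
  manifold.\<close>

definition flat :: "nat \<Rightarrow> real \<Rightarrow> real" where
  "flat k x = (if 0 < x then (1 / x) ^ k * exp (- (1 / x)) else 0)"

text \<open>With \<open>1 / h\<close> as the variable this is the exponential beating every power.
  The quotient is the difference quotient of \<open>flat k\<close> at the origin.\<close>

lemma flat_tendsto_0: "((\<lambda>h. flat k h / h) \<longlongrightarrow> 0) (at 0)"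
proof -
  have "((\<lambda>h::real. (1/h)^(Suc k) / exp (1/h)) \<longlongrightarrow> 0) (at_right 0)"
    using filterlim_compose[OF tendsto_power_div_exp_0 filterlim_inverse_at_top_right, of "Suc k"]
    by (simp add: inverse_eq_divide)
  moreover have "\<forall>\<^sub>F h in at_right 0. (1/h)^(Suc k) / exp (1/h) = flat k h / h"
    unfolding eventually_at_right_field
    by (rule exI[of _ 1]) (auto simp: flat_def exp_minus field_simps)
  ultimately have r: "((\<lambda>h. flat k h / h) \<longlongrightarrow> 0) (at_right 0)"
    by (rule Lim_transform_eventually)
  have "\<forall>\<^sub>F h in at_left (0::real). 0 = flat k h / h"
    unfolding eventually_at_left_field
    by (rule exI[of _ "-1"]) (auto simp: flat_def)
  then have l: "((\<lambda>h. flat k h / h) \<longlongrightarrow> 0) (at_left 0)"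
    by (rule Lim_transform_eventually[OF tendsto_const])
  show ?thesis using l r by (simp add: filterlim_at_split)
qed

text \<open>The factor \<open>(1 / x) ^ k\<close> is carried along so that the family is closed
  under differentiation up to linear combinations; smoothness then needs one derivative formula
  only.\<close>

lemma flat_derivative:
  "(flat k has_real_derivative flat (k + 2) x - real k * flat (k + 1) x) (at x)"
proof -
  consider "0 < x" | "x = 0" | "x < 0" by linarith
  then show ?thesis
  proof cases
    case 1
    have inv: "((\<lambda>y. 1 / y) has_real_derivative - ((1 / x) * (1 / x))) (at x)"
      using 1 by (auto intro!: derivative_eq_intros)
    have "((\<lambda>y. (1 / y) ^ k * exp (- (1 / y))) has_real_derivative
       (real k * (- ((1 / x) * (1 / x)) * (1 / x) ^ (k - Suc 0))) * exp (- (1 / x))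
       + (exp (- (1 / x)) * - (- ((1 / x) * (1 / x)))) * (1 / x) ^ k) (at x)"
      by (intro DERIV_mult DERIV_power inv DERIV_fun_exp DERIV_minus)
    then have "((\<lambda>y. (1 / y) ^ k * exp (- (1 / y))) has_real_derivative
       flat (k + 2) x - real k * flat (k + 1) x) (at x)"
      by (rule DERIV_cong) (use 1 in \<open>cases k; simp add: flat_def algebra_simps\<close>)
    moreover have "\<forall>\<^sub>F y in nhds x. (1 / y) ^ k * exp (- (1 / y)) = flat k y"
      by (rule eventually_mono[OF eventually_nhds_in_open[of "{0<..}"]]) (use 1 in \<open>auto simp: flat_def\<close>)
    ultimately show ?thesis
      using DERIV_cong_ev[OF refl _ refl] by metis
  next
    case 2
    then show ?thesis using flat_tendsto_0[of k]
      by (simp add: has_field_derivative_iff flat_def)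
  next
    case 3
    have "\<forall>\<^sub>F y in nhds x. 0 = flat k y"
      by (rule eventually_mono[OF eventually_nhds_in_open[of "{..<0}"]]) (use 3 in \<open>auto simp: flat_def\<close>)
    then have "(flat k has_real_derivative 0) (at x)"
      using DERIV_cong_ev[of x x "\<lambda>_. 0" "flat k" 0 0] by simp
    then show ?thesis using 3 by (simp add: flat_def)
  qed
qed

text \<open>The linear span of products that vanish outside \<open>{-1<..<1}\<close>. Closure under
  sums and multiples is what makes the set stable under differentiation.\<close>

inductive_set bumps :: "(real \<Rightarrow> real) set" where
  base: "(\<lambda>x. flat j (1 + x) * flat k (1 - x)) \<in> bumps"
| add: "g \<in> bumps \<Longrightarrow> h \<in> bumps \<Longrightarrow> (\<lambda>x. g x + h x) \<in> bumps"
| scale: "g \<in> bumps \<Longrightarrow> (\<lambda>x. a * g x) \<in> bumps"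

lemma bumps_derivative:
  assumes "g \<in> bumps"
  shows "\<exists>g'\<in>bumps. \<forall>x. (g has_real_derivative g' x) (at x)"
  using assms
proof induction
  case (base j k)
  \<comment> \<open>The product rule with \<open>flat_derivative\<close> inserted, bracketed so that
    the introduction rules of \<open>bumps\<close> apply. The signs of the last two terms come from
    the inner derivative of \<open>1 - x\<close>.\<close>
  let ?g = "\<lambda>x. ((flat (j + 2) (1 + x) * flat k (1 - x)
                  + (- real j) * (flat (j + 1) (1 + x) * flat k (1 - x)))
                + ((-1) * (flat j (1 + x) * flat (k + 2) (1 - x))
                  + real k * (flat j (1 + x) * flat (k + 1) (1 - x))))"
  have "?g \<in> bumps" by (intro bumps.intros)
  moreover have "((\<lambda>x. flat j (1 + x) * flat k (1 - x)) has_real_derivative ?g x) (at x)" for x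
  proof -
    have 1: "((\<lambda>x. flat j (1 + x)) has_real_derivative
        (flat (j + 2) (1 + x) - real j * flat (j + 1) (1 + x))) (at x)"
      by (rule DERIV_cong[OF DERIV_chain2[where g = "\<lambda>x. 1 + x", OF flat_derivative]])
        (auto intro!: derivative_eq_intros)
    have 2: "((\<lambda>x. flat k (1 - x)) has_real_derivative
        - (flat (k + 2) (1 - x) - real k * flat (k + 1) (1 - x))) (at x)"
      by (rule DERIV_cong[OF DERIV_chain2[where g = "\<lambda>x. 1 - x" and Db = "-1", OF flat_derivative]])
        (auto intro!: derivative_eq_intros)
    show ?thesis
      by (rule DERIV_cong[OF DERIV_mult[OF 1 2]]) (simp add: algebra_simps)
  qed
  ultimately show ?case by (intro bexI[of _ ?g] allI)
next
  case (add g h)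
  then obtain g' h' where "g' \<in> bumps" "h' \<in> bumps"
    "\<forall>x. (g has_real_derivative g' x) (at x)" "\<forall>x. (h has_real_derivative h' x) (at x)" by blast
  then show ?case
    by (intro bexI[of _ "\<lambda>x. g' x + h' x"]) (auto intro!: bumps.intros derivative_intros)
next
  case (scale g a)
  then obtain g' where "g' \<in> bumps" "\<forall>x. (g has_real_derivative g' x) (at x)" by blast
  then show ?case
    by (intro bexI[of _ "\<lambda>x. a * g' x"]) (auto intro!: bumps.intros DERIV_cmult)
qed

lemma deriv_funpow_closed:
  fixes g :: "real \<Rightarrow> real"
  assumes "g \<in> X" "\<And>h. h \<in> X \<Longrightarrow> \<exists>h'\<in>X. \<forall>x. (h has_real_derivative h' x) (at x)"
  shows "(deriv ^^ k) g \<in> X"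
proof (induction k)
  case (Suc k)
  then obtain h' where "h' \<in> X" "\<forall>x. ((deriv ^^ k) g has_real_derivative h' x) (at x)"
    using assms(2) by blast
  moreover from this have "deriv ((deriv ^^ k) g) = h'" using DERIV_imp_deriv by blast
  ultimately show ?case by simp
qed (simp add: assms)

text \<open>\<open>B\<close> is the antiderivative of one bump, normalised to climb from 0 to 1.
  Membership of \<open>\<beta>\<close> in \<open>bumps\<close> stands for all higher
  derivatives.\<close>

lemma smooth_step_exists:
  obtains B \<beta> :: "real \<Rightarrow> real" where
    "\<And>x. (B has_real_derivative \<beta> x) (at x)" "\<beta> \<in> bumps"
    "\<And>x. x \<le> -1 \<Longrightarrow> B x = 0" "\<And>x. 1 \<le> x \<Longrightarrow> B x = 1" "\<And>x. 0 \<le> B x" "\<And>x. B x \<le> 1"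
    "\<And>x. 0 \<le> \<beta> x" "\<And>x. x \<notin> {-1..1} \<Longrightarrow> \<beta> x = 0"
proof -
  define b where "b = (\<lambda>x. flat 0 (1 + x) * flat 0 (1 - x))"
  have bB: "b \<in> bumps" unfolding b_def by (rule bumps.base)
  have b_cont: "isCont b x" for x
    using bumps_derivative[OF bB] DERIV_isCont by blast
  obtain F where F: "\<And>x. (F has_real_derivative b x) (at x)"
    using einterval_antiderivative[of "-\<infinity>" "\<infinity>" b] b_cont
    by (auto simp: has_real_derivative_iff_has_vector_derivative)
  have b0: "0 \<le> b x" for x by (simp add: b_def flat_def)
  have bz: "b x = 0" if "x \<notin> {-1<..<1}" for x using that by (auto simp: b_def flat_def)
  have bp: "0 < b x" if "x \<in> {-1<..<1}" for x using that by (auto simp: b_def flat_def)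
  have mono: "F x \<le> F y" if "x \<le> y" for x y
    using that by (rule DERIV_nonneg_imp_nondecreasing) (use F b0 in blast)
  \<comment> \<open>The interval is shrunk because strict growth is derived from a derivative that
    is positive at the endpoints too, and \<open>b\<close> vanishes at -1 and 1.\<close>
  have "F (-1/2) < F (1/2)"
    by (rule DERIV_pos_imp_increasing) (auto intro!: exI F bp)
  then have pos: "F (-1) < F 1" using mono[of "-1" "-1/2"] mono[of "1/2" 1] by simp
  have le: "F x = F (-1)" if "x \<le> -1" for x
  proof (cases "x = -1")
    case False
    then have "x < -1" using that by simp
    from MVT2[OF this, of F b] obtain z where "x < z" "z < -1" "F (-1) - F x = (-1 - x) * b z"
      using F by blast
    then show ?thesis using bz[of z] by simp
  qed simp
  have ge: "F x = F 1" if "1 \<le> x" for x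
  proof (cases "x = 1")
    case False
    then have "1 < x" using that by simp
    from MVT2[OF this, of F b] obtain z where "1 < z" "z < x" "F x - F 1 = (x - 1) * b z"
      using F by blast
    then show ?thesis using bz[of z] by simp
  qed simp
  define c where "c = F 1 - F (-1)"
  have c: "c > 0" using pos by (simp add: c_def)
  define B where "B x = (F x - F (-1)) / c" for x
  have "(\<lambda>x. (1 / c) * b x) \<in> bumps" by (rule bumps.scale) (rule bB)
  moreover have "(B has_real_derivative (1 / c) * b x) (at x)" for x
    unfolding B_def by (rule DERIV_cong[OF DERIV_cdivide[OF DERIV_diff[OF F DERIV_const]]]) simp
  moreover have "0 \<le> B x" for x
  proof -
    have "F (-1) \<le> F x" using mono[of "-1" x] le[of x] by linarith
    then show ?thesis using c by (simp add: B_def)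
  qed
  moreover have "B x \<le> 1" for x
  proof -
    have "F x \<le> F 1" using mono[of x 1] ge[of x] by linarith
    then show ?thesis using c by (simp add: B_def c_def)
  qed
  moreover have "B x = 0" if "x \<le> -1" for x using le[OF that] by (simp add: B_def)
  moreover have "B x = 1" if "1 \<le> x" for x using ge[OF that] c by (simp add: B_def c_def)
  moreover have "0 \<le> (1 / c) * b x" for x using c b0[of x] by simp
  moreover have "(1 / c) * b x = 0" if "x \<notin> {-1..1}" for x
  proof -
    have "x \<notin> {-1<..<1}" using that by auto
    from bz[OF this] show ?thesis by simp
  qed
  ultimately show thesis by (intro that[of B "\<lambda>x. (1 / c) * b x"])
qed

section \<open>Smooth cutoffs of an interval and increments of a function with a weak
  derivative\<close>

lemma DERIV_rescale:
  fixes g :: "real \<Rightarrow> real"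
  assumes "\<forall>x. (g has_real_derivative g' x) (at x)" "e \<noteq> 0"
  shows "((\<lambda>t. g ((t - c) / e)) has_real_derivative g' ((t - c) / e) / e) (at t)"
proof -
  have "((\<lambda>t. (t - c) / e) has_real_derivative 1 / e) (at t)"
    using assms(2) by (auto intro!: derivative_eq_intros)
  from DERIV_chain2[OF _ this, of g "g' ((t - c) / e)"] show ?thesis
    using assms(1) by simp
qed

text \<open>Two centres suffice: the cutoff of \<open>{a..b}\<close> is a difference of two rescaled
  steps, and differentiation keeps this shape while dividing the coefficients by
  \<open>e\<close>.\<close>

inductive_set rescaled_bumps :: "real \<Rightarrow> real \<Rightarrow> real \<Rightarrow> (real \<Rightarrow> real) set" for e a b where
  "g \<in> bumps \<Longrightarrow> g' \<in> bumps \<Longrightarrow> (\<lambda>t. p * g ((t - a) / e) + q * g' ((t - b) / e)) \<in> rescaled_bumps e a b"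

lemma rescaled_bumps_derivative:
  assumes "f \<in> rescaled_bumps e a b" "e \<noteq> 0"
  shows "\<exists>f'\<in>rescaled_bumps e a b. \<forall>x. (f has_real_derivative f' x) (at x)"
  using assms(1)
proof cases
  case (1 g g' p q)
  obtain G where G: "G \<in> bumps" "\<forall>x. (g has_real_derivative G x) (at x)"
    using bumps_derivative[OF 1(2)] by blast
  obtain G' where G': "G' \<in> bumps" "\<forall>x. (g' has_real_derivative G' x) (at x)"
    using bumps_derivative[OF 1(3)] by blast
  note * = DERIV_rescale[OF G(2) assms(2)] DERIV_rescale[OF G'(2) assms(2)]
  have "(f has_real_derivative (p / e) * G ((t - a) / e) + (q / e) * G' ((t - b) / e)) (at t)" for t
    unfolding 1(1) by (rule DERIV_cong[OF DERIV_add[OF DERIV_cmult[OF *(1)] DERIV_cmult[OF *(2)]]]) simp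
  then show ?thesis by (intro bexI[OF _ rescaled_bumps.intros[OF G(1) G'(1)]]) blast
qed

text \<open>Testing the weak derivative with smooth approximations of the indicator of \<open>[a,b]\<close>.\<close>

lemma weak_derivative_imp_increment:
  fixes h w :: "real \<Rightarrow> real"
  assumes h: "continuous_on {0..} h"
    and w: "\<And>T. set_integrable lebesgue {0..T} w"
    and weak: "\<And>\<psi>. test_function {0<..} \<psi> \<Longrightarrow>
      (\<integral>t. deriv \<psi> t * h t \<partial>lebesgue_on {0<..}) = - (\<integral>t. \<psi> t * w t \<partial>lebesgue_on {0<..})"
    and ab: "0 < a" "a < b"
  shows "h b - h a = (LINT t:{a..b}|lebesgue. w t)"
proof -
  obtain B \<beta> where B: "\<And>x. (B has_real_derivative \<beta> x) (at x)" and \<beta>: "\<beta> \<in> bumps"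
    and B0: "\<And>x. x \<le> -1 \<Longrightarrow> B x = 0" and B1: "\<And>x. 1 \<le> x \<Longrightarrow> B x = 1"
    and B_nn: "\<And>x. 0 \<le> B x" and B_le: "\<And>x. B x \<le> 1"
    and \<beta>0: "\<And>x. 0 \<le> \<beta> x" and \<beta>z: "\<And>x. x \<notin> {-1..1} \<Longrightarrow> \<beta> x = 0"
    using smooth_step_exists by metis
  have \<beta>_cont: "continuous_on UNIV \<beta>"
    using bumps_derivative[OF \<beta>] DERIV_isCont continuous_at_imp_continuous_on by blast
  have B_cont: "continuous_on UNIV B"
    using B DERIV_isCont continuous_at_imp_continuous_on by blast
  \<comment> \<open>Constant extension to the left of 0, so that continuity holds on the whole
    line.\<close>
  define k where "k = (\<lambda>t. h (max 0 t))"
  have k_cont: "continuous_on UNIV k"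
    unfolding k_def by (rule continuous_on_compose2[OF h]) (auto intro!: continuous_intros)
  \<comment> \<open>A width of at most \<open>a / 2\<close> keeps the cutoff away from time 0, as a
    test function on \<open>{0<..}\<close> requires; a width of at most \<open>b\<close> ends it
    before \<open>2 * b\<close>.\<close>
  define e where "e n = min a (b - a) / (2 + real n)" for n :: nat
  have e: "0 < e n" "e n \<le> a / 2" "e n \<le> (b - a) / 2" "e n \<le> b" for n
  proof -
    show "0 < e n" using ab by (simp add: e_def)
    have "e n \<le> min a (b - a) / 2" unfolding e_def
      using ab by (intro divide_left_mono) auto
    then show "e n \<le> a / 2" "e n \<le> (b - a) / 2" "e n \<le> b" using ab by (auto simp: min_def split: if_splits)
  qed
  have e_lim: "e \<longlonglongrightarrow> 0"
    unfolding e_def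
    by (rule tendsto_divide_0[OF tendsto_const])
       (intro filterlim_at_top_imp_at_infinity filterlim_tendsto_add_at_top[OF tendsto_const] filterlim_real_sequentially)
  define \<psi> where "\<psi> n t = B ((t - a) / e n) - B ((t - b) / e n)" for n t
  have d\<psi>: "(\<psi> n has_real_derivative (\<beta> ((t - a) / e n) - \<beta> ((t - b) / e n)) / e n) (at t)" for n t
  proof -
    have "\<forall>x. (B has_real_derivative \<beta> x) (at x)" "e n \<noteq> 0" using B e(1)[of n] by auto
    from DERIV_diff[OF DERIV_rescale[OF this, of a t] DERIV_rescale[OF this, of b t]] show ?thesis
      unfolding \<psi>_def by (simp add: diff_divide_distrib)
  qed
  have deriv\<psi>: "deriv (\<psi> n) t = (\<beta> ((t - a) / e n) - \<beta> ((t - b) / e n)) / e n" for n t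
    using d\<psi> DERIV_imp_deriv by blast
  have \<psi>0: "\<psi> n t = 0" if "t \<notin> {a/2..2*b}" for n t
  proof (cases "t < a/2")
    case True
    then have "(t - a) / e n \<le> -1" "(t - b) / e n \<le> -1"
      using e[of n] ab by (auto simp: field_simps)
    then show ?thesis by (simp add: \<psi>_def B0)
  next
    case False
    then have "1 \<le> (t - a) / e n" "1 \<le> (t - b) / e n"
      using that e[of n] ab by (auto simp: field_simps)
    then show ?thesis by (simp add: \<psi>_def B1)
  qed
  have test: "test_function {0<..} (\<psi> n)" for n
    unfolding test_function_def
  proof (intro conjI allI exI)
    fix m t
    have "deriv (\<psi> n) = (\<lambda>t. (1 / e n) * \<beta> ((t - a) / e n) + (- (1 / e n)) * \<beta> ((t - b) / e n))"
      by (simp add: fun_eq_iff deriv\<psi> diff_divide_distrib)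
    then have "deriv (\<psi> n) \<in> rescaled_bumps (e n) a b"
      using rescaled_bumps.intros[OF \<beta> \<beta>] by metis
    moreover have en: "e n \<noteq> 0" using e(1)[of n] by simp
    ultimately have D: "(deriv ^^ l) (deriv (\<psi> n)) \<in> rescaled_bumps (e n) a b" for l
      by (intro deriv_funpow_closed[OF _ rescaled_bumps_derivative])
    show "(deriv ^^ m) (\<psi> n) field_differentiable at t"
    proof (cases m)
      case 0
      then show ?thesis using d\<psi>[of n t] by (auto simp: field_differentiable_def)
    next
      case (Suc l)
      then show ?thesis using rescaled_bumps_derivative[OF D[of l] en]
        unfolding field_differentiable_def by (auto simp: funpow_swap1)
    qed
  next
    show "compact {a/2..2*b}" by simp
    show "{a/2..2*b} \<subseteq> {0<..}" using ab by auto
  qed (use \<psi>0 in blast)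
  have [measurable]: "\<beta> \<in> borel_measurable borel" "k \<in> borel_measurable borel" "B \<in> borel_measurable borel"
    using \<beta>_cont k_cont B_cont by (auto intro: borel_measurable_continuous_onI)
  \<comment> \<open>An approximate identity at \<open>c\<close>: nonnegative, of unit mass,
    supported within \<open>e n\<close> of \<open>c\<close>. The derivative of the cutoff is
    \<open>G a n - G b n\<close>, which produces \<open>h a - h b\<close> in the limit.\<close>
  define G where "G c n t = \<beta> ((t - c) / e n) / e n" for c n t
  have G0: "0 \<le> G c n t" for c n t using \<beta>0 e(1)[of n] by (simp add: G_def)
  have Gz: "G c n t = 0" if "t \<notin> {c - e n..c + e n}" for c n t
  proof -
    have "(t - c) / e n \<notin> {-1..1}" using that e(1)[of n] by (auto simp: field_simps)
    then show ?thesis by (simp add: G_def \<beta>z)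
  qed
  have G_cont: "continuous_on S (G c n)" for S c n
    unfolding G_def using e(1)[of n]
    by (intro continuous_intros continuous_on_compose2[OF \<beta>_cont]) auto
  have G1: "integrable lborel (G c n)" "(\<integral>t. G c n t \<partial>lborel) = 1" for c n
  proof -
    have ba: "\<forall>x. (B has_real_derivative \<beta> x) (at x)" "e n \<noteq> 0" using B e(1)[of n] by auto
    have "has_bochner_integral lborel (\<lambda>t. indicator {c - e n..c + e n} t *\<^sub>R G c n t)
        (B ((c + e n - c) / e n) - B ((c - e n - c) / e n))"
    proof (rule has_bochner_integral_FTC_Icc)
      show "((\<lambda>t. B ((t - c) / e n)) has_vector_derivative G c n t) (at t within {c - e n..c + e n})" for t
        using DERIV_rescale[OF ba, of c t] unfolding G_def
        by (auto simp: has_real_derivative_iff_has_vector_derivative intro: has_vector_derivative_at_within)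
    qed (use e(1)[of n] G_cont in auto)
    moreover have "(\<lambda>t. indicator {c - e n..c + e n} t *\<^sub>R G c n t) = G c n"
      using Gz[of _ c n] by (auto simp: fun_eq_iff indicator_def)
    moreover have "B ((c + e n - c) / e n) = 1" "B ((c - e n - c) / e n) = 0" using e(1)[of n] B0 B1 by auto
    ultimately show "integrable lborel (G c n)" "(\<integral>t. G c n t \<partial>lborel) = 1"
      by (auto simp: has_bochner_integral_iff)
  qed
  have ik: "integrable lborel (\<lambda>t. G c n t * k t)" for c n
  proof -
    have "set_integrable lborel {c - e n..c + e n} (\<lambda>t. G c n t * k t)"
      by (intro borel_integrable_atLeastAtMost' continuous_on_mult G_cont continuous_on_subset[OF k_cont]) auto
    then show ?thesis unfolding set_integrable_def
      by (elim Bochner_Integration.integrable_cong[THEN iffD1, rotated 2])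
        (use Gz[of _ c n] in \<open>auto simp: indicator_def\<close>)
  qed
  have kernel_lim: "(\<lambda>n. \<integral>t. G c n t * k t \<partial>lborel) \<longlonglongrightarrow> k c" for c
  proof (rule metric_LIMSEQ_I)
    fix \<epsilon> :: real assume \<epsilon>: "0 < \<epsilon>"
    have "isCont k c" using k_cont by (simp add: continuous_on_eq_continuous_at)
    then obtain \<delta> where \<delta>: "0 < \<delta>" "\<And>t. \<bar>t - c\<bar> < \<delta> \<Longrightarrow> \<bar>k t - k c\<bar> < \<epsilon> / 2"
      using \<epsilon> unfolding continuous_at_eps_delta dist_real_def by (meson half_gt_zero)
    obtain n0 where n0: "\<And>n. n0 \<le> n \<Longrightarrow> e n < \<delta>"
      using order_tendstoD(2)[OF e_lim \<delta>(1)] by (auto simp: eventually_sequentially)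
    have "dist (\<integral>t. G c n t * k t \<partial>lborel) (k c) < \<epsilon>" if n: "n0 \<le> n" for n
    proof -
      have i: "integrable lborel (\<lambda>t. G c n t * k t - G c n t * k c)" using ik G1(1) by simp
      have "\<bar>(\<integral>t. G c n t * k t \<partial>lborel) - k c\<bar> = \<bar>\<integral>t. G c n t * k t - G c n t * k c \<partial>lborel\<bar>"
        using ik G1 by simp
      also have "\<dots> \<le> (\<integral>t. \<bar>G c n t * k t - G c n t * k c\<bar> \<partial>lborel)" by (rule integral_abs_bound)
      also have "\<dots> \<le> (\<integral>t. G c n t * (\<epsilon> / 2) \<partial>lborel)"
      proof (rule integral_mono)
        fix t
        show "\<bar>G c n t * k t - G c n t * k c\<bar> \<le> G c n t * (\<epsilon> / 2)"
        proof (cases "t \<in> {c - e n..c + e n}")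
          case True
          then have "\<bar>t - c\<bar> < \<delta>" using n0[OF n] by auto
          from mult_left_mono[OF less_imp_le[OF \<delta>(2)[OF this]] G0[of c n t]]
          show ?thesis using G0[of c n t] by (simp only: abs_mult abs_of_nonneg flip: right_diff_distrib)
        qed (simp add: Gz)
      qed (use i G1(1) in auto)
      also have "\<dots> = \<epsilon> / 2" using G1(2) by simp
      finally show ?thesis using \<epsilon> by (simp add: dist_real_def)
    qed
    then show "\<exists>n0. \<forall>n\<ge>n0. dist (\<integral>t. G c n t * k t \<partial>lborel) (k c) < \<epsilon>" by blast
  qed
  have lhs: "(\<integral>t. deriv (\<psi> n) t * h t \<partial>lebesgue_on {0<..}) = (\<integral>t. G a n t * k t \<partial>lborel) - (\<integral>t. G b n t * k t \<partial>lborel)" for n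
  proof -
    have "(\<integral>t. deriv (\<psi> n) t * h t \<partial>lebesgue_on {0<..}) = (\<integral>t. indicator {0<..} t *\<^sub>R (deriv (\<psi> n) t * h t) \<partial>lebesgue)"
      by (rule integral_restrict_space) simp
    also have "\<dots> = (\<integral>t. G a n t * k t - G b n t * k t \<partial>lebesgue)"
    proof (rule Bochner_Integration.integral_cong)
      fix t
      have "G c n t = 0" if "t \<le> 0" "c \<in> {a,b}" for c
        using that e[of n] ab by (intro Gz) auto
      then show "indicator {0<..} t *\<^sub>R (deriv (\<psi> n) t * h t) = G a n t * k t - G b n t * k t"
        by (cases "t \<le> 0") (auto simp: deriv\<psi> G_def k_def left_diff_distrib diff_divide_distrib)
    qed simp
    also have "\<dots> = (\<integral>t. G a n t * k t - G b n t * k t \<partial>lborel)"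
      by (rule integral_completion) (simp add: G_def)
    also have "\<dots> = (\<integral>t. G a n t * k t \<partial>lborel) - (\<integral>t. G b n t * k t \<partial>lborel)"
      by (rule Bochner_Integration.integral_diff[OF ik ik])
    finally show ?thesis .
  qed
  have L: "(\<lambda>n. \<integral>t. deriv (\<psi> n) t * h t \<partial>lebesgue_on {0<..}) \<longlonglongrightarrow> h a - h b"
    using tendsto_diff[OF kernel_lim[of a] kernel_lim[of b]] ab by (simp add: lhs k_def)
  have "(\<lambda>n. \<integral>t. indicator {0..2*b} t *\<^sub>R (\<psi> n t * w t) \<partial>lebesgue) \<longlonglongrightarrow> (\<integral>t. indicator {a..b} t *\<^sub>R w t \<partial>lebesgue)"
  proof (rule integral_dominated_convergence[where w = "\<lambda>t. \<bar>indicator {0..2*b} t *\<^sub>R w t\<bar>"])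
    have wi: "integrable lebesgue (\<lambda>t. indicator {0..2*b} t *\<^sub>R w t)"
      using w[of "2*b"] by (simp add: set_integrable_def)
    then show "integrable lebesgue (\<lambda>t. \<bar>indicator {0..2*b} t *\<^sub>R w t\<bar>)" by simp
    have [measurable]: "(\<lambda>t. indicator {0..2*b} t *\<^sub>R w t) \<in> borel_measurable lebesgue" using wi by simp
    have "(\<lambda>t. indicator {a..b} t * (indicator {0..2*b} t *\<^sub>R w t)) \<in> borel_measurable lebesgue"
      by (intro borel_measurable_times borel_measurable_indicator borel_measurable_integrable[OF wi]) simp
    moreover have "(\<lambda>t. indicator {a..b} t * (indicator {0..2*b} t *\<^sub>R w t)) = (\<lambda>t. indicator {a..b} t *\<^sub>R w t)"
      using ab by (auto simp: fun_eq_iff indicator_def)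
    ultimately show "(\<lambda>t. indicator {a..b} t *\<^sub>R w t) \<in> borel_measurable lebesgue" by simp
    fix n
    have [measurable]: "\<psi> n \<in> borel_measurable lebesgue"
      by (rule measurable_completion) (simp add: \<psi>_def[abs_def])
    have "(\<lambda>t. \<psi> n t * (indicator {0..2*b} t *\<^sub>R w t)) \<in> borel_measurable lebesgue"
      by measurable
    then show "(\<lambda>t. indicator {0..2*b} t *\<^sub>R (\<psi> n t * w t)) \<in> borel_measurable lebesgue"
      by (simp add: mult.left_commute)
    have "\<bar>\<psi> n t\<bar> \<le> 1" for t using B_nn[of "(t - a) / e n"] B_le[of "(t - a) / e n"]
        B_nn[of "(t - b) / e n"] B_le[of "(t - b) / e n"] by (auto simp: \<psi>_def)
    then show "AE t in lebesgue. norm (indicator {0..2*b} t *\<^sub>R (\<psi> n t * w t)) \<le> \<bar>indicator {0..2*b} t *\<^sub>R w t\<bar>"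
      by (intro AE_I2) (auto simp: abs_mult indicator_def mult_left_le_one_le)
  next
    \<comment> \<open>At the endpoints the cutoffs need not converge to the indicator; both points
      are discarded as null sets.\<close>
    have "AE t in lebesgue. t \<noteq> a \<and> t \<noteq> b"
      using AE_lborel_singleton[of a] AE_lborel_singleton[of b] by (intro AE_completion) auto
    then show "AE t in lebesgue. (\<lambda>n. indicator {0..2*b} t *\<^sub>R (\<psi> n t * w t)) \<longlonglongrightarrow> indicator {a..b} t *\<^sub>R w t"
    proof (rule AE_mp, intro AE_I2 impI)
      fix t assume t: "t \<noteq> a \<and> t \<noteq> b"
      have step: "\<forall>\<^sub>F n in sequentially. B ((t - c) / e n) = indicator {c..} t" if "t \<noteq> c" for c
      proof -
        have "\<forall>\<^sub>F n in sequentially. e n < \<bar>t - c\<bar>"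
          using order_tendstoD(2)[OF e_lim, of "\<bar>t - c\<bar>"] that by simp
        then show ?thesis
        proof (rule eventually_mono)
          fix n assume n: "e n < \<bar>t - c\<bar>"
          show "B ((t - c) / e n) = indicator {c..} t"
          proof (cases "c < t")
            case True
            then have "1 \<le> (t - c) / e n" using n e(1)[of n] by (simp add: field_simps)
            then show ?thesis using True by (simp add: B1)
          next
            case False
            then have "(t - c) / e n \<le> -1" using n e(1)[of n] by (simp add: field_simps)
            then show ?thesis using False that by (simp add: B0)
          qed
        qed
      qed
      have "\<forall>\<^sub>F n in sequentially. indicator {a..b} t *\<^sub>R w t = indicator {0..2*b} t *\<^sub>R (\<psi> n t * w t)"
        using step[OF conjunct1[OF t]] step[OF conjunct2[OF t]]
        by eventually_elim (use ab t in \<open>auto simp: \<psi>_def indicator_def\<close>)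
      then show "(\<lambda>n. indicator {0..2*b} t *\<^sub>R (\<psi> n t * w t)) \<longlonglongrightarrow> indicator {a..b} t *\<^sub>R w t"
        by (rule Lim_transform_eventually[OF tendsto_const])
    qed
  qed
  moreover have "(\<integral>t. indicator {0..2*b} t *\<^sub>R (\<psi> n t * w t) \<partial>lebesgue) = (\<integral>t. \<psi> n t * w t \<partial>lebesgue_on {0<..})" for n
  proof -
    have "(\<integral>t. \<psi> n t * w t \<partial>lebesgue_on {0<..}) = (\<integral>t. indicator {0<..} t *\<^sub>R (\<psi> n t * w t) \<partial>lebesgue)"
      by (rule integral_restrict_space) simp
    also have "\<dots> = (\<integral>t. indicator {0..2*b} t *\<^sub>R (\<psi> n t * w t) \<partial>lebesgue)"
      by (rule Bochner_Integration.integral_cong) (use \<psi>0[of _ n] ab in \<open>auto simp: indicator_def\<close>)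
    finally show ?thesis by simp
  qed
  ultimately have "(\<lambda>n. - (\<integral>t. \<psi> n t * w t \<partial>lebesgue_on {0<..})) \<longlonglongrightarrow> - (LINT t:{a..b}|lebesgue. w t)"
    by (simp add: set_lebesgue_integral_def tendsto_minus)
  with L have "h a - h b = - (LINT t:{a..b}|lebesgue. w t)"
    using weak[OF test] LIMSEQ_unique by fastforce
  then show ?thesis by simp
qed

section \<open>The fractional Sobolev inequality\<close>

text \<open>The ball of radius \<open>\<rho>\<close> around \<open>x\<close> has twice the measure
  of \<open>E\<close>, so it keeps at least the measure of \<open>E\<close> outside
  \<open>E\<close>, and there the kernel is at most \<open>\<rho> powr (N + s)\<close>. The bound is
  the same for every centre \<open>x\<close>, at the price of a constant that is not sharp.\<close>

lemma kernel_complement_lower_bound: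
  fixes x :: "real^'n" and E :: "(real^'n) set" and s :: real
  defines "N \<equiv> real CARD('n)"
  defines "\<omega> \<equiv> measure lborel (ball (0::real^'n) 1)"
  assumes s: "0 < s" and E: "E \<in> sets borel" and fin: "emeasure lborel E < \<infinity>" and m: "0 < measure lborel E"
  shows "ennreal ((2 / \<omega>) powr (- (1 + s / N)) * measure lborel E powr (- (s / N)))
    \<le> (\<integral>\<^sup>+y. ennreal (1 / kernel s x y) * indicator (- E) y \<partial>lborel)"
proof -
  define m where "m = measure lborel E"
  define \<rho> where "\<rho> = (2 * m / \<omega>) powr (1 / N)"
  have \<omega>: "0 < \<omega>" unfolding \<omega>_def by (simp add: content_ball_pos)
  have N: "1 \<le> N" by (simp add: N_def Suc_leI)
  have m0: "0 < m" using m by (simp add: m_def)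
  have \<rho>: "0 < \<rho>" using \<omega> m0 by (simp add: \<rho>_def)
  have \<rho>N: "\<rho> powr N = 2 * m / \<omega>"
    using N \<omega> m0 by (simp add: \<rho>_def powr_powr)
  have ball: "measure lborel (ball x \<rho>) = 2 * m"
  proof -
    have "measure lborel (ball x \<rho>) = \<rho> ^ CARD('n) * \<omega>"
      using content_ball_conv_unit_ball[of \<rho> x] \<rho> by (simp add: \<omega>_def)
    also have "\<dots> = 2 * m" using \<rho>N \<rho> \<omega> by (simp add: N_def powr_realpow)
    finally show ?thesis .
  qed
  \<comment> \<open>The centre is removed because \<open>1 / kernel s x x = 1 / 0 = 0\<close>.\<close>
  define A where "A = ball x \<rho> - {x} - E"
  have A: "A \<in> sets lborel" using E by (simp add: A_def)
  have Em: "emeasure lborel E = ennreal m"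
    using fin by (simp add: m_def emeasure_eq_ennreal_measure)
  have "ennreal (2 * m) = emeasure lborel (ball x \<rho>)"
    using ball emeasure_lborel_ball_finite[of x \<rho>] by (simp add: emeasure_eq_ennreal_measure)
  also have "\<dots> \<le> emeasure lborel (A \<union> ({x} \<union> E))"
    by (rule emeasure_mono) (use A E in \<open>auto simp: A_def\<close>)
  also have "\<dots> \<le> emeasure lborel A + emeasure lborel ({x} \<union> E)"
    using A E by (intro emeasure_subadditive) auto
  also have "\<dots> \<le> emeasure lborel A + (emeasure lborel {x} + emeasure lborel E)"
    using A E by (intro add_left_mono emeasure_subadditive) auto
  finally have "ennreal m + ennreal m \<le> emeasure lborel A + ennreal m"
    using m0 Em by (simp flip: ennreal_plus)
  then have Am: "ennreal m \<le> emeasure lborel A"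
    unfolding add.commute[of "emeasure lborel A"] ennreal_add_left_cancel_le by simp
  have c: "(2 / \<omega>) powr (- (1 + s / N)) * m powr (- (s / N)) = \<rho> powr (- (N + s)) * m"
  proof -
    have "\<rho> powr (- (N + s)) = (2 / \<omega> * m) powr (- (1 + s / N))"
    proof -
      have "1 / N * - (N + s) = - (1 + s / N)" using N by (simp add: field_simps)
      then show ?thesis by (simp only: \<rho>_def powr_powr mult.commute times_divide_eq_left times_divide_eq_right)
    qed
    also have "\<dots> = (2 / \<omega>) powr (- (1 + s / N)) * m powr (- (1 + s / N))"
      by (rule powr_mult)
    finally have "\<rho> powr (- (N + s)) * m = (2 / \<omega>) powr (- (1 + s / N)) * (m powr (- (1 + s / N)) * m powr 1)"
      using m0 by simp
    also have "m powr (- (1 + s / N)) * m powr 1 = m powr (- (s / N))"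
      unfolding powr_add[symmetric] by simp
    finally show ?thesis by simp
  qed
  have "ennreal (\<rho> powr (- (N + s)) * m) \<le> ennreal (\<rho> powr (- (N + s))) * emeasure lborel A"
    using Am by (simp add: ennreal_mult' mult_left_mono)
  also have "\<dots> = (\<integral>\<^sup>+y. ennreal (\<rho> powr (- (N + s))) * indicator A y \<partial>lborel)"
    using A by (simp add: nn_integral_cmult_indicator)
  also have "\<dots> \<le> (\<integral>\<^sup>+y. ennreal (1 / kernel s x y) * indicator (- E) y \<partial>lborel)"
  proof (rule nn_integral_mono)
    fix y
    show "ennreal (\<rho> powr (- (N + s))) * indicator A y \<le> ennreal (1 / kernel s x y) * indicator (- E) y"
    proof (cases "y \<in> A")
      case True
      then have y: "0 < norm (x - y)" "norm (x - y) \<le> \<rho>" "y \<notin> E" by (auto simp: A_def dist_norm)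
      have "norm (x - y) powr (N + s) \<le> \<rho> powr (N + s)"
        using y N s by (intro powr_mono2) auto
      then have "\<rho> powr (- (N + s)) \<le> 1 / norm (x - y) powr (N + s)"
        unfolding powr_minus_divide using y \<rho> by (intro divide_left_mono) auto
      then show ?thesis using True y by (simp add: kernel_def N_def)
    qed simp
  qed
  finally show ?thesis using c unfolding m_def by simp
qed

section \<open>From level sets to powers\<close>

lemma borel_measurable_kernel [measurable]:
  "(\<lambda>z. kernel s (fst z) (snd z)) \<in> borel_measurable (borel :: ((real^'n) \<times> (real^'n)) measure)"
proof -
  have [measurable]: "fst \<in> (borel :: ((real^'n) \<times> (real^'n)) measure) \<rightarrow>\<^sub>M borel"
    "snd \<in> (borel :: ((real^'n) \<times> (real^'n)) measure) \<rightarrow>\<^sub>M borel"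
    by (simp_all add: measurable_fst' borel_prod[symmetric])
  show ?thesis unfolding kernel_def by measurable
qed

lemma borel_measurable_case_kernel [measurable]:
  "(\<lambda>(x, y). kernel s x y) \<in> borel_measurable (borel \<Otimes>\<^sub>M borel :: ((real^'n) \<times> (real^'n)) measure)"
  using borel_measurable_kernel[of s, where 'n = 'n] by (simp add: borel_prod case_prod_beta)

lemma kernel_nonneg: "0 \<le> kernel s x y"
  by (simp add: kernel_def)

text \<open>Coarea formula: \<open>max 0 (u x - u y)\<close> is the measure of the levels \<open>t\<close> with \<open>u y \<le> t < u x\<close>.\<close>

lemma superlevel_integral_le:
  fixes u :: "real^'n \<Rightarrow> real" and s :: real
  defines "N \<equiv> real CARD('n)"
  defines "c \<equiv> (2 / measure lborel (ball (0::real^'n) 1)) powr (- (1 + s / N))"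
  assumes s: "0 < s" and u[measurable]: "u \<in> borel_measurable borel"
    and fin: "\<And>t. 0 < t \<Longrightarrow> emeasure lborel {x. t < u x} < \<infinity>"
  shows "(\<integral>\<^sup>+t. ennreal (c * measure lborel {x. t < u x} powr (1 - s / N)) * indicator {0<..} t \<partial>lborel)
     \<le> (\<integral>\<^sup>+x. \<integral>\<^sup>+y. ennreal (\<bar>u x - u y\<bar> / kernel s x y) \<partial>lborel \<partial>lborel)"
proof -
  \<comment> \<open>\<open>?I x y t\<close> puts the weight of the pair on each positive level
    \<open>t\<close> that separates \<open>u y\<close> from \<open>u x\<close>. For fixed
    \<open>t\<close> the integral over \<open>x\<close> and \<open>y\<close> is the fractional
    perimeter of a superlevel set; the integral over \<open>t\<close> is at most
    \<open>\<bar>u x - u y\<bar> / kernel s x y\<close>.\<close>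
  let ?I = "\<lambda>x y t. ennreal (1 / kernel s x y) * (indicator {t. 0 < t \<and> u y \<le> t \<and> t < u x} t :: ennreal)"
  have "ennreal (c * measure lborel {x. t < u x} powr (1 - s / N)) * indicator {0<..} t
      \<le> (\<integral>\<^sup>+x. \<integral>\<^sup>+y. ?I x y t \<partial>lborel \<partial>lborel)" for t
  proof (cases "0 < t \<and> 0 < measure lborel {x. t < u x}")
    case True
    let ?E = "{x. t < u x}"
    define m where "m = measure lborel ?E"
    have m0: "0 < m" using True by (simp add: m_def)
    have E: "?E \<in> sets borel" by measurable
    have Em: "emeasure lborel ?E = ennreal m"
      using fin[of t] True by (simp add: m_def emeasure_eq_ennreal_measure)
    have "m powr (- (s / N)) * m = m powr (1 - s / N)"
      using m0 powr_add[of m "- (s / N)" 1] by simp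
    then have "ennreal (c * m powr (1 - s / N)) = ennreal (c * m powr (- (s / N))) * emeasure lborel ?E"
      unfolding Em using m0 by (simp add: c_def mult.assoc flip: ennreal_mult')
    also have "\<dots> = (\<integral>\<^sup>+x. ennreal (c * m powr (- (s / N))) * indicator ?E x \<partial>lborel)"
      using E by (simp add: nn_integral_cmult_indicator)
    also have "\<dots> \<le> (\<integral>\<^sup>+x. (\<integral>\<^sup>+y. ennreal (1 / kernel s x y) * indicator (- ?E) y \<partial>lborel) * indicator ?E x \<partial>lborel)"
      using kernel_complement_lower_bound[OF s E, folded m_def N_def c_def] fin[of t] True m0
      by (intro nn_integral_mono mult_right_mono) (auto simp: m_def c_def N_def)
    also have "\<dots> = (\<integral>\<^sup>+x. \<integral>\<^sup>+y. ?I x y t \<partial>lborel \<partial>lborel)"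
      using True by (intro nn_integral_cong) (auto simp: indicator_def not_less intro!: nn_integral_cong)
    finally show ?thesis using True by (simp add: m_def)
  next
    case False
    then have "t \<le> 0 \<or> measure lborel {x. t < u x} = 0"
      using measure_nonneg[of lborel "{x. t < u x}"] by linarith
    then have "ennreal (c * measure lborel {x. t < u x} powr (1 - s / N)) * indicator {0<..} t = 0"
      by (elim disjE) simp_all
    then show ?thesis by (simp only: zero_le)
  qed
  then have "(\<integral>\<^sup>+t. ennreal (c * measure lborel {x. t < u x} powr (1 - s / N)) * indicator {0<..} t \<partial>lborel)
     \<le> (\<integral>\<^sup>+t. \<integral>\<^sup>+x. \<integral>\<^sup>+y. ?I x y t \<partial>lborel \<partial>lborel \<partial>lborel)"
    by (intro nn_integral_mono)
  also have "\<dots> = (\<integral>\<^sup>+x. \<integral>\<^sup>+t. \<integral>\<^sup>+y. ?I x y t \<partial>lborel \<partial>lborel \<partial>lborel)"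
    by (rule lborel_pair.Fubini') measurable
  also have "\<dots> = (\<integral>\<^sup>+x. \<integral>\<^sup>+y. \<integral>\<^sup>+t. ?I x y t \<partial>lborel \<partial>lborel \<partial>lborel)"
    by (intro nn_integral_cong lborel_pair.Fubini') measurable
  also have "\<dots> \<le> (\<integral>\<^sup>+x. \<integral>\<^sup>+y. ennreal (\<bar>u x - u y\<bar> / kernel s x y) \<partial>lborel \<partial>lborel)"
  proof (intro nn_integral_mono)
    fix x y
    have "(\<integral>\<^sup>+t. ?I x y t \<partial>lborel) = ennreal (1 / kernel s x y) * emeasure lborel {t. 0 < t \<and> u y \<le> t \<and> t < u x}"
      by (rule nn_integral_cmult_indicator) measurable
    also have "\<dots> \<le> ennreal (1 / kernel s x y) * emeasure lborel {u y..u y + \<bar>u x - u y\<bar>}"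
      by (intro mult_left_mono emeasure_mono) auto
    also have "\<dots> = ennreal (\<bar>u x - u y\<bar> / kernel s x y)"
      by (simp add: kernel_nonneg flip: ennreal_mult')
    finally show "(\<integral>\<^sup>+t. ?I x y t \<partial>lborel) \<le> ennreal (\<bar>u x - u y\<bar> / kernel s x y)" .
  qed
  finally show ?thesis .
qed

lemma borel_measurable_superlevel:
  fixes u :: "'a::euclidean_space \<Rightarrow> real"
  assumes [measurable]: "u \<in> borel_measurable borel"
  shows "(\<lambda>t. measure lborel {x. t < u x}) \<in> borel_measurable borel"
proof -
  have "(\<lambda>t. emeasure lborel {x \<in> space lborel. t < u x}) \<in> borel_measurable borel" by measurable
  then show ?thesis unfolding measure_def by simp
qed

text \<open>The embedding of the Lorentz space \<open>L(p,1)\<close> into \<open>L(p,p)\<close>.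
  With \<open>g\<close> the nonincreasing distribution function, \<open>t * g t powr (1 / p)\<close>
  is at most the integral of \<open>g powr (1 / p)\<close> up to \<open>t\<close>, hence at most
  \<open>G\<close>. In the layer cake formula this bounds \<open>t powr (p - 1) * g t\<close> by
  \<open>G powr (p - 1) * g t powr (1 / p)\<close>.\<close>

lemma nn_integral_powr_le_superlevels:
  fixes u :: "'a::euclidean_space \<Rightarrow> real" and p G :: real
  assumes p: "1 \<le> p" and u[measurable]: "u \<in> borel_measurable borel" and nn: "\<And>x. 0 \<le> u x"
    and fin: "\<And>t. 0 < t \<Longrightarrow> emeasure lborel {x. t < u x} < \<infinity>"
    and G: "(\<integral>\<^sup>+t. ennreal (measure lborel {x. t < u x} powr (1 / p)) * indicator {0<..} t \<partial>lborel) \<le> ennreal G" "0 \<le> G"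
  shows "(\<integral>\<^sup>+x. ennreal (u x powr p) \<partial>lborel) \<le> ennreal (p * G powr p)"
proof -
  define g where "g t = measure lborel {x. t < u x}" for t
  have g0: "0 \<le> g t" for t by (simp add: g_def)
  have E: "{x. t < u x} \<in> sets lborel" for t by measurable
  have eg: "emeasure lborel {x. t < u x} = ennreal (g t)" if "0 < t" for t
    using fin[OF that] by (simp add: g_def emeasure_eq_ennreal_measure)
  have mono: "g t \<le> g \<tau>" if "0 < \<tau>" "\<tau> \<le> t" for t \<tau>
    using that fin[of \<tau>] E unfolding g_def by (intro measure_mono_fmeasurable) (auto intro: fmeasurableI)
  have tg: "t * g t powr (1 / p) \<le> G" if t: "0 < t" for t
  proof -
    have "ennreal (t * g t powr (1 / p)) = (\<integral>\<^sup>+\<tau>. ennreal (g t powr (1 / p)) * indicator {0<..t} \<tau> \<partial>lborel)"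
      using t by (subst nn_integral_cmult_indicator) (simp_all add: mult.commute flip: ennreal_mult')
    also have "\<dots> \<le> (\<integral>\<^sup>+\<tau>. ennreal (g \<tau> powr (1 / p)) * indicator {0<..} \<tau> \<partial>lborel)"
    proof (rule nn_integral_mono)
      fix \<tau>
      show "ennreal (g t powr (1 / p)) * indicator {0<..t} \<tau> \<le> ennreal (g \<tau> powr (1 / p)) * indicator {0<..} \<tau>"
        using mono[of \<tau> t] p g0 by (auto simp: indicator_def intro!: ennreal_leI powr_mono2)
    qed
    also have "\<dots> \<le> ennreal G" using G by (simp add: g_def)
    finally show ?thesis using G by simp
  qed
  have layer: "ennreal (u x powr p) = (\<integral>\<^sup>+t. ennreal (p * t powr (p - 1)) * indicator {t. 0 < t \<and> t < u x} t \<partial>lborel)" for x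
  proof -
    have "((\<lambda>t. p * t powr (p - 1)) has_integral (p * (u x powr (p - 1 + 1) / (p - 1 + 1)))) {0..u x}"
      using p nn by (intro has_integral_mult_right has_integral_powr_from_0) auto
    then have "((\<lambda>t. p * t powr (p - 1)) has_integral u x powr p) {0..u x}" using p by simp
    then have "ennreal (u x powr p) = (\<integral>\<^sup>+t. ennreal (p * t powr (p - 1)) * indicator {0..u x} t \<partial>lborel)"
      using p by (subst nn_integral_has_integral_lebesgue') auto
    also have "\<dots> = (\<integral>\<^sup>+t. ennreal (p * t powr (p - 1)) * indicator {t. 0 < t \<and> t < u x} t \<partial>lborel)"
    proof (rule nn_integral_cong_AE)
      show "AE t in lborel. ennreal (p * t powr (p - 1)) * indicator {0..u x} t
          = ennreal (p * t powr (p - 1)) * indicator {t. 0 < t \<and> t < u x} t"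
        using AE_lborel_singleton[of 0] AE_lborel_singleton[of "u x"]
        by eventually_elim (auto simp: indicator_def)
    qed
    finally show ?thesis .
  qed
  have "(\<integral>\<^sup>+x. ennreal (u x powr p) \<partial>lborel) = (\<integral>\<^sup>+x. \<integral>\<^sup>+t. ennreal (p * t powr (p - 1)) * indicator {t. 0 < t \<and> t < u x} t \<partial>lborel \<partial>lborel)"
    using layer by simp
  also have "\<dots> = (\<integral>\<^sup>+t. \<integral>\<^sup>+x. ennreal (p * t powr (p - 1)) * indicator {t. 0 < t \<and> t < u x} t \<partial>lborel \<partial>lborel)"
    by (rule lborel_pair.Fubini') measurable
  also have "\<dots> = (\<integral>\<^sup>+t. ennreal (p * t powr (p - 1) * g t) * indicator {0<..} t \<partial>lborel)"
  proof (rule nn_integral_cong)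
    fix t
    have "(\<integral>\<^sup>+x. ennreal (p * t powr (p - 1)) * indicator {t. 0 < t \<and> t < u x} t \<partial>lborel)
      = (\<integral>\<^sup>+x. (ennreal (p * t powr (p - 1)) * indicator {0<..} t) * indicator {x. t < u x} x \<partial>lborel)"
      by (intro nn_integral_cong) (auto simp: indicator_def)
    also have "\<dots> = (ennreal (p * t powr (p - 1)) * indicator {0<..} t) * emeasure lborel {x. t < u x}"
      using E by (rule nn_integral_cmult_indicator)
    also have "\<dots> = ennreal (p * t powr (p - 1) * g t) * indicator {0<..} t"
      using p g0 by (cases "0 < t") (auto simp: eg ennreal_mult)
    finally show "(\<integral>\<^sup>+x. ennreal (p * t powr (p - 1)) * indicator {t. 0 < t \<and> t < u x} t \<partial>lborel)
      = ennreal (p * t powr (p - 1) * g t) * indicator {0<..} t" .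
  qed
  also have "\<dots> \<le> (\<integral>\<^sup>+t. ennreal (p * G powr (p - 1)) * (ennreal (g t powr (1 / p)) * indicator {0<..} t) \<partial>lborel)"
  proof (rule nn_integral_mono)
    fix t :: real
    show "ennreal (p * t powr (p - 1) * g t) * indicator {0<..} t
      \<le> ennreal (p * G powr (p - 1)) * (ennreal (g t powr (1 / p)) * indicator {0<..} t)"
    proof (cases "0 < t")
      case True
      have "t powr (p - 1) * g t = (t * g t powr (1 / p)) powr (p - 1) * g t powr (1 / p)"
      proof (cases "g t = 0")
        case False
        have "(t * g t powr (1 / p)) powr (p - 1) * g t powr (1 / p) = t powr (p - 1) * (g t powr ((p - 1) / p) * g t powr (1 / p))"
          using True g0[of t] by (simp add: powr_mult powr_powr)
        also have "g t powr ((p - 1) / p) * g t powr (1 / p) = g t"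
          using False g0[of t] p by (simp add: diff_divide_distrib flip: powr_add)
        finally show ?thesis by simp
      qed simp
      also have "\<dots> \<le> G powr (p - 1) * g t powr (1 / p)"
        using tg[OF True] True p by (intro mult_right_mono powr_mono2) auto
      finally have "p * t powr (p - 1) * g t \<le> p * G powr (p - 1) * g t powr (1 / p)"
        using p by simp
      then show ?thesis using True p by (simp add: ennreal_leI flip: ennreal_mult')
    qed simp
  qed
  also have "\<dots> = ennreal (p * G powr (p - 1)) * (\<integral>\<^sup>+t. ennreal (g t powr (1 / p)) * indicator {0<..} t \<partial>lborel)"
  proof (rule nn_integral_cmult)
    have [measurable]: "g \<in> borel_measurable borel"
      unfolding g_def[abs_def] by (rule borel_measurable_superlevel[OF u])
    show "(\<lambda>t. ennreal (g t powr (1 / p)) * indicator {0<..} t) \<in> borel_measurable lborel"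
      by measurable
  qed
  also have "\<dots> \<le> ennreal (p * G powr (p - 1)) * ennreal G"
    using G by (intro mult_left_mono) (auto simp: g_def)
  also have "\<dots> = ennreal (p * G powr p)"
  proof -
    have "G powr (p - 1) * G = G powr p"
    proof (cases "G = 0")
      case False
      then show ?thesis using G powr_add[of G "p - 1" 1] by simp
    qed simp
    then show ?thesis using p G by (simp add: mult.assoc flip: ennreal_mult')
  qed
  finally show ?thesis .
qed

section \<open>Borel representatives and the embedding theorem\<close>

lemma AE_lborel_fst:
  assumes "AE x in (lborel :: 'a::euclidean_space measure). P x"
  shows "AE z in (lborel :: ('a \<times> 'b::euclidean_space) measure). P (fst z)"
proof -
  obtain N where N: "N \<in> null_sets lborel" "{x. \<not> P x} \<subseteq> N"
    using assms unfolding eventually_ae_filter by auto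
  have "N \<times> (UNIV :: 'b set) \<in> null_sets (lborel \<Otimes>\<^sub>M lborel)"
    using N by (auto simp: null_sets_def lborel.emeasure_pair_measure_Times intro!: pair_measureI)
  then show ?thesis using N(2) unfolding lborel_prod
    by (intro AE_I'[of "N \<times> UNIV"]) auto
qed

lemma AE_lborel_snd:
  assumes "AE x in (lborel :: 'b::euclidean_space measure). P x"
  shows "AE z in (lborel :: ('a::euclidean_space \<times> 'b) measure). P (snd z)"
proof -
  obtain N where N: "N \<in> null_sets lborel" "{x. \<not> P x} \<subseteq> N"
    using assms unfolding eventually_ae_filter by auto
  have "(UNIV :: 'a set) \<times> N \<in> null_sets (lborel \<Otimes>\<^sub>M lborel)"
    using N by (auto simp: null_sets_def lborel.emeasure_pair_measure_Times intro!: pair_measureI)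
  then show ?thesis using N(2) unfolding lborel_prod
    by (intro AE_I'[of "UNIV \<times> N"]) auto
qed

text \<open>Elements of \<open>Ws1\<close> are Lebesgue measurable on \<open>\<Omega>\<close> and
  vanish outside it only almost everywhere, while the coarea argument needs a Borel function with
  exact zeros. Taking absolute values does not increase differences, and outside
  \<open>Qset \<Omega>\<close> both values are zero, so the whole double integral is controlled by
  the seminorm.\<close>

lemma Ws1_borel_representative:
  fixes w :: "real^'n \<Rightarrow> real"
  assumes w: "w \<in> Ws1 s \<Omega>" and \<Omega>: "\<Omega> \<in> sets borel"
  obtains u where "u \<in> borel_measurable borel" "\<And>x. 0 \<le> u x" "\<And>x. x \<notin> \<Omega> \<Longrightarrow> u x = 0"
    "AE x in lborel. \<bar>w x\<bar> = u x"
    "(\<integral>\<^sup>+x. \<integral>\<^sup>+y. ennreal (\<bar>u x - u y\<bar> / kernel s x y) \<partial>lborel \<partial>lborel) \<le> ennreal (Ws1_norm s \<Omega> w)"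
proof -
  have \<Omega>l: "\<Omega> \<in> sets lebesgue" using \<Omega> by simp
  have w1: "w \<in> borel_measurable (lebesgue_on \<Omega>)" and w0: "AE x in lborel. x \<notin> \<Omega> \<longrightarrow> w x = 0"
    and wQ: "set_integrable lebesgue (Qset \<Omega>) (\<lambda>(x, y). \<bar>w x - w y\<bar> / kernel s x y)"
    using w by (auto simp: Ws1_def Lp_def AE_completion_iff)
  have "(\<lambda>x. w x * indicator \<Omega> x) \<in> borel_measurable lebesgue"
    using w1 \<Omega>l by (simp add: borel_measurable_restrict_space_iff mult.commute)
  then obtain w' where w': "w' \<in> borel_measurable borel" "AE x in lborel. w x * indicator \<Omega> x = w' x"
    using completion_ex_borel_measurable_real by fastforce
  define u where "u x = \<bar>w' x\<bar> * indicator \<Omega> x" for x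
  have u[measurable]: "u \<in> borel_measurable borel" unfolding u_def using w' \<Omega> by measurable
  have uw: "AE x in lborel. \<bar>w x\<bar> = u x"
    using w'(2) w0 by eventually_elim (auto simp: u_def indicator_def split: if_splits)
  have u0: "u x = 0" if "x \<notin> \<Omega>" for x using that by (simp add: u_def)
  have "(\<integral>\<^sup>+x. \<integral>\<^sup>+y. ennreal (\<bar>u x - u y\<bar> / kernel s x y) \<partial>lborel \<partial>lborel)
     = (\<integral>\<^sup>+z. (case z of (x, y) \<Rightarrow> ennreal (\<bar>u x - u y\<bar> / kernel s x y)) \<partial>lborel)"
    unfolding lborel_prod[symmetric] by (subst lborel.nn_integral_fst[symmetric]) simp_all
  also have "\<dots> \<le> (\<integral>\<^sup>+z. ennreal (indicator (Qset \<Omega>) z *\<^sub>R (case z of (x, y) \<Rightarrow> \<bar>w x - w y\<bar> / kernel s x y)) \<partial>lborel)"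
  proof (rule nn_integral_mono_AE)
    show "AE z in lborel. (case z of (x, y) \<Rightarrow> ennreal (\<bar>u x - u y\<bar> / kernel s x y))
       \<le> ennreal (indicator (Qset \<Omega>) z *\<^sub>R (case z of (x, y) \<Rightarrow> \<bar>w x - w y\<bar> / kernel s x y))"
      using AE_lborel_fst[OF uw] AE_lborel_snd[OF uw]
    proof eventually_elim
      case (elim z)
      obtain x y where z: "z = (x, y)" by force
      show ?case
      proof (cases "z \<in> Qset \<Omega>")
        case True
        have "\<bar>u x - u y\<bar> \<le> \<bar>w x - w y\<bar>" using elim z by simp
        then show ?thesis using True z
          by (simp add: divide_right_mono kernel_nonneg ennreal_leI)
      next
        case False
        then have "x \<notin> \<Omega>" "y \<notin> \<Omega>" using z by (auto simp: Qset_def)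
        then show ?thesis using z by (simp add: u0)
      qed
    qed
  qed
  also have "\<dots> = (\<integral>\<^sup>+z. ennreal (indicator (Qset \<Omega>) z *\<^sub>R (case z of (x, y) \<Rightarrow> \<bar>w x - w y\<bar> / kernel s x y)) \<partial>lebesgue)"
    by (simp add: nn_integral_completion)
  also have "\<dots> = ennreal (Ws1_norm s \<Omega> w)"
    unfolding Ws1_norm_def set_lebesgue_integral_def
    using wQ by (intro nn_integral_eq_integral) (auto simp: set_integrable_def kernel_nonneg)
  finally show thesis
    using that[OF u _ u0 uw] by (simp add: u_def)
qed

lemma Ws1_norm_nonneg: "0 \<le> Ws1_norm s \<Omega> w"
  unfolding Ws1_norm_def set_lebesgue_integral_def
  by (rule Bochner_Integration.integral_nonneg) (auto simp: kernel_nonneg)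

text \<open>The coarea bound controls the integral of \<open>g powr (1 - s / N)\<close>, where
  \<open>g\<close> is the distribution function. Since \<open>g\<close> is at most the measure of
  \<open>\<Omega>\<close> and \<open>1 - s / N \<le> 1 / p\<close>, raising the exponent to
  \<open>1 / p\<close> costs only a power of that measure, and the layer cake estimate concludes.
  The critical exponent is included.\<close>

theorem fractional_Sobolev:
  fixes \<Omega> :: "(real^'n) set" and s p :: real
  defines "N \<equiv> real CARD('n)"
  assumes s: "0 < s" "s < N" and \<Omega>: "open \<Omega>" "bounded \<Omega>" and p: "1 \<le> p" "p \<le> N / (N - s)"
  obtains K where "0 < K"
    "\<And>w. w \<in> Ws1 s \<Omega> \<Longrightarrow> integrable (lebesgue_on \<Omega>) (\<lambda>x. \<bar>w x\<bar> powr p) \<and>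
       (\<integral>x. \<bar>w x\<bar> powr p \<partial>lebesgue_on \<Omega>) \<le> K * Ws1_norm s \<Omega> w powr p"
proof -
  define c where "c = (2 / measure lborel (ball (0::real^'n) 1)) powr (- (1 + s / N))"
  define b where "b = measure lborel \<Omega>"
  define a where "a = b powr (1 / p - (1 - s / N)) / c"
  have N: "1 \<le> N" by (simp add: N_def Suc_leI)
  have "measure lborel (ball (0::real^'n) 1) > 0" by (simp add: content_ball_pos)
  then have c: "0 < c" by (simp add: c_def)
  have a0: "0 \<le> a" using c by (simp add: a_def)
  have exp: "1 - s / N \<le> 1 / p" using p s N by (simp add: field_simps)
  have fin\<Omega>: "emeasure lborel \<Omega> < \<infinity>" using \<Omega>(2) by (rule emeasure_bounded_finite)
  \<comment> \<open>The summand 1 serves only to make the constant positive.\<close>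
  show thesis
  proof (rule that[of "p * a powr p + 1"])
    show "0 < p * a powr p + 1" using p by (simp add: add_nonneg_pos)
    fix w :: "real^'n \<Rightarrow> real" assume w: "w \<in> Ws1 s \<Omega>"
    define D where "D = Ws1_norm s \<Omega> w"
    have D0: "0 \<le> D" by (simp add: D_def Ws1_norm_nonneg)
    obtain u where u[measurable]: "u \<in> borel_measurable borel" and nn: "\<And>x. 0 \<le> u x"
      and u0: "\<And>x. x \<notin> \<Omega> \<Longrightarrow> u x = 0" and uw: "AE x in lborel. \<bar>w x\<bar> = u x"
      and D: "(\<integral>\<^sup>+x. \<integral>\<^sup>+y. ennreal (\<bar>u x - u y\<bar> / kernel s x y) \<partial>lborel \<partial>lborel) \<le> ennreal D"
      by (rule Ws1_borel_representative[OF w borel_open[OF \<Omega>(1)], folded D_def]) (rule that)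
    have sub: "{x. t < u x} \<subseteq> \<Omega>" if "0 < t" for t
    proof (rule subsetI, rule ccontr)
      fix x assume "x \<in> {x. t < u x}" "x \<notin> \<Omega>"
      then show False using u0[of x] that by simp
    qed
    have fin: "emeasure lborel {x. t < u x} < \<infinity>" if "0 < t" for t
      using emeasure_mono[OF sub[OF that], of lborel] fin\<Omega> \<Omega>(1) by (auto intro: le_less_trans)
    define g where "g t = measure lborel {x. t < u x}" for t
    have gb: "g t \<le> b" if "0 < t" for t
      unfolding g_def b_def using fin\<Omega> \<Omega>(1) sub[OF that]
      by (intro measure_mono_fmeasurable) (auto intro!: fmeasurableI)
    have g0: "0 \<le> g t" for t by (simp add: g_def)
    have "(\<integral>\<^sup>+t. ennreal (g t powr (1 / p)) * indicator {0<..} t \<partial>lborel)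
       \<le> (\<integral>\<^sup>+t. ennreal a * (ennreal (c * g t powr (1 - s / N)) * indicator {0<..} t) \<partial>lborel)"
    proof (rule nn_integral_mono)
      fix t :: real
      show "ennreal (g t powr (1 / p)) * indicator {0<..} t \<le> ennreal a * (ennreal (c * g t powr (1 - s / N)) * indicator {0<..} t)"
      proof (cases "0 < t")
        case True
        have "g t powr (1 / p) = g t powr (1 / p - (1 - s / N)) * g t powr (1 - s / N)"
          by (simp flip: powr_add)
        also have "\<dots> \<le> b powr (1 / p - (1 - s / N)) * g t powr (1 - s / N)"
          using gb[OF True] g0 exp by (intro mult_right_mono powr_mono2) auto
        also have "\<dots> = a * (c * g t powr (1 - s / N))" using c by (simp add: a_def)
        finally show ?thesis using True a0 by (simp add: ennreal_leI flip: ennreal_mult')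
      qed simp
    qed
    also have "\<dots> = ennreal a * (\<integral>\<^sup>+t. ennreal (c * g t powr (1 - s / N)) * indicator {0<..} t \<partial>lborel)"
    proof (rule nn_integral_cmult)
      have [measurable]: "g \<in> borel_measurable borel"
        unfolding g_def[abs_def] by (rule borel_measurable_superlevel[OF u])
      show "(\<lambda>t. ennreal (c * g t powr (1 - s / N)) * indicator {0<..} t) \<in> borel_measurable lborel"
        by measurable
    qed
    also have "\<dots> \<le> ennreal a * ennreal D"
      using order_trans[OF superlevel_integral_le[OF s(1) u fin, folded N_def] D]
      by (intro mult_left_mono) (auto simp: c_def g_def)
    also have "\<dots> = ennreal (a * D)" using a0 by (simp add: ennreal_mult')
    finally have "(\<integral>\<^sup>+x. ennreal (u x powr p) \<partial>lborel) \<le> ennreal (p * (a * D) powr p)"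
      using a0 D0 by (intro nn_integral_powr_le_superlevels[OF p(1) u nn fin]) (auto simp: g_def)
    then have le: "(\<integral>\<^sup>+x. ennreal (u x powr p) \<partial>lborel) \<le> ennreal (p * a powr p * D powr p)"
      using a0 D0 by (simp add: powr_mult mult.assoc)
    have ui: "integrable lborel (\<lambda>x. u x powr p)"
      using le by (intro integrableI_nonneg) (auto intro: le_less_trans)
    then have iu: "(\<integral>x. u x powr p \<partial>lborel) \<le> p * a powr p * D powr p"
      using le p by (subst (asm) nn_integral_eq_integral) (auto simp: ennreal_le_iff)
    have w1: "w \<in> borel_measurable (lebesgue_on \<Omega>)" using w by (auto simp: Ws1_def Lp_def)
    have eq: "AE x in lebesgue. indicator \<Omega> x *\<^sub>R \<bar>w x\<bar> powr p = u x powr p"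
      unfolding AE_completion_iff using uw
      by eventually_elim (use u0 p in \<open>auto simp: indicator_def\<close>)
    have \<Omega>l: "\<Omega> \<inter> space lebesgue \<in> sets lebesgue" using \<Omega>(1) by simp
    have ul: "integrable lebesgue (\<lambda>x. u x powr p)" using ui by (simp add: integrable_completion)
    have wm: "(\<lambda>x. indicator \<Omega> x *\<^sub>R \<bar>w x\<bar> powr p) \<in> borel_measurable lebesgue"
      by (subst borel_measurable_restrict_space_iff[OF \<Omega>l, symmetric]) (use w1 in measurable)
    have "integrable (lebesgue_on \<Omega>) (\<lambda>x. \<bar>w x\<bar> powr p)"
      unfolding integrable_restrict_space[OF \<Omega>l]
      using integrable_cong_AE[OF wm _ eq] ul by simp
    moreover have "(\<integral>x. \<bar>w x\<bar> powr p \<partial>lebesgue_on \<Omega>) = (\<integral>x. u x powr p \<partial>lborel)"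
    proof -
      have "(\<integral>x. \<bar>w x\<bar> powr p \<partial>lebesgue_on \<Omega>) = (\<integral>x. indicator \<Omega> x *\<^sub>R \<bar>w x\<bar> powr p \<partial>lebesgue)"
        by (rule integral_restrict_space[OF \<Omega>l])
      also have "\<dots> = (\<integral>x. u x powr p \<partial>lebesgue)"
        by (rule integral_cong_AE[OF wm _ eq]) (use ul in simp)
      also have "\<dots> = (\<integral>x. u x powr p \<partial>lborel)" by (rule integral_completion) measurable
      finally show ?thesis .
    qed
    ultimately show "integrable (lebesgue_on \<Omega>) (\<lambda>x. \<bar>w x\<bar> powr p) \<and>
       (\<integral>x. \<bar>w x\<bar> powr p \<partial>lebesgue_on \<Omega>) \<le> (p * a powr p + 1) * Ws1_norm s \<Omega> w powr p"
      using iu by (simp add: D_def distrib_right add_increasing2)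
  qed
qed

section \<open>Square integrability and superposition operators\<close>

lemma Cauchy_Schwarz_integral:
  fixes f g :: "'a \<Rightarrow> real"
  assumes f[measurable]: "f \<in> borel_measurable M" and g[measurable]: "g \<in> borel_measurable M"
    and f2: "integrable M (\<lambda>x. (f x)\<^sup>2)" and g2: "integrable M (\<lambda>x. (g x)\<^sup>2)"
  shows "integrable M (\<lambda>x. f x * g x)"
    and "\<bar>\<integral>x. f x * g x \<partial>M\<bar> \<le> sqrt (\<integral>x. (f x)\<^sup>2 \<partial>M) * sqrt (\<integral>x. (g x)\<^sup>2 \<partial>M)"
proof -
  show i: "integrable M (\<lambda>x. f x * g x)"
  proof (rule Bochner_Integration.integrable_bound[of M "\<lambda>x. (f x)\<^sup>2 + (g x)\<^sup>2"])
    show "AE x in M. norm (f x * g x) \<le> norm ((f x)\<^sup>2 + (g x)\<^sup>2)"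
    proof (rule AE_I2)
      fix x
      have "0 \<le> (\<bar>f x\<bar> - \<bar>g x\<bar>)\<^sup>2 + \<bar>f x\<bar>\<^sup>2 + \<bar>g x\<bar>\<^sup>2" by simp
      then have "2 * (\<bar>f x\<bar> * \<bar>g x\<bar>) \<le> 2 * ((f x)\<^sup>2 + (g x)\<^sup>2)"
        by (simp add: power2_diff)
      then show "norm (f x * g x) \<le> norm ((f x)\<^sup>2 + (g x)\<^sup>2)" by (simp add: abs_mult)
    qed
  qed (use f2 g2 in simp_all)
  have "(\<integral>\<^sup>+x. ennreal \<bar>f x\<bar> * ennreal \<bar>g x\<bar> \<partial>M)\<^sup>2
      \<le> (\<integral>\<^sup>+x. (ennreal \<bar>f x\<bar>)\<^sup>2 \<partial>M) * (\<integral>\<^sup>+x. (ennreal \<bar>g x\<bar>)\<^sup>2 \<partial>M)"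
    by (rule Cauchy_Schwarz_nn_integral) measurable
  moreover have "(\<integral>\<^sup>+x. ennreal \<bar>f x\<bar> * ennreal \<bar>g x\<bar> \<partial>M) = ennreal (\<integral>x. \<bar>f x * g x\<bar> \<partial>M)"
    using nn_integral_eq_integral[OF integrable_abs[OF i]] by (simp add: abs_mult flip: ennreal_mult')
  moreover have "(\<integral>\<^sup>+x. (ennreal \<bar>f x\<bar>)\<^sup>2 \<partial>M) = ennreal (\<integral>x. (f x)\<^sup>2 \<partial>M)"
    using f2 by (simp add: ennreal_power nn_integral_eq_integral)
  moreover have "(\<integral>\<^sup>+x. (ennreal \<bar>g x\<bar>)\<^sup>2 \<partial>M) = ennreal (\<integral>x. (g x)\<^sup>2 \<partial>M)"
    using g2 by (simp add: ennreal_power nn_integral_eq_integral)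
  ultimately have "(\<integral>x. \<bar>f x * g x\<bar> \<partial>M)\<^sup>2 \<le> (\<integral>x. (f x)\<^sup>2 \<partial>M) * (\<integral>x. (g x)\<^sup>2 \<partial>M)"
    by (simp add: ennreal_power ennreal_le_iff flip: ennreal_mult')
  then have "(\<integral>x. \<bar>f x * g x\<bar> \<partial>M) \<le> sqrt (\<integral>x. (f x)\<^sup>2 \<partial>M) * sqrt (\<integral>x. (g x)\<^sup>2 \<partial>M)"
    by (metis real_le_rsqrt real_sqrt_mult)
  moreover have "\<bar>\<integral>x. f x * g x \<partial>M\<bar> \<le> (\<integral>x. \<bar>f x * g x\<bar> \<partial>M)"
    by (rule integral_abs_bound)
  ultimately show "\<bar>\<integral>x. f x * g x \<partial>M\<bar> \<le> sqrt (\<integral>x. (f x)\<^sup>2 \<partial>M) * sqrt (\<integral>x. (g x)\<^sup>2 \<partial>M)"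
    by linarith
qed

section \<open>The inner product space of square integrable functions\<close>

lemma Lp2_iff:
  "u \<in> Lp 2 \<Omega> \<longleftrightarrow> u \<in> borel_measurable (lebesgue_on \<Omega>) \<and> integrable (lebesgue_on \<Omega>) (\<lambda>x. (u x)\<^sup>2)"
  by (simp add: Lp_def)

lemma Lp2_norm: "Lp_norm 2 \<Omega> u = sqrt (\<integral>x. (u x)\<^sup>2 \<partial>lebesgue_on \<Omega>)"
  by (simp add: Lp_norm_def powr_half_sqrt)

lemma Lp2_norm_sq: "(Lp_norm 2 \<Omega> u)\<^sup>2 = (\<integral>x. (u x)\<^sup>2 \<partial>lebesgue_on \<Omega>)"
  by (simp add: Lp2_norm)

lemma Lp2_mult_integrable:
  "u \<in> Lp 2 \<Omega> \<Longrightarrow> g \<in> Lp 2 \<Omega> \<Longrightarrow> integrable (lebesgue_on \<Omega>) (\<lambda>x. u x * g x)"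
  using Cauchy_Schwarz_integral(1) by (auto simp: Lp2_iff)

lemma Lp2_Cauchy_Schwarz:
  "u \<in> Lp 2 \<Omega> \<Longrightarrow> g \<in> Lp 2 \<Omega> \<Longrightarrow> \<bar>\<integral>x. u x * g x \<partial>lebesgue_on \<Omega>\<bar> \<le> Lp_norm 2 \<Omega> u * Lp_norm 2 \<Omega> g"
  using Cauchy_Schwarz_integral(2) by (auto simp: Lp2_iff Lp2_norm)

lemma Lp2_add:
  assumes u: "u \<in> Lp 2 \<Omega>" and g: "g \<in> Lp 2 \<Omega>" shows "(\<lambda>x. u x + g x) \<in> Lp 2 \<Omega>"
proof -
  have "integrable (lebesgue_on \<Omega>) (\<lambda>x. (u x)\<^sup>2 + (g x)\<^sup>2 + 2 * (u x * g x))"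
    using assms Lp2_mult_integrable[OF assms] by (intro Bochner_Integration.integrable_add) (auto simp: Lp2_iff)
  then have "integrable (lebesgue_on \<Omega>) (\<lambda>x. (u x + g x)\<^sup>2)" by (simp add: power2_sum mult.assoc)
  then show ?thesis using assms by (auto simp: Lp2_iff)
qed

lemma Lp2_cmult: "u \<in> Lp 2 \<Omega> \<Longrightarrow> (\<lambda>x. a * u x) \<in> Lp 2 \<Omega>"
  by (auto simp: Lp2_iff power_mult_distrib)

lemma Lp2_diff: "u \<in> Lp 2 \<Omega> \<Longrightarrow> g \<in> Lp 2 \<Omega> \<Longrightarrow> (\<lambda>x. u x - g x) \<in> Lp 2 \<Omega>"
  using Lp2_add[OF _ Lp2_cmult[of g \<Omega> "-1"], of u] by simp

lemma Lp_norm_nonneg: "0 \<le> Lp_norm p \<Omega> u"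
  by (simp add: Lp_norm_def)

section \<open>Measurability and continuity of superposition operators\<close>

lemma floor_approx_tendsto:
  fixes a :: real
  shows "(\<lambda>n. of_int \<lfloor>real n * a\<rfloor> / real n) \<longlonglongrightarrow> a"
proof -
  have "\<bar>of_int \<lfloor>real n * a\<rfloor> / real n - a\<bar> \<le> 1 / real n" if "0 < n" for n
  proof -
    have "\<bar>of_int \<lfloor>real n * a\<rfloor> - real n * a\<bar> \<le> 1" by linarith
    then have "\<bar>(of_int \<lfloor>real n * a\<rfloor> - real n * a) / real n\<bar> \<le> 1 / real n"
      using that by (simp add: divide_right_mono abs_divide)
    moreover have "(of_int \<lfloor>real n * a\<rfloor> - real n * a) / real n = of_int \<lfloor>real n * a\<rfloor> / real n - a"
      using that by (simp add: diff_divide_distrib)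
    ultimately show ?thesis by simp
  qed
  then have "\<forall>\<^sub>F n in sequentially. norm (of_int \<lfloor>real n * a\<rfloor> / real n - a) \<le> 1 / real n"
    by (auto simp: eventually_sequentially intro!: exI[of _ 1])
  then have "(\<lambda>n. of_int \<lfloor>real n * a\<rfloor> / real n - a) \<longlonglongrightarrow> 0"
    by (rule Lim_null_comparison) (rule lim_1_over_n)
  then show ?thesis by (simp add: LIM_zero_iff)
qed

text \<open>Rounding \<open>w x\<close> down to a multiple of \<open>1 / n\<close> leaves countably
  many values, so only the functions \<open>\<lambda>x. f x t\<close> with fixed \<open>t\<close>
  occur; continuity in the second variable passes to the limit.\<close>

lemma measurable_Caratheodory:
  fixes f :: "'a \<Rightarrow> real \<Rightarrow> real"
  assumes f: "\<And>t. (\<lambda>x. f x t) \<in> borel_measurable M"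
    and cont: "\<And>x. x \<in> space M \<Longrightarrow> continuous_on UNIV (f x)"
    and w[measurable]: "w \<in> borel_measurable M"
  shows "(\<lambda>x. f x (w x)) \<in> borel_measurable M"
proof (rule borel_measurable_LIMSEQ_metric)
  fix n :: nat
  show "(\<lambda>x. f x (of_int \<lfloor>real n * w x\<rfloor> / real n)) \<in> borel_measurable M"
    by (rule measurable_compose_countable[where f = "\<lambda>i x. f x (of_int i / real n)"]) (use f in measurable)
next
  fix x assume "x \<in> space M"
  then show "(\<lambda>n. f x (of_int \<lfloor>real n * w x\<rfloor> / real n)) \<longlonglongrightarrow> f x (w x)"
    by (intro continuous_on_tendsto_compose[OF cont floor_approx_tendsto]) auto
qed

text \<open>Applied on the product space with the second projection as \<open>w\<close>,
  \<open>measurable_Caratheodory\<close> gives joint measurability, and integrals with a parameter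
  are then measurable.\<close>

lemma measurable_primitive:
  fixes f :: "real^'n \<Rightarrow> real \<Rightarrow> real"
  assumes f: "\<And>t. (\<lambda>x. f x t) \<in> borel_measurable M"
    and cont: "\<And>x. x \<in> space M \<Longrightarrow> continuous_on UNIV (f x)"
  shows "(\<lambda>x. primitive f x t) \<in> borel_measurable M"
proof -
  have [measurable]: "(\<lambda>z. f (fst z) (snd z)) \<in> borel_measurable (M \<Otimes>\<^sub>M borel)"
  proof (rule measurable_Caratheodory[where f = "\<lambda>z. f (fst z)" and w = snd])
    show "(\<lambda>z. f (fst z) t) \<in> borel_measurable (M \<Otimes>\<^sub>M borel)" for t
      by (rule measurable_compose[OF measurable_fst f])
  qed (use cont in \<open>auto simp: space_pair_measure\<close>)
  have *: "(\<lambda>x. LINT \<tau>:S|lborel. f x \<tau>) \<in> borel_measurable M" if "S \<in> sets borel" for S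
    unfolding set_lebesgue_integral_def
    by (rule lborel.borel_measurable_lebesgue_integral) (use that in \<open>simp add: case_prod_beta\<close>)
  show ?thesis
    unfolding primitive_def interval_lebesgue_integral_def
    by (cases "0 \<le> t") (auto intro!: * borel_measurable_uminus)
qed

lemma primitive_has_derivative:
  assumes cont: "continuous_on UNIV (f x)"
  shows "(primitive f x has_real_derivative f x t) (at t)"
proof -
  let ?a = "- \<bar>t\<bar> - 1" and ?b = "\<bar>t\<bar> + 1"
  have "((\<lambda>u. LBINT y=ereal 0..ereal u. f x y) has_vector_derivative f x t) (at t within {?a..?b})"
    by (rule interval_integral_FTC2) (auto intro: continuous_on_subset[OF cont])
  moreover have "at t within {?a..?b} = at t" by (rule at_within_interior) auto
  moreover have "primitive f x = (\<lambda>u. LBINT y=ereal 0..ereal u. f x y)"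
    by (simp add: fun_eq_iff primitive_def)
  ultimately show ?thesis by (simp add: has_real_derivative_iff_has_vector_derivative)
qed

lemma primitive_0: "primitive f x 0 = 0"
  by (simp add: primitive_def)

text \<open>Needed because convergence in mean gives convergence almost everywhere only along a
  subsequence.\<close>

lemma LIMSEQ_by_subsequences:
  fixes a :: "nat \<Rightarrow> 'a::metric_space"
  assumes "\<And>\<sigma> :: nat \<Rightarrow> nat. strict_mono \<sigma> \<Longrightarrow> \<exists>\<rho> :: nat \<Rightarrow> nat. strict_mono \<rho> \<and> (\<lambda>n. a (\<sigma> (\<rho> n))) \<longlonglongrightarrow> l"
  shows "a \<longlonglongrightarrow> l"
proof (rule ccontr)
  assume "\<not> a \<longlonglongrightarrow> l"
  then obtain e where e: "0 < e" "\<not> (\<forall>\<^sub>F n in sequentially. dist (a n) l < e)"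
    by (auto simp: tendsto_iff)
  then have "infinite {n. \<not> dist (a n) l < e}"
    by (simp add: eventually_cofinite flip: cofinite_eq_sequentially)
  then obtain \<sigma> :: "nat \<Rightarrow> nat" where \<sigma>: "strict_mono \<sigma>" "\<And>n. \<sigma> n \<in> {n. \<not> dist (a n) l < e}"
    using infinite_enumerate by blast
  obtain \<rho> where "strict_mono \<rho>" "(\<lambda>n. a (\<sigma> (\<rho> n))) \<longlonglongrightarrow> l" using assms[OF \<sigma>(1)] by blast
  from tendstoD[OF this(2) e(1)] have "\<forall>\<^sub>F n in sequentially. False"
    using \<sigma>(2) by simp
  then show False by simp
qed

lemma powr_add_le:
  fixes a b r :: real
  assumes "0 \<le> r"
  shows "\<bar>a + b\<bar> powr r \<le> 2 powr r * (\<bar>a\<bar> powr r + \<bar>b\<bar> powr r)"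
proof -
  have "\<bar>a + b\<bar> powr r \<le> (2 * max \<bar>a\<bar> \<bar>b\<bar>) powr r"
    using assms by (intro powr_mono2) auto
  also have "\<dots> = 2 powr r * max \<bar>a\<bar> \<bar>b\<bar> powr r" by (simp add: powr_mult)
  also have "\<dots> \<le> 2 powr r * (\<bar>a\<bar> powr r + \<bar>b\<bar> powr r)"
    by (intro mult_left_mono) (auto simp: max_def)
  finally show ?thesis .
qed

text \<open>Along a subsequence converging almost everywhere, the excess of \<open>|H(w\<^sub>n) - H(w)|\<close> over a
  multiple of \<open>|w\<^sub>n - w|\<^sup>r\<close> is dominated.\<close>

lemma superposition_tendsto:
  fixes H :: "'a \<Rightarrow> real \<Rightarrow> real" and w :: "'a \<Rightarrow> real" and wn :: "nat \<Rightarrow> 'a \<Rightarrow> real"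
  assumes H: "\<And>t. (\<lambda>x. H x t) \<in> borel_measurable M"
    and cont: "\<And>x. x \<in> space M \<Longrightarrow> continuous_on UNIV (H x)"
    and growth: "\<And>x t. x \<in> space M \<Longrightarrow> \<bar>H x t\<bar> \<le> C * \<bar>t\<bar> powr r" and C: "0 \<le> C" and r: "0 < r"
    and w: "w \<in> borel_measurable M" "integrable M (\<lambda>x. \<bar>w x\<bar> powr r)"
    and wn: "\<And>n. wn n \<in> borel_measurable M" "\<And>n. integrable M (\<lambda>x. \<bar>wn n x\<bar> powr r)"
    and lim: "(\<lambda>n. \<integral>x. \<bar>wn n x - w x\<bar> powr r \<partial>M) \<longlonglongrightarrow> 0"
  shows "(\<lambda>n. \<integral>x. H x (wn n x) \<partial>M) \<longlonglongrightarrow> (\<integral>x. H x (w x) \<partial>M)"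
proof (rule LIMSEQ_by_subsequences)
  fix \<sigma> :: "nat \<Rightarrow> nat" assume \<sigma>: "strict_mono \<sigma>"
  \<comment> \<open>The constant from \<open>powr_add_le\<close>: it splits
    \<open>\<bar>H x (v n x)\<bar>\<close> into \<open>K * \<bar>v n x - w x\<bar> powr r\<close>,
    which is subtracted in \<open>D\<close>, and \<open>K * \<bar>w x\<bar> powr r\<close>, which
    goes into \<open>dom\<close>.\<close>
  define K where "K = C * 2 powr r"
  have K: "0 \<le> K" using C by (simp add: K_def)
  note [measurable] = w(1) wn(1)
  have Hm[measurable]: "(\<lambda>x. H x (v x)) \<in> borel_measurable M" if "v \<in> borel_measurable M" for v
    by (rule measurable_Caratheodory[OF H cont that])
  have Hi: "integrable M (\<lambda>x. H x (v x))" if "v \<in> borel_measurable M" "integrable M (\<lambda>x. \<bar>v x\<bar> powr r)" for v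
    by (rule Bochner_Integration.integrable_bound[OF _ Hm[OF that(1)], of "\<lambda>x. C * \<bar>v x\<bar> powr r"])
       (use that growth C in \<open>auto intro!: AE_I2\<close>)
  have di: "integrable M (\<lambda>x. \<bar>wn n x - w x\<bar> powr r)" for n
  proof (rule Bochner_Integration.integrable_bound[of M "\<lambda>x. 2 powr r * (\<bar>wn n x\<bar> powr r + \<bar>w x\<bar> powr r)"])
    show "AE x in M. norm (\<bar>wn n x - w x\<bar> powr r) \<le> norm (2 powr r * (\<bar>wn n x\<bar> powr r + \<bar>w x\<bar> powr r))"
      using powr_add_le[of r "wn n _" "- w _"] r by (intro AE_I2) simp
  qed (use w wn in simp_all)
  have "(\<lambda>n. \<integral>x. norm (\<bar>wn (\<sigma> n) x - w x\<bar> powr r) \<partial>M) \<longlonglongrightarrow> 0"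
    using LIMSEQ_subseq_LIMSEQ[OF lim \<sigma>] by (simp add: o_def)
  from tendsto_L1_AE_subseq[OF di this] obtain \<rho> :: "nat \<Rightarrow> nat" where \<rho>: "strict_mono \<rho>"
    and ae: "AE x in M. (\<lambda>n. \<bar>wn (\<sigma> (\<rho> n)) x - w x\<bar> powr r) \<longlonglongrightarrow> 0" by blast
  define v where "v n = wn (\<sigma> (\<rho> n))" for n
  have v: "v n \<in> borel_measurable M" "integrable M (\<lambda>x. \<bar>v n x\<bar> powr r)"
    "integrable M (\<lambda>x. \<bar>v n x - w x\<bar> powr r)" for n
    using wn di by (simp_all add: v_def)
  note [measurable] = v(1)
  have vlim: "(\<lambda>n. \<integral>x. \<bar>v n x - w x\<bar> powr r \<partial>M) \<longlonglongrightarrow> 0"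
    using LIMSEQ_subseq_LIMSEQ[OF LIMSEQ_subseq_LIMSEQ[OF lim \<sigma>] \<rho>] by (simp add: o_def v_def)
  have vae: "AE x in M. (\<lambda>n. v n x) \<longlonglongrightarrow> w x"
    using ae
  proof eventually_elim
    case (elim x)
    have "(\<lambda>n. (\<bar>v n x - w x\<bar> powr r) powr (1 / r)) \<longlonglongrightarrow> 0"
      by (rule tendsto_zero_powrI[OF elim[folded v_def] tendsto_const]) (use r in auto)
    then have "(\<lambda>n. \<bar>v n x - w x\<bar>) \<longlonglongrightarrow> 0" using r by (simp add: powr_powr)
    then show ?case by (simp add: tendsto_rabs_zero_iff LIM_zero_iff)
  qed
  define dom where "dom x = K * \<bar>w x\<bar> powr r + C * \<bar>w x\<bar> powr r" for x
  have dom: "integrable M dom" using w unfolding dom_def by simp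
  define D where "D n x = max 0 (\<bar>H x (v n x) - H x (w x)\<bar> - K * \<bar>v n x - w x\<bar> powr r)" for n x
  have D_le: "D n x \<le> dom x" if "x \<in> space M" for n x
  proof -
    have "\<bar>H x (v n x)\<bar> \<le> C * \<bar>v n x\<bar> powr r" using growth that by blast
    also have "\<dots> \<le> C * (2 powr r * (\<bar>v n x - w x\<bar> powr r + \<bar>w x\<bar> powr r))"
      using powr_add_le[of r "v n x - w x" "w x"] r C by (intro mult_left_mono) auto
    also have "\<dots> = K * \<bar>v n x - w x\<bar> powr r + K * \<bar>w x\<bar> powr r" by (simp add: K_def algebra_simps)
    finally have "\<bar>H x (v n x)\<bar> \<le> K * \<bar>v n x - w x\<bar> powr r + K * \<bar>w x\<bar> powr r" .
    moreover have "\<bar>H x (w x)\<bar> \<le> C * \<bar>w x\<bar> powr r" using growth that by blast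
    moreover have "0 \<le> dom x" using K C by (simp add: dom_def)
    ultimately show ?thesis unfolding D_def dom_def by linarith
  qed
  have Dm: "D n \<in> borel_measurable M" for n unfolding D_def by measurable
  have D_bound: "AE x in M. norm (D n x) \<le> dom x" for n
  proof (rule AE_I2)
    fix x assume "x \<in> space M"
    then show "norm (D n x) \<le> dom x"
      using D_le[of x n] by (simp add: D_def)
  qed
  have Di: "integrable M (D n)" for n
  proof (rule Bochner_Integration.integrable_bound[OF _ Dm])
    show "integrable M dom" by (rule dom)
    show "AE x in M. norm (D n x) \<le> norm (dom x)"
      using D_bound[of n] by eventually_elim simp
  qed
  have "(\<lambda>n. \<integral>x. D n x \<partial>M) \<longlonglongrightarrow> (\<integral>x. 0 \<partial>M)"
  proof (rule integral_dominated_convergence[where w = dom])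
    show "AE x in M. (\<lambda>n. D n x) \<longlonglongrightarrow> 0"
      using vae AE_space
    proof eventually_elim
      case (elim x)
      have 1: "(\<lambda>n. H x (v n x)) \<longlonglongrightarrow> H x (w x)"
        by (rule continuous_on_tendsto_compose[OF cont elim(1)]) (use elim in auto)
      have "(\<lambda>n. \<bar>v n x - w x\<bar>) \<longlonglongrightarrow> 0" using elim(1) by (simp add: tendsto_rabs_zero_iff LIM_zero_iff)
      then have 2: "(\<lambda>n. \<bar>v n x - w x\<bar> powr r) \<longlonglongrightarrow> 0"
        by (rule tendsto_zero_powrI[OF _ tendsto_const]) (use r in auto)
      have "(\<lambda>n. max 0 (\<bar>H x (v n x) - H x (w x)\<bar> - K * \<bar>v n x - w x\<bar> powr r)) \<longlonglongrightarrow> max 0 (\<bar>H x (w x) - H x (w x)\<bar> - K * 0)"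
        by (intro tendsto_intros 1 2)
      then show ?case by (simp add: D_def)
    qed
    show "AE x in M. norm (D n x) \<le> dom x" for n
      by (rule D_bound)
  qed (use Dm dom in simp_all)
  then have Dlim: "(\<lambda>n. (\<integral>x. D n x \<partial>M) + K * (\<integral>x. \<bar>v n x - w x\<bar> powr r \<partial>M)) \<longlonglongrightarrow> 0 + K * 0"
    by (intro tendsto_intros vlim) simp
  have bound: "norm ((\<integral>x. H x (v n x) \<partial>M) - (\<integral>x. H x (w x) \<partial>M))
     \<le> (\<integral>x. D n x \<partial>M) + K * (\<integral>x. \<bar>v n x - w x\<bar> powr r \<partial>M)" for n
  proof -
    have "(\<integral>x. H x (v n x) \<partial>M) - (\<integral>x. H x (w x) \<partial>M) = (\<integral>x. H x (v n x) - H x (w x) \<partial>M)"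
      using Hi v w by (intro Bochner_Integration.integral_diff[symmetric]) auto
    also have "norm \<dots> \<le> (\<integral>x. \<bar>H x (v n x) - H x (w x)\<bar> \<partial>M)"
      using integral_abs_bound by simp
    also have "\<dots> \<le> (\<integral>x. D n x + K * \<bar>v n x - w x\<bar> powr r \<partial>M)"
      using Hi v w Di by (intro integral_mono) (auto simp: D_def)
    also have "\<dots> = (\<integral>x. D n x \<partial>M) + K * (\<integral>x. \<bar>v n x - w x\<bar> powr r \<partial>M)"
      using Di v by simp
    finally show ?thesis .
  qed
  have "(\<lambda>n. (\<integral>x. H x (v n x) \<partial>M) - (\<integral>x. H x (w x) \<partial>M)) \<longlonglongrightarrow> 0"
    by (rule Lim_null_comparison[OF always_eventually]) (use bound Dlim in auto)
  then show "\<exists>\<rho> :: nat \<Rightarrow> nat. strict_mono \<rho> \<and> (\<lambda>n. \<integral>x. H x (wn (\<sigma> (\<rho> n)) x) \<partial>M) \<longlonglongrightarrow> (\<integral>x. H x (w x) \<partial>M)"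
    using \<rho> by (auto simp: v_def LIM_zero_iff)
qed

section \<open>The Nehari manifold\<close>

lemma Lp2_norm_eq_0_imp:
  assumes "w \<in> Lp 2 \<Omega>" "Lp_norm 2 \<Omega> w = 0"
  shows "AE x in lebesgue_on \<Omega>. w x = 0"
proof -
  have "(\<integral>x. (w x)\<^sup>2 \<partial>lebesgue_on \<Omega>) = 0" using Lp2_norm_sq[of \<Omega> w] assms(2) by simp
  then have "AE x in lebesgue_on \<Omega>. (w x)\<^sup>2 = 0"
    using assms(1) by (subst (asm) integral_nonneg_eq_0_iff_AE) (auto simp: Lp2_iff)
  then show ?thesis by simp
qed

locale nehari_setting =
  fixes s :: real and \<Omega> :: "(real^'n) set" and f :: "real^'n \<Rightarrow> real \<Rightarrow> real" and r C \<theta> \<Theta> :: real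
  assumes s: "0 < s" "s < 1"
    and dim: "real CARD('n) \<le> 2 * s"
    and domain: "open \<Omega>" "bounded \<Omega>"
    and f_meas: "\<And>t. (\<lambda>x. f x t) \<in> borel_measurable (lebesgue_on \<Omega>)"
    and r: "1 < r" "r < real CARD('n) / (real CARD('n) - s)" and C: "C > 0"
    and f_growth: "\<And>x t. x \<in> \<Omega> \<Longrightarrow> \<bar>f x t\<bar> \<le> C * \<bar>t\<bar> powr (r - 1)"
    and \<theta>: "\<theta> > 1"
    and F_pos: "\<And>x t. x \<in> \<Omega> \<Longrightarrow> t \<noteq> 0 \<Longrightarrow> 0 < \<theta> * primitive f x t"
    and F_le: "\<And>x t. x \<in> \<Omega> \<Longrightarrow> t \<noteq> 0 \<Longrightarrow> \<theta> * primitive f x t \<le> t * f x t"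
    and f_C1: "\<And>x. x \<in> \<Omega> \<Longrightarrow> f x C1_differentiable_on UNIV"
    and \<Theta>: "\<Theta> > 1"
    and f_superlinear: "\<And>x t. x \<in> \<Omega> \<Longrightarrow> t \<noteq> 0 \<Longrightarrow> (\<Theta> - 1) * f x t * t < t\<^sup>2 * deriv (f x) t"
begin

abbreviation "L \<equiv> lebesgue_on \<Omega>"
abbreviation "X \<equiv> Ws1 s \<Omega>"
abbreviation "W \<equiv> Ws1_norm s \<Omega>"
abbreviation "E \<equiv> energy s \<Omega> f"
abbreviation "I \<equiv> nehari_functional s \<Omega> f"
abbreviation "NM \<equiv> nehari_manifold s \<Omega> f"
abbreviation "depth \<equiv> well_depth s \<Omega> f"

abbreviation vanishes :: "(real^'n \<Rightarrow> real) \<Rightarrow> bool" where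
  "vanishes w \<equiv> AE x in lebesgue. w x = 0"

abbreviation ray :: "real \<Rightarrow> (real^'n \<Rightarrow> real) \<Rightarrow> real^'n \<Rightarrow> real" where
  "ray l w \<equiv> \<lambda>x. l * w x"

definition "A w = (\<integral>x. f x (w x) * w x \<partial>L)"
definition "B w = (\<integral>x. primitive f x (w x) \<partial>L)"

lemma W_nonneg: "0 \<le> W w" by (rule Ws1_norm_nonneg)
lemma I_eq: "I w = W w - A w" by (simp add: nehari_functional_def A_def)
lemma E_eq: "E w = W w - B w" by (simp add: energy_def B_def)

lemma \<Omega>_sets: "\<Omega> \<inter> space lebesgue \<in> sets lebesgue" using domain(1) by simp

lemma space_L: "space L = \<Omega>" by (simp add: space_restrict_space)

lemma s_less_N: "s < real CARD('n)"
proof -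
  have "1 \<le> real CARD('n)" by (simp add: Suc_leI)
  then show ?thesis using s by linarith
qed

lemma two_le_critical: "2 \<le> real CARD('n) / (real CARD('n) - s)"
  using s_less_N dim by (simp add: field_simps)

lemma one_less_critical: "1 < real CARD('n) / (real CARD('n) - s)"
  using two_le_critical by simp

section \<open>Pointwise estimates for the nonlinearity\<close>

lemma f_deriv: "x \<in> \<Omega> \<Longrightarrow> (f x has_real_derivative deriv (f x) t) (at t)"
  using f_C1[of x] unfolding C1_differentiable_on_def
  by (auto simp: has_real_derivative_iff_has_vector_derivative[symmetric]) (metis DERIV_imp_deriv)

lemma f_cont: "x \<in> \<Omega> \<Longrightarrow> continuous_on UNIV (f x)"
  by (intro continuous_at_imp_continuous_on ballI DERIV_isCont[OF f_deriv])

lemma F_deriv: "x \<in> \<Omega> \<Longrightarrow> (primitive f x has_real_derivative f x t) (at t)"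
  by (rule primitive_has_derivative[OF f_cont])

lemma F_cont: "x \<in> \<Omega> \<Longrightarrow> continuous_on UNIV (primitive f x)"
  by (intro continuous_at_imp_continuous_on ballI DERIV_isCont[OF F_deriv])

lemma ft_pos: "x \<in> \<Omega> \<Longrightarrow> t \<noteq> 0 \<Longrightarrow> 0 < f x t * t"
  using F_pos[of x t] F_le[of x t] by (simp add: mult.commute)

lemma ft_nonneg: "x \<in> \<Omega> \<Longrightarrow> 0 \<le> f x t * t"
  using ft_pos[of x t] by (cases "t = 0") auto

lemma F_nonneg: "x \<in> \<Omega> \<Longrightarrow> 0 \<le> primitive f x t"
  using F_pos[of x t] \<theta> by (cases "t = 0") (auto simp: primitive_0 zero_less_mult_iff)

lemma theta_F_le: "x \<in> \<Omega> \<Longrightarrow> \<theta> * primitive f x t \<le> f x t * t"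
  using F_le[of x t] by (cases "t = 0") (auto simp: primitive_0 mult.commute)

lemma F_le_ft: "x \<in> \<Omega> \<Longrightarrow> primitive f x t \<le> f x t * t"
  using theta_F_le[of x t] F_nonneg[of x t] mult_right_mono[of 1 \<theta> "primitive f x t"] \<theta> by simp

lemma ft_growth:
  assumes "x \<in> \<Omega>"
  shows "\<bar>f x t * t\<bar> \<le> C * \<bar>t\<bar> powr r"
proof (cases "t = 0")
  case False
  have "\<bar>f x t * t\<bar> \<le> C * \<bar>t\<bar> powr (r - 1) * \<bar>t\<bar> powr 1"
    using f_growth[OF assms, of t] by (simp add: abs_mult mult_right_mono)
  also have "\<dots> = C * \<bar>t\<bar> powr r" unfolding mult.assoc powr_add[symmetric] by simp
  finally show ?thesis .
qed simp

lemma F_growth: "x \<in> \<Omega> \<Longrightarrow> \<bar>primitive f x t\<bar> \<le> C * \<bar>t\<bar> powr r"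
  using F_nonneg[of x t] F_le_ft[of x t] ft_growth[of x t] by linarith

text \<open>\<open>f_superlinear\<close> says exactly that
  \<open>l powr (1 - \<Theta>) * (f x (l * t) * t)\<close> has a positive derivative in
  \<open>l\<close> when \<open>t\<close> is nonzero, so its value at 1 is a lower bound.\<close>

lemma f_scale_ge:
  assumes x: "x \<in> \<Omega>" and l: "1 \<le> l"
  shows "l powr (\<Theta> - 1) * (f x t * t) \<le> f x (l * t) * t"
proof (cases "t = 0")
  case False
  let ?h = "\<lambda>l. l powr (1 - \<Theta>) * (f x (l * t) * t)"
  have "?h 1 \<le> ?h l"
  proof (rule DERIV_nonneg_imp_nondecreasing[OF l])
    fix y :: real assume y: "1 \<le> y"
    have 1: "((\<lambda>l. f x (l * t)) has_real_derivative deriv (f x) (y * t) * t) (at y)"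
      by (rule DERIV_chain2[OF f_deriv[OF x]]) (auto intro!: derivative_eq_intros)
    have 2: "((\<lambda>l. l powr (1 - \<Theta>)) has_real_derivative (1 - \<Theta>) * y powr (1 - \<Theta> - 1)) (at y)"
      using y by (intro has_real_derivative_powr) simp
    let ?D = "(1 - \<Theta>) * y powr (1 - \<Theta> - 1) * (f x (y * t) * t) + (deriv (f x) (y * t) * t * t) * y powr (1 - \<Theta>)"
    have "(?h has_real_derivative ?D) (at y)"
      by (rule DERIV_mult[OF 2 DERIV_cmult_right[OF 1]])
    moreover have "0 \<le> ?D"
    proof -
      have "(\<Theta> - 1) * f x (y * t) * (y * t) < (y * t)\<^sup>2 * deriv (f x) (y * t)"
        using False y by (intro f_superlinear[OF x]) simp
      then have "y * ((\<Theta> - 1) * (f x (y * t) * t)) \<le> y * (y * (t * t * deriv (f x) (y * t)))"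
        by (simp add: power2_eq_square algebra_simps)
      then have le: "(\<Theta> - 1) * (f x (y * t) * t) \<le> y * (t * t * deriv (f x) (y * t))"
        using y by (subst (asm) mult_le_cancel_left_pos) auto
      have "y powr (1 - \<Theta>) = y powr (1 - \<Theta> - 1) * y"
        using y powr_add[of y "1 - \<Theta> - 1" 1] by simp
      then have "?D = y powr (1 - \<Theta> - 1) * (y * (t * t * deriv (f x) (y * t)) - (\<Theta> - 1) * (f x (y * t) * t))"
        by (simp only:) (simp add: algebra_simps)
      then show ?thesis using le by (simp add: mult_nonneg_nonneg)
    qed
    ultimately show "\<exists>z. (?h has_real_derivative z) (at y) \<and> 0 \<le> z" by blast
  qed
  then have "l powr (\<Theta> - 1) * (f x t * t) \<le> l powr (\<Theta> - 1) * (l powr (1 - \<Theta>) * (f x (l * t) * t))"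
    by (intro mult_left_mono) auto
  also have "\<dots> = f x (l * t) * t"
    using l by (simp add: mult.assoc[symmetric] flip: powr_add)
  finally show ?thesis .
qed simp

text \<open>The factor \<open>1 / l \<ge> 1\<close>, applied at the point \<open>l * t\<close>,
  leads back to \<open>t\<close>.\<close>

lemma f_scale_le:
  assumes x: "x \<in> \<Omega>" and l: "0 < l" "l \<le> 1"
  shows "f x (l * t) * t \<le> l powr (\<Theta> - 1) * (f x t * t)"
proof -
  have "(1 / l) powr (\<Theta> - 1) * (f x (l * t) * (l * t)) \<le> f x (1 / l * (l * t)) * (l * t)"
    by (rule f_scale_ge[OF x]) (use l in simp)
  then have "l * ((1 / l) powr (\<Theta> - 1) * (f x (l * t) * t)) \<le> l * (f x t * t)"
    using l by (simp add: mult.left_commute mult.commute)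
  then have "(1 / l) powr (\<Theta> - 1) * (f x (l * t) * t) \<le> f x t * t"
    using l by (subst (asm) mult_le_cancel_left_pos) auto
  then have "l powr (\<Theta> - 1) * ((1 / l) powr (\<Theta> - 1) * (f x (l * t) * t)) \<le> l powr (\<Theta> - 1) * (f x t * t)"
    by (intro mult_left_mono) auto
  moreover have "l powr (\<Theta> - 1) * (1 / l) powr (\<Theta> - 1) = 1"
    using l powr_mult[of l "1 / l" "\<Theta> - 1"] by simp
  ultimately show ?thesis by (simp add: mult.assoc[symmetric])
qed

lemma F_ray_deriv:
  "x \<in> \<Omega> \<Longrightarrow> ((\<lambda>l. primitive f x (l * t)) has_real_derivative f x (l * t) * t) (at l)"
  by (rule DERIV_chain2[OF F_deriv]) (auto intro!: derivative_eq_intros)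

lemma F_ray_mono:
  assumes x: "x \<in> \<Omega>" and l: "1 \<le> l"
  shows "primitive f x t \<le> primitive f x (l * t)"
proof -
  have "primitive f x (1 * t) \<le> primitive f x (l * t)"
  proof (rule DERIV_nonneg_imp_nondecreasing[OF l])
    fix y :: real assume "1 \<le> y"
    then have "0 \<le> y * (f x (y * t) * t)" using ft_nonneg[OF x, of "y * t"] by (simp add: mult.left_commute)
    then have "0 \<le> f x (y * t) * t" using \<open>1 \<le> y\<close> by (simp add: zero_le_mult_iff)
    then show "\<exists>z. ((\<lambda>l. primitive f x (l * t)) has_real_derivative z) (at y) \<and> 0 \<le> z"
      using F_ray_deriv[OF x] by blast
  qed
  then show ?thesis by simp
qed

text \<open>By the mean value theorem the difference is \<open>(1 - l)\<close> times
  \<open>f x (z * t) * t\<close> with \<open>z < 1\<close>, and along the ray this product is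
  largest at \<open>z = 1\<close>.\<close>

lemma F_ray_diff_le:
  assumes x: "x \<in> \<Omega>" and l: "0 < l" "l < 1"
  shows "primitive f x t - primitive f x (l * t) \<le> (1 - l) * (f x t * t)"
proof -
  obtain z where z: "l < z" "z < 1" "primitive f x (1 * t) - primitive f x (l * t) = (1 - l) * (f x (z * t) * t)"
    using MVT2[OF l(2), of "\<lambda>l. primitive f x (l * t)" "\<lambda>l. f x (l * t) * t"] F_ray_deriv[OF x] by blast
  have "f x (z * t) * t \<le> z powr (\<Theta> - 1) * (f x t * t)"
    using f_scale_le[OF x, of z t] z l by simp
  also have "\<dots> \<le> 1 * (f x t * t)"
    using z l \<Theta> ft_nonneg[OF x, of t] powr_mono2[of "\<Theta> - 1" z 1] by (intro mult_right_mono) auto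
  finally show ?thesis using z l by (simp add: mult_left_mono)
qed

section \<open>Embeddings and almost everywhere invariance\<close>

lemma Ws1_Lp:
  assumes "1 \<le> p" "p \<le> real CARD('n) / (real CARD('n) - s)"
  obtains K where "0 < K" "\<And>w. w \<in> X \<Longrightarrow> integrable L (\<lambda>x. \<bar>w x\<bar> powr p)"
    "\<And>w. w \<in> X \<Longrightarrow> (\<integral>x. \<bar>w x\<bar> powr p \<partial>L) \<le> K * W w powr p"
  by (rule fractional_Sobolev[OF s(1) s_less_N domain assms]) blast

lemma Ws1_measurable: "w \<in> X \<Longrightarrow> w \<in> borel_measurable L"
  by (simp add: Ws1_def Lp_def)

lemma Ws1_integrable_powr:
  assumes "w \<in> X" "1 \<le> p" "p \<le> real CARD('n) / (real CARD('n) - s)"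
  shows "integrable L (\<lambda>x. \<bar>w x\<bar> powr p)"
  using Ws1_Lp[OF assms(2,3)] assms(1) by metis

lemma Ws1_r: "w \<in> X \<Longrightarrow> integrable L (\<lambda>x. \<bar>w x\<bar> powr r)"
  using r by (intro Ws1_integrable_powr) auto

lemma Ws1_Lp2: "w \<in> X \<Longrightarrow> w \<in> Lp 2 \<Omega>"
  using Ws1_integrable_powr[of w 2] two_le_critical Ws1_measurable by (simp add: Lp_def)

text \<open>The source of \<open>C\<^sub>S\<^sub>o\<^sub>b\<close>: by
  \<open>two_le_critical\<close> the exponent 2 is allowed in the fractional Sobolev
  inequality.\<close>

lemma Sobolev_L2: obtains S where "0 < S" "\<And>w. w \<in> X \<Longrightarrow> S * Lp_norm 2 \<Omega> w \<le> W w"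
proof -
  have "(1::real) \<le> 2" by simp
  from Ws1_Lp[OF this two_le_critical] obtain K where K: "0 < K"
    "\<And>w. w \<in> X \<Longrightarrow> (\<integral>x. \<bar>w x\<bar> powr 2 \<partial>L) \<le> K * W w powr 2" by metis
  show thesis
  proof (rule that[of "1 / sqrt K"])
    fix w assume "w \<in> X"
    have "(Lp_norm 2 \<Omega> w)\<^sup>2 = (\<integral>x. \<bar>w x\<bar> powr 2 \<partial>L)" by (simp add: Lp2_norm_sq)
    also have "\<dots> \<le> K * W w powr 2" by (rule K(2)) fact
    also have "\<dots> = (sqrt K * W w)\<^sup>2"
      using K(1) W_nonneg[of w] by (simp add: power_mult_distrib)
    finally have "(Lp_norm 2 \<Omega> w)\<^sup>2 \<le> (sqrt K * W w)\<^sup>2" .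
    then have "Lp_norm 2 \<Omega> w \<le> sqrt K * W w"
      by (rule power2_le_imp_le) (use K(1) W_nonneg[of w] in simp)
    then show "1 / sqrt K * Lp_norm 2 \<Omega> w \<le> W w" using K(1) by (simp add: field_simps)
  qed (use K(1) in simp)
qed

lemma Ws1_zero_outside: "w \<in> X \<Longrightarrow> AE x in lebesgue. x \<notin> \<Omega> \<longrightarrow> w x = 0"
  by (simp add: Ws1_def)

lemma AE_L_imp_AE:
  assumes "w \<in> X" "AE x in L. w x = 0"
  shows "vanishes w"
proof -
  have "AE x in lebesgue. x \<in> \<Omega> \<longrightarrow> w x = 0"
    using assms(2) \<Omega>_sets by (simp add: AE_restrict_space_iff)
  with Ws1_zero_outside[OF assms(1)] show ?thesis by eventually_elim auto
qed

lemma Lp2_norm_zero: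
  assumes "w \<in> X" "Lp_norm 2 \<Omega> w = 0"
  shows "vanishes w"
  using AE_L_imp_AE[OF assms(1) Lp2_norm_eq_0_imp[OF Ws1_Lp2]] assms by blast

lemma W_zero:
  assumes w: "w \<in> X" "W w = 0"
  shows "vanishes w"
proof -
  obtain S where S: "0 < S" "S * Lp_norm 2 \<Omega> w \<le> W w" using Sobolev_L2 w(1) by metis
  then have "Lp_norm 2 \<Omega> w \<le> 0" using w(2) by (simp add: mult_le_0_iff)
  then have "Lp_norm 2 \<Omega> w = 0" using Lp_norm_nonneg[of 2 \<Omega> w] by simp
  then show ?thesis by (rule Lp2_norm_zero[OF w(1)])
qed

lemma W_pos: "w \<in> X \<Longrightarrow> \<not> vanishes w \<Longrightarrow> 0 < W w"
  using W_zero[of w] W_nonneg[of w] by fastforce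

lemma AE_pair_lebesgue:
  assumes "AE x in lebesgue. P (x :: real^'n)"
  shows "AE z in (lebesgue :: ((real^'n) \<times> (real^'n)) measure). P (fst z) \<and> P (snd z)"
  using AE_lborel_fst[of P, where 'b = "real^'n"] AE_lborel_snd[of P, where 'a = "real^'n"] assms
  unfolding AE_completion_iff by (auto intro: AE_conjI)

lemma W_cong:
  assumes w: "w \<in> X" "w' \<in> X" and eq: "AE x in lebesgue. w x = w' x"
  shows "W w = W w'"
  unfolding Ws1_norm_def set_lebesgue_integral_def
proof (rule integral_cong_AE)
  show "AE z in lebesgue. indicator (Qset \<Omega>) z *\<^sub>R (case z of (x, y) \<Rightarrow> \<bar>w x - w y\<bar> / kernel s x y)
     = indicator (Qset \<Omega>) z *\<^sub>R (case z of (x, y) \<Rightarrow> \<bar>w' x - w' y\<bar> / kernel s x y)"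
    using AE_pair_lebesgue[OF eq] by eventually_elim (simp add: case_prod_beta)
qed (use w in \<open>auto simp: Ws1_def set_integrable_def\<close>)

text \<open>What \<open>f x t * t\<close> and \<open>primitive f x t\<close> have in common, so that
  integrability and convergence are proved once for both \<open>A\<close> and
  \<open>B\<close>.\<close>

definition admissible :: "(real^'n \<Rightarrow> real \<Rightarrow> real) \<Rightarrow> bool" where
  "admissible H \<longleftrightarrow> (\<forall>t. (\<lambda>x. H x t) \<in> borel_measurable L) \<and>
     (\<forall>x\<in>\<Omega>. continuous_on UNIV (H x)) \<and> (\<forall>x\<in>\<Omega>. \<forall>t. \<bar>H x t\<bar> \<le> C * \<bar>t\<bar> powr r)"

lemma admissible_ft: "admissible (\<lambda>x t. f x t * t)"
  using f_meas f_cont ft_growth by (auto simp: admissible_def intro!: continuous_intros)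

lemma admissible_F: "admissible (primitive f)"
  using measurable_primitive[OF f_meas] f_cont F_cont F_growth by (auto simp: admissible_def space_L)

lemma admissible_measurable:
  assumes "admissible H" "w \<in> borel_measurable L"
  shows "(\<lambda>x. H x (w x)) \<in> borel_measurable L"
  by (rule measurable_Caratheodory[OF _ _ assms(2)]) (use assms(1) in \<open>auto simp: admissible_def space_L\<close>)

lemma admissible_cong:
  assumes H: "admissible H" and w: "AE x in L. w x = w' x" "w \<in> X" "w' \<in> X"
  shows "(\<integral>x. H x (w x) \<partial>L) = (\<integral>x. H x (w' x) \<partial>L)"
proof (rule integral_cong_AE)
  show "AE x in L. H x (w x) = H x (w' x)" using w(1) by eventually_elim simp
qed (use admissible_measurable[OF H] Ws1_measurable w in auto)

lemma admissible_integrable: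
  assumes H: "admissible H" and w: "w \<in> X"
  shows "integrable L (\<lambda>x. H x (w x))"
proof (rule Bochner_Integration.integrable_bound)
  show "integrable L (\<lambda>x. C * \<bar>w x\<bar> powr r)" using Ws1_r[OF w] by simp
  show "AE x in L. norm (H x (w x)) \<le> norm (C * \<bar>w x\<bar> powr r)"
    using H C by (intro AE_I2) (simp add: space_L admissible_def)
qed (rule admissible_measurable[OF H Ws1_measurable[OF w]])

lemma admissible_tendsto:
  assumes H: "admissible H" and w: "w \<in> X" "\<And>n. wn n \<in> X"
    and lim: "(\<lambda>n. \<integral>x. \<bar>wn n x - w x\<bar> powr r \<partial>L) \<longlonglongrightarrow> 0"
  shows "(\<lambda>n. \<integral>x. H x (wn n x) \<partial>L) \<longlonglongrightarrow> (\<integral>x. H x (w x) \<partial>L)"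
  by (rule superposition_tendsto[where C = C and r = r, OF _ _ _ _ _ _ _ _ _ lim])
    (use H w C r Ws1_measurable Ws1_r in \<open>auto simp: admissible_def space_L\<close>)

lemma A_integrable: "w \<in> X \<Longrightarrow> integrable L (\<lambda>x. f x (w x) * w x)"
  by (rule admissible_integrable[OF admissible_ft])

lemma B_integrable: "w \<in> X \<Longrightarrow> integrable L (\<lambda>x. primitive f x (w x))"
  by (rule admissible_integrable[OF admissible_F])

lemma AE_eq_imp:
  assumes "w \<in> X" "w' \<in> X" "AE x in L. w x = w' x"
  shows "W w = W w'" "I w = I w'" "E w = E w'" "Lp_norm 2 \<Omega> w = Lp_norm 2 \<Omega> w'"
proof -
  have "AE x in lebesgue. x \<in> \<Omega> \<longrightarrow> w x = w' x"
    using assms(3) \<Omega>_sets by (simp add: AE_restrict_space_iff)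
  with Ws1_zero_outside[OF assms(1)] Ws1_zero_outside[OF assms(2)]
  have eq: "AE x in lebesgue. w x = w' x" by eventually_elim auto
  show W: "W w = W w'" by (rule W_cong[OF assms(1,2) eq])
  show "I w = I w'" "E w = E w'"
    using W admissible_cong[OF admissible_ft assms(3,1,2)] admissible_cong[OF admissible_F assms(3,1,2)]
    by (simp_all add: I_eq E_eq A_def B_def)
  show "Lp_norm 2 \<Omega> w = Lp_norm 2 \<Omega> w'"
    unfolding Lp2_norm using assms(3) Ws1_measurable[OF assms(1)] Ws1_measurable[OF assms(2)]
    by (intro arg_cong[where f = sqrt] integral_cong_AE) auto
qed

lemma zero_in_Ws1: "(\<lambda>x. 0) \<in> X"
  by (simp add: Ws1_def Lp_def set_integrable_def case_prod_beta)

lemma zero_values: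
  assumes "w \<in> X" "vanishes w"
  shows "W w = 0" "I w = 0" "E w = 0" "Lp_norm 2 \<Omega> w = 0"
proof -
  have "AE x in L. w x = (\<lambda>x. 0) x"
    using assms(2) \<Omega>_sets by (auto simp: AE_restrict_space_iff elim: eventually_mono)
  from AE_eq_imp[OF assms(1) zero_in_Ws1 this]
  show "W w = 0" "I w = 0" "E w = 0" "Lp_norm 2 \<Omega> w = 0"
    by (simp_all add: I_eq E_eq A_def B_def primitive_0 Ws1_norm_def set_lebesgue_integral_def Lp2_norm case_prod_beta)
qed

lemma A_nonneg: "0 \<le> A w"
  unfolding A_def by (rule Bochner_Integration.integral_nonneg_AE) (auto intro!: AE_I2 ft_nonneg simp: space_L)

lemma A_pos:
  assumes w: "w \<in> X" "\<not> vanishes w"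
  shows "0 < A w"
proof (rule ccontr)
  assume "\<not> 0 < A w"
  then have "A w = 0" using A_nonneg[of w] by simp
  then have "AE x in L. f x (w x) * w x = 0"
    unfolding A_def using A_integrable[OF w(1)] ft_nonneg
    by (subst (asm) integral_nonneg_eq_0_iff_AE) (auto intro!: AE_I2 simp: space_L)
  then have "AE x in L. w x = 0"
    using AE_space
  proof eventually_elim
    case (elim x)
    then show ?case using ft_pos[of x "w x"] by (cases "w x = 0") (auto simp: space_L)
  qed
  then show False using AE_L_imp_AE[OF w(1)] w(2) by blast
qed

text \<open>As \<open>r > 1\<close>, this makes \<open>A\<close> smaller than \<open>W\<close> near
  the origin, which keeps the nonzero functions with \<open>I w \<le> 0\<close> away from
  it.\<close>

lemma A_le_W: obtains K where "0 < K" "\<And>w. w \<in> X \<Longrightarrow> A w \<le> K * W w powr r"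
proof -
  have "1 \<le> r" "r \<le> real CARD('n) / (real CARD('n) - s)" using r by auto
  from Ws1_Lp[OF this] obtain K where K: "0 < K"
    "\<And>w. w \<in> X \<Longrightarrow> (\<integral>x. \<bar>w x\<bar> powr r \<partial>L) \<le> K * W w powr r" by metis
  show thesis
  proof (rule that[of "C * K"])
    fix w assume w: "w \<in> X"
    have "A w \<le> (\<integral>x. C * \<bar>w x\<bar> powr r \<partial>L)"
      unfolding A_def using A_integrable[OF w] Ws1_r[OF w] ft_growth
      by (intro integral_mono) (auto simp: space_L intro: order_trans[OF abs_ge_self])
    also have "\<dots> \<le> C * (K * W w powr r)" using K(2)[OF w] C by simp
    finally show "A w \<le> C * K * W w powr r" by (simp add: mult.assoc)
  qed (use K(1) C in simp)
qed

section \<open>Scaling along rays and projection onto the Nehari manifold\<close>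

lemma scale_Ws1:
  assumes w: "w \<in> X"
  shows "(ray l w) \<in> X" "W (ray l w) = \<bar>l\<bar> * W w"
proof -
  have eq: "(\<lambda>z. indicator (Qset \<Omega>) z *\<^sub>R (case z of (x, y) \<Rightarrow> \<bar>l * w x - l * w y\<bar> / kernel s x y))
     = (\<lambda>z. \<bar>l\<bar> * (indicator (Qset \<Omega>) z *\<^sub>R (case z of (x, y) \<Rightarrow> \<bar>w x - w y\<bar> / kernel s x y)))"
    by (auto simp: fun_eq_iff right_diff_distrib[symmetric] abs_mult)
  show "W (ray l w) = \<bar>l\<bar> * W w"
    unfolding Ws1_norm_def set_lebesgue_integral_def eq by simp
  have "set_integrable lebesgue (Qset \<Omega>) (\<lambda>(x, y). \<bar>l * w x - l * w y\<bar> / kernel s x y)"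
    unfolding set_integrable_def eq using w by (auto simp: Ws1_def set_integrable_def)
  moreover have "(ray l w) \<in> Lp 1 \<Omega>"
    using w by (auto simp: Ws1_def Lp_def abs_mult)
  ultimately show "(ray l w) \<in> X"
    using Ws1_zero_outside[OF w] by (auto simp: Ws1_def elim!: eventually_mono)
qed

lemma scale_nonzero:
  assumes "\<not> vanishes w" "l \<noteq> (0::real)"
  shows "\<not> (AE x in lebesgue. l * w x = 0)"
  using assms by simp

lemma A_scale_ge:
  assumes w: "w \<in> X" and l: "1 \<le> l"
  shows "l powr \<Theta> * A w \<le> A (ray l w)"
proof -
  note lw = scale_Ws1(1)[OF w, of l]
  have "l powr \<Theta> * A w = (\<integral>x. l powr \<Theta> * (f x (w x) * w x) \<partial>L)" by (simp add: A_def)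
  also have "\<dots> \<le> A (ray l w)"
    unfolding A_def
  proof (rule integral_mono)
    fix x assume "x \<in> space L"
    then have "l * (l powr (\<Theta> - 1) * (f x (w x) * w x)) \<le> l * (f x (l * w x) * w x)"
      using f_scale_ge[of x l "w x"] l by (intro mult_left_mono) (auto simp: space_L)
    moreover have "l powr \<Theta> = l * l powr (\<Theta> - 1)" using l powr_add[of l 1 "\<Theta> - 1"] by simp
    ultimately show "l powr \<Theta> * (f x (w x) * w x) \<le> f x (l * w x) * (l * w x)"
      by (simp add: mult.left_commute mult.assoc)
  qed (use A_integrable[OF w] A_integrable[OF lw] in simp_all)
  finally show ?thesis .
qed

lemma A_scale_le:
  assumes w: "w \<in> X" and l: "0 < l" "l \<le> 1"
  shows "A (ray l w) \<le> l powr \<Theta> * A w"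
proof -
  have "(1 / l) powr \<Theta> * A (ray l w) \<le> A (ray (1 / l) (ray l w))"
    using l by (intro A_scale_ge scale_Ws1(1)[OF w]) simp
  then have "l powr \<Theta> * ((1 / l) powr \<Theta> * A (ray l w)) \<le> l powr \<Theta> * A w"
    using l by (intro mult_left_mono) auto
  moreover have "l powr \<Theta> * (1 / l) powr \<Theta> = 1" using l powr_mult[of l "1 / l" \<Theta>] by simp
  ultimately show ?thesis by (simp add: mult.assoc[symmetric])
qed

lemma I_ray_continuous:
  assumes w: "w \<in> X"
  shows "continuous_on {0..} (\<lambda>l. I (ray l w))"
  unfolding continuous_on_sequentially
proof (intro allI ballI impI, elim conjE)
  fix lam :: "nat \<Rightarrow> real" and l assume l: "l \<in> {0..}" and lam: "\<forall>n. lam n \<in> {0..}" "lam \<longlonglongrightarrow> l"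
  have "(\<lambda>n. A (ray (lam n) w)) \<longlonglongrightarrow> A (ray l w)"
    unfolding A_def
  proof (rule admissible_tendsto[OF admissible_ft])
    have "(\<lambda>n. \<bar>lam n - l\<bar>) \<longlonglongrightarrow> 0" using lam(2) by (simp add: tendsto_rabs_zero_iff LIM_zero_iff)
    then have "(\<lambda>n. \<bar>lam n - l\<bar> powr r) \<longlonglongrightarrow> 0"
      by (rule tendsto_zero_powrI[OF _ tendsto_const]) (use r in auto)
    then have "(\<lambda>n. \<bar>lam n - l\<bar> powr r * (\<integral>x. \<bar>w x\<bar> powr r \<partial>L)) \<longlonglongrightarrow> 0 * (\<integral>x. \<bar>w x\<bar> powr r \<partial>L)"
      by (intro tendsto_intros)
    then show "(\<lambda>n. \<integral>x. \<bar>lam n * w x - l * w x\<bar> powr r \<partial>L) \<longlonglongrightarrow> 0"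
      by (simp add: left_diff_distrib[symmetric] abs_mult powr_mult)
  qed (use scale_Ws1(1)[OF w] in auto)
  moreover have "(\<lambda>n. \<bar>lam n\<bar> * W w) \<longlonglongrightarrow> \<bar>l\<bar> * W w" using lam(2) by (intro tendsto_intros)
  ultimately show "((\<lambda>l. I (ray l w)) \<circ> lam) \<longlonglongrightarrow> I (ray l w)"
    by (auto simp: o_def I_eq scale_Ws1(2)[OF w] intro: tendsto_diff)
qed

lemma nehari_manifold_iff:
  "v \<in> NM \<longleftrightarrow> v \<in> X \<and> \<not> vanishes v \<and> I v = 0"
  by (simp add: nehari_manifold_def)

text \<open>\<open>A\<close> grows along the ray at least like \<open>l powr \<Theta>\<close> with
  \<open>\<Theta> > 1\<close>, while \<open>W\<close> grows linearly, so \<open>I\<close> changes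
  sign beyond \<open>l = 1\<close> and the intermediate value theorem applies.\<close>

lemma nehari_ray_up:
  assumes w: "w \<in> X" "0 < I w" "\<not> vanishes w"
  obtains l where "1 < l" "(ray l w) \<in> NM"
proof -
  have Apos: "0 < A w" by (rule A_pos[OF w(1,3)])
  \<comment> \<open>The factor at which \<open>M powr (\<Theta> - 1) * A w\<close> reaches
    \<open>W w\<close>, raised to 1 where necessary so that \<open>A_scale_ge\<close>
    applies.\<close>
  define M where "M = max 1 ((W w / A w) powr (1 / (\<Theta> - 1)))"
  have M: "1 \<le> M" by (simp add: M_def)
  have "W w / A w = ((W w / A w) powr (1 / (\<Theta> - 1))) powr (\<Theta> - 1)"
    using \<Theta> Apos W_nonneg[of w] by (simp add: powr_powr)
  also have "\<dots> \<le> M powr (\<Theta> - 1)" using \<Theta> by (intro powr_mono2) (auto simp: M_def)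
  finally have "W w \<le> M powr (\<Theta> - 1) * A w" using Apos by (simp add: field_simps)
  then have "M * W w \<le> M * (M powr (\<Theta> - 1) * A w)" using M by (intro mult_left_mono) auto
  also have "\<dots> = M powr \<Theta> * A w" using M powr_add[of M 1 "\<Theta> - 1"] by simp
  also have "\<dots> \<le> A (ray M w)" by (rule A_scale_ge[OF w(1) M])
  finally have "I (ray M w) \<le> 0" using M by (simp add: I_eq scale_Ws1(2)[OF w(1)])
  moreover have "0 \<le> I (ray 1 w)" using w(2) by simp
  ultimately obtain l where l: "1 \<le> l" "l \<le> M" "I (ray l w) = 0"
    using IVT2'[of "\<lambda>l. I (ray l w)" M 0 1] M continuous_on_subset[OF I_ray_continuous[OF w(1)], of "{1..M}"]
    by auto
  have "l \<noteq> 1" using l(3) w(2) by auto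
  then show thesis
    using that[of l] l scale_Ws1(1)[OF w(1), of l] scale_nonzero[OF w(3), of l] by (auto simp: nehari_manifold_iff)
qed

text \<open>Towards the origin \<open>A\<close> shrinks at least as fast as
  \<open>l powr \<Theta>\<close>, hence faster than \<open>W\<close>, and \<open>I\<close> becomes
  nonnegative before the ray reaches zero.\<close>

lemma nehari_ray_down:
  assumes w: "w \<in> X" "I w < 0"
  obtains l where "0 < l" "l < 1" "(ray l w) \<in> NM"
proof -
  have nz: "\<not> vanishes w" using zero_values(2)[OF w(1)] w(2) by force
  have Apos: "0 < A w" by (rule A_pos[OF w(1) nz])
  have Wpos: "0 < W w" by (rule W_pos[OF w(1) nz])
  define m where "m = min 1 ((W w / A w) powr (1 / (\<Theta> - 1)))"
  have m: "0 < m" "m \<le> 1" using Apos Wpos by (auto simp: m_def)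
  have "m powr (\<Theta> - 1) \<le> ((W w / A w) powr (1 / (\<Theta> - 1))) powr (\<Theta> - 1)"
    using \<Theta> m by (intro powr_mono2) (auto simp: m_def)
  also have "\<dots> = W w / A w"
    using \<Theta> Apos Wpos by (simp add: powr_powr)
  finally have "m powr (\<Theta> - 1) * A w \<le> W w" using Apos by (simp add: field_simps)
  then have "m * (m powr (\<Theta> - 1) * A w) \<le> m * W w" using m by (intro mult_left_mono) auto
  moreover have "m * (m powr (\<Theta> - 1) * A w) = m powr \<Theta> * A w" using m powr_add[of m 1 "\<Theta> - 1"] by simp
  moreover have "A (ray m w) \<le> m powr \<Theta> * A w" by (rule A_scale_le[OF w(1) m])
  ultimately have "0 \<le> I (ray m w)" using m by (simp add: I_eq scale_Ws1(2)[OF w(1)])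
  moreover have "I (ray 1 w) \<le> 0" using w(2) by simp
  ultimately obtain l where l: "m \<le> l" "l \<le> 1" "I (ray l w) = 0"
    using IVT2'[of "\<lambda>l. I (ray l w)" 1 0 m] m continuous_on_subset[OF I_ray_continuous[OF w(1)], of "{m..1}"]
    by auto
  have "l \<noteq> 1" using l(3) w(2) by auto
  then show thesis
    using that[of l] l m scale_Ws1(1)[OF w(1), of l] scale_nonzero[OF nz, of l] by (auto simp: nehari_manifold_iff)
qed

section \<open>Depth of the potential well and energy gaps\<close>

lemma theta_B_le:
  assumes w: "w \<in> X"
  shows "\<theta> * B w \<le> A w"
proof -
  have "\<theta> * B w = (\<integral>x. \<theta> * primitive f x (w x) \<partial>L)" by (simp add: B_def)
  also have "\<dots> \<le> A w"
    unfolding A_def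
    using A_integrable[OF w] B_integrable[OF w] theta_F_le
    by (intro integral_mono) (auto simp: space_L)
  finally show ?thesis .
qed

text \<open>Coercivity of Ambrosetti-Rabinowitz type:
  \<open>\<theta> * B w \<le> A w \<le> W w\<close>.\<close>

lemma E_ge_W:
  assumes w: "w \<in> X" "0 \<le> I w"
  shows "(1 - 1 / \<theta>) * W w \<le> E w"
proof -
  have "\<theta> * B w \<le> W w" using theta_B_le[OF w(1)] w(2) by (simp add: I_eq)
  then show ?thesis using \<theta> by (simp add: E_eq field_simps)
qed

lemma E_nonneg: "w \<in> X \<Longrightarrow> 0 \<le> I w \<Longrightarrow> 0 \<le> E w"
  using E_ge_W[of w] W_nonneg[of w] \<theta>
  by (meson order_trans mult_nonneg_nonneg diff_ge_0_iff_ge divide_le_eq_1_pos less_imp_le zero_less_one order.strict_trans)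

text \<open>The infimum is a lower bound because the energy is bounded below by 0 on the manifold,
  where \<open>I\<close> is zero.\<close>

lemma depth_le: "v \<in> NM \<Longrightarrow> depth \<le> E v"
  unfolding well_depth_def
  by (rule cINF_lower) (auto intro!: bdd_belowI2[of _ 0] E_nonneg simp: nehari_manifold_iff)

text \<open>Here \<open>W w \<le> A w \<le> K * W w powr r\<close>, and dividing by the positive
  number \<open>W w\<close> leaves a lower bound because \<open>r > 1\<close>.\<close>

lemma W_lower_bound:
  obtains c where "0 < c" "\<And>w. w \<in> X \<Longrightarrow> \<not> vanishes w \<Longrightarrow> I w \<le> 0 \<Longrightarrow> c \<le> W w"
proof -
  obtain K where K: "0 < K" "\<And>w. w \<in> X \<Longrightarrow> A w \<le> K * W w powr r" using A_le_W by metis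
  show thesis
  proof (rule that[of "(1 / K) powr (1 / (r - 1))"])
    fix w assume w: "w \<in> X" "\<not> vanishes w" "I w \<le> 0"
    have Wpos: "0 < W w" by (rule W_pos[OF w(1,2)])
    have "W w \<le> K * W w powr r" using K(2)[OF w(1)] w(3) by (simp add: I_eq)
    also have "\<dots> = W w * (K * W w powr (r - 1))" using Wpos powr_add[of "W w" 1 "r - 1"] by simp
    finally have "1 \<le> K * W w powr (r - 1)" using Wpos by simp
    then have "1 / K \<le> W w powr (r - 1)" using K(1) by (simp add: field_simps)
    then have "(1 / K) powr (1 / (r - 1)) \<le> (W w powr (r - 1)) powr (1 / (r - 1))"
      using r K(1) by (intro powr_mono2) auto
    also have "\<dots> = W w" using r Wpos by (simp add: powr_powr)
    finally show "(1 / K) powr (1 / (r - 1)) \<le> W w" .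
  qed (use K(1) in simp)
qed

text \<open>The hypothesis excludes an infimum over the empty set. On the manifold, coercivity and
  the lower bound for \<open>W\<close> combine to a positive bound for the energy.\<close>

lemma depth_pos:
  assumes "NM \<noteq> {}"
  shows "0 < depth"
proof -
  obtain c where c: "0 < c" "\<And>w. w \<in> X \<Longrightarrow> \<not> vanishes w \<Longrightarrow> I w \<le> 0 \<Longrightarrow> c \<le> W w"
    using W_lower_bound by metis
  have "(1 - 1 / \<theta>) * c \<le> E v" if v: "v \<in> NM" for v
  proof -
    have "(1 - 1 / \<theta>) * c \<le> (1 - 1 / \<theta>) * W v"
      using c(2)[of v] v \<theta> by (intro mult_left_mono) (auto simp: nehari_manifold_iff)
    also have "\<dots> \<le> E v" using E_ge_W[of v] v by (auto simp: nehari_manifold_iff)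
    finally show ?thesis .
  qed
  then have "(1 - 1 / \<theta>) * c \<le> depth"
    unfolding well_depth_def by (rule cINF_greatest[OF assms])
  moreover have "0 < (1 - 1 / \<theta>) * c" using c(1) \<theta> by simp
  ultimately show ?thesis by linarith
qed

text \<open>Let \<open>l > 1\<close> carry \<open>w\<close> onto the Nehari manifold. Since
  \<open>B\<close> does not decrease along the ray, \<open>depth \<le> E w + (l - 1) * W w\<close>,
  and the coercive bound on \<open>W w\<close> forces \<open>l \<ge> \<mu>\<close> for some
  \<open>\<mu> > 1\<close> depending on \<open>e\<close> but not on \<open>w\<close>. Membership in
  the manifold and the growth of \<open>A\<close> give
  \<open>A w \<le> l powr (1 - \<Theta>) * W w\<close>, so \<open>\<mu> powr (1 - \<Theta>)\<close>
  serves as \<open>\<delta>\<close>.\<close>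

lemma stable_gap:
  assumes e: "e < depth"
  obtains \<delta> where "0 < \<delta>" "\<delta> < 1"
    "\<And>w. w \<in> X \<Longrightarrow> 0 \<le> I w \<Longrightarrow> E w \<le> e \<Longrightarrow> (1 - \<delta>) * W w \<le> I w"
proof -
  \<comment> \<open>The bound for \<open>W w\<close> from \<open>E_ge_W\<close>: the first factor is
    the inverse of \<open>1 - 1 / \<theta>\<close>, and \<open>\<bar>e\<bar> + 1\<close> keeps
    \<open>M\<close> positive for every \<open>e\<close>.\<close>
  define M where "M = \<theta> / (\<theta> - 1) * (\<bar>e\<bar> + 1)"
  define \<mu> where "\<mu> = 1 + (depth - e) / M"
  have M: "0 < M" using \<theta> by (simp add: M_def)
  have \<mu>: "1 < \<mu>" using e M by (simp add: \<mu>_def)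
  show thesis
  proof (rule that[of "\<mu> powr (1 - \<Theta>)"])
    show "0 < \<mu> powr (1 - \<Theta>)" using \<mu> by simp
    show "\<mu> powr (1 - \<Theta>) < 1" using \<mu> \<Theta> powr_less_mono[of "1 - \<Theta>" 0 \<mu>] by simp
    fix w assume w: "w \<in> X" "0 \<le> I w" "E w \<le> e"
    show "(1 - \<mu> powr (1 - \<Theta>)) * W w \<le> I w"
    proof (cases "vanishes w")
      case True
      then show ?thesis using zero_values[OF w(1)] by simp
    next
      case False
      have "I w \<noteq> 0"
      proof
        assume "I w = 0"
        then have "depth \<le> E w" using w(1) False by (intro depth_le) (simp add: nehari_manifold_iff)
        then show False using w(3) e by simp
      qed
      then have "0 < I w" using w(2) by simp
      from nehari_ray_up[OF w(1) this False] obtain l where l: "1 < l" "(ray l w) \<in> NM" .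
      note lw = scale_Ws1(1)[OF w(1), of l]
      have WM: "W w \<le> M"
      proof -
        have "(1 - 1 / \<theta>) * W w \<le> \<bar>e\<bar> + 1" using E_ge_W[OF w(1,2)] w(3) by linarith
        then have "\<theta> * ((1 - 1 / \<theta>) * W w) \<le> \<theta> * (\<bar>e\<bar> + 1)"
          using \<theta> by (intro mult_left_mono) auto
        moreover have "\<theta> * ((1 - 1 / \<theta>) * W w) = W w * (\<theta> - 1)" using \<theta> by (simp add: field_simps)
        ultimately show ?thesis using \<theta> by (simp add: M_def pos_le_divide_eq)
      qed
      have "B w \<le> B (ray l w)"
        unfolding B_def
        using B_integrable[OF w(1)] B_integrable[OF lw] F_ray_mono l
        by (intro integral_mono) (auto simp: space_L)
      then have "E (ray l w) \<le> E w + (l - 1) * W w"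
        using l by (simp add: E_eq scale_Ws1(2)[OF w(1)] algebra_simps)
      then have "depth - e \<le> (l - 1) * W w" using depth_le[OF l(2)] w(3) by linarith
      also have "\<dots> \<le> (l - 1) * M" using WM l by (intro mult_left_mono) auto
      finally have "\<mu> \<le> l" using M by (simp add: \<mu>_def field_simps)
      have "l powr \<Theta> * A w \<le> l * W w"
        using A_scale_ge[OF w(1), of l] l by (simp add: nehari_manifold_iff I_eq scale_Ws1(2)[OF w(1)])
      moreover have "l powr \<Theta> = l * l powr (\<Theta> - 1)" using l powr_add[of l 1 "\<Theta> - 1"] by simp
      ultimately have "l powr (\<Theta> - 1) * A w \<le> W w" using l by (simp add: mult.assoc)
      then have "l powr (1 - \<Theta>) * (l powr (\<Theta> - 1) * A w) \<le> l powr (1 - \<Theta>) * W w"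
        by (intro mult_left_mono) auto
      then have "A w \<le> l powr (1 - \<Theta>) * W w" using l by (simp add: mult.assoc[symmetric] flip: powr_add)
      also have "\<dots> \<le> \<mu> powr (1 - \<Theta>) * W w"
        using \<open>\<mu> \<le> l\<close> \<mu> \<Theta> W_nonneg[of w] by (intro mult_right_mono powr_mono2') auto
      finally show ?thesis by (simp add: I_eq algebra_simps)
    qed
  qed
qed

text \<open>Descending to the manifold by a factor \<open>l < 1\<close> changes \<open>B\<close> by
  at most \<open>(1 - l) * A w\<close>, so the energy rises by at most
  \<open>(1 - l) * - I w\<close>, while it ends at \<open>depth\<close> or above.\<close>

lemma unstable_gap:
  assumes w: "w \<in> X" "I w < 0"
  shows "depth - E w \<le> - I w"
proof -
  obtain l where l: "0 < l" "l < 1" "(ray l w) \<in> NM"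
    using nehari_ray_down[OF w] .
  note lw = scale_Ws1(1)[OF w(1), of l]
  have "B w - B (ray l w) = (\<integral>x. primitive f x (w x) - primitive f x (l * w x) \<partial>L)"
    unfolding B_def
    using B_integrable[OF w(1)] B_integrable[OF lw] by simp
  also have "\<dots> \<le> (\<integral>x. (1 - l) * (f x (w x) * w x) \<partial>L)"
    using B_integrable[OF w(1)] B_integrable[OF lw]
      A_integrable[OF w(1)] F_ray_diff_le l
    by (intro integral_mono) (auto simp: space_L)
  also have "\<dots> = (1 - l) * A w" by (simp add: A_def)
  finally have "E (ray l w) - E w \<le> (1 - l) * - I w"
    using l by (simp add: E_eq I_eq scale_Ws1(2)[OF w(1)] algebra_simps)
  also have "\<dots> \<le> 1 * - I w" using l w(2) by (intro mult_right_mono) auto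
  finally show ?thesis using depth_le[OF l(3)] by simp
qed

end

section \<open>Regularity in time of the solution\<close>

lemma borel_measurable_AE_limit:
  fixes F :: "'a::euclidean_space \<Rightarrow> real"
  assumes "\<And>k. g k \<in> borel_measurable lebesgue" "AE x in lebesgue. (\<lambda>k::nat. g k x) \<longlonglongrightarrow> F x"
  shows "F \<in> borel_measurable lebesgue"
proof (rule borel_measurable_AE)
  show "(\<lambda>x. lim (\<lambda>k. g k x)) \<in> borel_measurable lebesgue"
    by (rule borel_measurable_lim_metric[OF assms(1)])
  show "AE x in lebesgue. lim (\<lambda>k. g k x) = F x"
    using assms(2) by eventually_elim (rule limI)
qed

text \<open>A functional that is Lipschitz for \<open>nrm\<close> turns the approximating simple
  functions into real simple functions converging almost everywhere.\<close>

lemma strongly_measurable_functional: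
  fixes \<phi> :: "(real^'n \<Rightarrow> real) \<Rightarrow> real"
  assumes v: "strongly_measurable X nrm J v" and J: "J \<in> sets lebesgue"
    and Y: "AE t in lebesgue_on J. v t \<in> Y"
    and \<phi>: "\<And>a b. a \<in> X \<Longrightarrow> b \<in> Y \<Longrightarrow> \<bar>\<phi> a - \<phi> b\<bar> \<le> K * nrm (\<lambda>x. a x - b x)"
  shows "(\<lambda>t. indicator J t * \<phi> (v t)) \<in> borel_measurable lebesgue"
proof -
  obtain S where S: "\<And>k. simple_function (lebesgue_on J) (S k)" "\<And>k. S k ` J \<subseteq> X"
    "AE t in lebesgue_on J. (\<lambda>k::nat. nrm (\<lambda>x. S k t x - v t x)) \<longlonglongrightarrow> 0"
    using v unfolding strongly_measurable_def by blast
  have J': "J \<inter> space lebesgue \<in> sets lebesgue" using J by simp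
  show ?thesis
  proof (rule borel_measurable_AE_limit)
    fix k
    have "(\<lambda>t. \<phi> (S k t)) \<in> borel_measurable (lebesgue_on J)"
      by (rule borel_measurable_simple_function[OF simple_function_compose1[OF S(1)]])
    then show "(\<lambda>t. indicator J t * \<phi> (S k t)) \<in> borel_measurable lebesgue"
      using borel_measurable_restrict_space_iff[OF J', of "\<lambda>t. \<phi> (S k t)"] by simp
  next
    show "AE t in lebesgue. (\<lambda>k. indicator J t * \<phi> (S k t)) \<longlonglongrightarrow> indicator J t * \<phi> (v t)"
      using S(3) Y unfolding AE_restrict_space_iff[OF J']
    proof eventually_elim
      case (elim t)
      show ?case
      proof (cases "t \<in> J")
        case True
        then have lim: "(\<lambda>k. K * nrm (\<lambda>x. S k t x - v t x)) \<longlonglongrightarrow> 0"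
          using elim tendsto_mult_right_zero by blast
        have "norm (\<phi> (S k t) - \<phi> (v t)) \<le> K * nrm (\<lambda>x. S k t x - v t x)" for k
          using \<phi>[of "S k t" "v t"] S(2)[of k] elim True by auto
        then have "(\<lambda>k. \<phi> (S k t) - \<phi> (v t)) \<longlonglongrightarrow> 0"
          by (intro Lim_null_comparison[OF always_eventually lim]) auto
        then have "(\<lambda>k. \<phi> (S k t)) \<longlonglongrightarrow> \<phi> (v t)" by (simp add: LIM_zero_iff)
        then show ?thesis by (intro tendsto_intros)
      qed simp
    qed
  qed
qed

text \<open>The sign condition on \<open>\<eta>\<close> is given in all three variables jointly, but
  it is used at a fixed time. A Borel null set covers the exceptional set, and two exchanges of
  integrals bring \<open>t\<close> to the outside.\<close>

lemma AE_lebesgue_triple: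
  fixes P :: "'a::euclidean_space \<Rightarrow> 'b::euclidean_space \<Rightarrow> 'c::euclidean_space \<Rightarrow> bool"
  assumes "AE (x, y, t) in lebesgue. P x y t"
  shows "AE t in lebesgue. AE (x, y) in lebesgue. P x y t"
proof -
  have "AE z in (lborel :: ('a \<times> 'b \<times> 'c) measure). case z of (x, y, t) \<Rightarrow> P x y t"
    using assms by (simp add: AE_completion_iff)
  then obtain Z where Z: "Z \<in> null_sets (lborel :: ('a \<times> 'b \<times> 'c) measure)"
    "{z. \<not> (case z of (x, y, t) \<Rightarrow> P x y t)} \<subseteq> Z"
    unfolding eventually_ae_filter by auto
  have Zm: "Z \<in> sets (borel \<Otimes>\<^sub>M (borel \<Otimes>\<^sub>M borel))"
    unfolding borel_prod using Z(1) by (simp add: null_sets_def)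
  have ind: "(\<lambda>w. indicator Z (fst w, snd w, t) :: ennreal) \<in> borel_measurable (lborel \<Otimes>\<^sub>M lborel)" for t
    using Zm by measurable
  have "0 = (\<integral>\<^sup>+z. indicator Z z \<partial>(lborel \<Otimes>\<^sub>M (lborel :: ('b \<times> 'c) measure)))"
    using Z(1) by (simp add: lborel_prod null_sets_def)
  also have "\<dots> = (\<integral>\<^sup>+x. \<integral>\<^sup>+w. indicator Z (x, w) \<partial>lborel \<partial>lborel)"
  proof (rule lborel.nn_integral_fst[symmetric])
    show "indicator Z \<in> borel_measurable (lborel \<Otimes>\<^sub>M (lborel :: ('b \<times> 'c) measure))"
      unfolding lborel_prod by (rule borel_measurable_indicator) (use Z(1) in \<open>simp add: null_sets_def\<close>)
  qed
  also have "\<dots> = (\<integral>\<^sup>+x. \<integral>\<^sup>+y. \<integral>\<^sup>+t. indicator Z (x, y, t) \<partial>lborel \<partial>lborel \<partial>lborel)"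
  proof (rule nn_integral_cong)
    fix x
    have "(\<lambda>w. indicator Z (x, w) :: ennreal) \<in> borel_measurable (lborel \<Otimes>\<^sub>M lborel)"
      using Zm by measurable
    from lborel.nn_integral_fst[OF this]
    show "(\<integral>\<^sup>+w. indicator Z (x, w) \<partial>lborel) = (\<integral>\<^sup>+y. \<integral>\<^sup>+t. indicator Z (x, y, t) \<partial>lborel \<partial>lborel)"
      by (simp add: lborel_prod)
  qed
  also have "\<dots> = (\<integral>\<^sup>+x. \<integral>\<^sup>+t. \<integral>\<^sup>+y. indicator Z (x, y, t) \<partial>lborel \<partial>lborel \<partial>lborel)"
  proof (intro nn_integral_cong lborel_pair.Fubini')
    show "(\<lambda>(t, y). indicator Z (x, y, t) :: ennreal) \<in> borel_measurable (lborel \<Otimes>\<^sub>M lborel)" for x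
      unfolding case_prod_beta using Zm by measurable
  qed
  also have "\<dots> = (\<integral>\<^sup>+t. \<integral>\<^sup>+x. \<integral>\<^sup>+y. indicator Z (x, y, t) \<partial>lborel \<partial>lborel \<partial>lborel)"
  proof (rule lborel_pair.Fubini')
    show "(\<lambda>(t, x). \<integral>\<^sup>+y. indicator Z (x, y, t) \<partial>lborel) \<in> borel_measurable (lborel \<Otimes>\<^sub>M lborel)"
      unfolding case_prod_beta using Zm by measurable
  qed
  finally have "(\<integral>\<^sup>+t. \<integral>\<^sup>+x. \<integral>\<^sup>+y. indicator Z (x, y, t) \<partial>lborel \<partial>lborel \<partial>lborel) = 0" by simp
  moreover have "(\<lambda>t. \<integral>\<^sup>+x. \<integral>\<^sup>+y. indicator Z (x, y, t) \<partial>lborel \<partial>lborel) \<in> borel_measurable lborel"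
    using Zm by measurable
  ultimately have "AE t in lborel. (\<integral>\<^sup>+x. \<integral>\<^sup>+y. indicator Z (x, y, t) \<partial>lborel \<partial>lborel) = 0"
    by (subst (asm) nn_integral_0_iff_AE) auto
  then have "AE t in lborel. AE (x, y) in lborel. P x y t"
  proof eventually_elim
    case (elim t)
    have "(\<integral>\<^sup>+w. indicator Z (fst w, snd w, t) \<partial>(lborel \<Otimes>\<^sub>M lborel)) = (\<integral>\<^sup>+x. \<integral>\<^sup>+y. indicator Z (x, y, t) \<partial>lborel \<partial>lborel)"
      by (subst lborel.nn_integral_fst[symmetric]) (use ind in simp_all)
    then have "(\<integral>\<^sup>+w. indicator Z (fst w, snd w, t) \<partial>lborel) = 0" using elim by (simp add: lborel_prod)
    then have "AE w in lborel. (indicator Z (fst w, snd w, t) :: ennreal) = 0"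
      using ind[of t] by (subst (asm) nn_integral_0_iff_AE) (simp_all add: lborel_prod)
    then show ?case
    proof eventually_elim
      case (elim w)
      then have "(fst w, snd w, t) \<notin> Z" by (simp add: indicator_def split: if_splits)
      then have "(fst w, snd w, t) \<notin> {z. \<not> (case z of (x, y, t) \<Rightarrow> P x y t)}" using Z(2) by blast
      then show ?case by (simp add: case_prod_beta)
    qed
  qed
  then show ?thesis by (simp add: AE_completion_iff)
qed

lemma continuous_on_atLeast_local:
  fixes g :: "real \<Rightarrow> real"
  assumes "\<And>T. continuous_on {a..T} g"
  shows "continuous_on {a..} g"
  unfolding continuous_on_eq_continuous_within
proof
  fix t assume t: "t \<in> {a..}"
  have "at t within {a..} = at t within {a..t + 1}"
    by (rule at_within_nhd[of t "{..<t + 1}"]) auto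
  moreover have "continuous (at t within {a..t + 1}) g"
    using assms[of "t + 1"] t by (auto simp: continuous_on_eq_continuous_within)
  ultimately show "continuous (at t within {a..}) g" by simp
qed

locale evolution = nehari_setting s \<Omega> f r C \<theta> \<Theta>
  for s :: real and \<Omega> :: "(real^'n) set" and f and r C \<theta> \<Theta> :: real +
  fixes u0 :: "real^'n \<Rightarrow> real" and u v :: "real \<Rightarrow> real^'n \<Rightarrow> real"
  assumes r_subcritical: "r < 1 + real CARD('n) / (2 * (real CARD('n) - s))"
    and weak: "weak_solution_with s \<Omega> f \<infinity> u0 u v"
    and u_Ws1: "\<And>t. 0 \<le> t \<Longrightarrow> u t \<in> X"
    and energy_identity: "\<And>t. 0 \<le> t \<Longrightarrow>
      (\<integral>\<tau>. (Lp_norm 2 \<Omega> (v \<tau>))\<^sup>2 \<partial>lebesgue_on {0..t}) + E (u t) = E (u 0)"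
begin

abbreviation "H \<equiv> Lp 2 \<Omega>"
abbreviation "norm2 \<equiv> Lp_norm 2 \<Omega>"

definition ip :: "(real^'n \<Rightarrow> real) \<Rightarrow> (real^'n \<Rightarrow> real) \<Rightarrow> real" where
  "ip a b = (\<integral>x. a x * b x \<partial>L)"
definition "q \<tau> = (norm2 (v \<tau>))\<^sup>2"

section \<open>Continuity along the trajectory\<close>

lemma time_intervals: "open_time \<infinity> = {0<..}" "closed_time \<infinity> = {0..}"
  by (auto simp: open_time_def closed_time_def)

lemma norm2_nonneg: "0 \<le> norm2 w" by (rule Lp_norm_nonneg)

lemma ip_le: "a \<in> H \<Longrightarrow> b \<in> H \<Longrightarrow> \<bar>ip a b\<bar> \<le> norm2 a * norm2 b"
  unfolding ip_def by (rule Lp2_Cauchy_Schwarz)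

lemma ip_diff_left:
  "a \<in> H \<Longrightarrow> b \<in> H \<Longrightarrow> g \<in> H \<Longrightarrow> ip (\<lambda>x. a x - b x) g = ip a g - ip b g"
  unfolding ip_def by (simp add: left_diff_distrib Lp2_mult_integrable)

lemma ip_diff_right:
  "a \<in> H \<Longrightarrow> b \<in> H \<Longrightarrow> g \<in> H \<Longrightarrow> ip g (\<lambda>x. a x - b x) = ip g a - ip g b"
  unfolding ip_def by (simp add: right_diff_distrib Lp2_mult_integrable)

lemma ip_add_right:
  "a \<in> H \<Longrightarrow> b \<in> H \<Longrightarrow> g \<in> H \<Longrightarrow> ip g (\<lambda>x. a x + b x) = ip g a + ip g b"
  unfolding ip_def by (simp add: distrib_left Lp2_mult_integrable)

lemma ip_self: "ip a a = (norm2 a)\<^sup>2"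
  by (simp add: ip_def Lp2_norm_sq flip: power2_eq_square)

lemma ip_commute: "ip a b = ip b a"
  unfolding ip_def by (rule Bochner_Integration.integral_cong) (simp_all add: mult.commute)

lemma u_Lp2: "0 \<le> t \<Longrightarrow> u t \<in> H"
  by (rule Ws1_Lp2[OF u_Ws1])

lemma u_continuous_seq:
  assumes \<kappa>: "1 \<le> \<kappa>" "\<kappa> < real CARD('n) / (real CARD('n) - s)"
    and \<tau>: "\<And>n. 0 \<le> \<tau> n" "\<tau> \<longlonglongrightarrow> t" and t: "0 \<le> t"
  shows "(\<lambda>n. \<integral>x. \<bar>u (\<tau> n) x - u t x\<bar> powr \<kappa> \<partial>L) \<longlonglongrightarrow> 0"
proof -
  let ?\<phi> = "\<lambda>y. Lp_norm \<kappa> \<Omega> (\<lambda>x. u y x - u t x)"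
  have "continuous_in_Lp \<kappa> \<Omega> {0..} u"
    using weak \<kappa> unfolding weak_solution_with_def time_intervals by blast
  then have "(?\<phi> \<longlongrightarrow> 0) (at t within {0..})" using t by (simp add: continuous_in_Lp_def)
  moreover have \<phi>t: "?\<phi> t = 0" by (simp add: Lp_norm_def)
  ultimately have "continuous (at t within {0..}) ?\<phi>" by (simp add: continuous_within)
  then have "(?\<phi> \<circ> \<tau>) \<longlonglongrightarrow> ?\<phi> t" unfolding continuous_within_sequentially using \<tau> by auto
  then have "(\<lambda>n. ?\<phi> (\<tau> n) powr \<kappa>) \<longlonglongrightarrow> 0"
    using \<phi>t by (intro tendsto_zero_powrI[OF _ tendsto_const]) (use \<kappa> in \<open>auto simp: o_def Lp_norm_nonneg\<close>)
  moreover have "?\<phi> y powr \<kappa> = (\<integral>x. \<bar>u y x - u t x\<bar> powr \<kappa> \<partial>L)" for y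
    using \<kappa> by (simp add: Lp_norm_def powr_powr)
  ultimately show ?thesis by simp
qed

lemma admissible_continuous:
  assumes "admissible h"
  shows "continuous_on {0..} (\<lambda>t. \<integral>x. h x (u t x) \<partial>L)"
  unfolding continuous_on_sequentially
proof (intro allI ballI impI, elim conjE)
  fix \<tau> :: "nat \<Rightarrow> real" and t assume t: "t \<in> {0..}" "\<forall>n. \<tau> n \<in> {0..}" "\<tau> \<longlonglongrightarrow> t"
  have "(\<lambda>n. \<integral>x. h x (u (\<tau> n) x) \<partial>L) \<longlonglongrightarrow> (\<integral>x. h x (u t x) \<partial>L)"
    by (rule admissible_tendsto[OF assms _ _ u_continuous_seq]) (use t r u_Ws1 in auto)
  then show "((\<lambda>t. \<integral>x. h x (u t x) \<partial>L) \<circ> \<tau>) \<longlonglongrightarrow> (\<integral>x. h x (u t x) \<partial>L)" by (simp add: o_def)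
qed

lemma A_continuous: "continuous_on {0..} (\<lambda>t. A (u t))"
  unfolding A_def by (rule admissible_continuous[OF admissible_ft])

lemma B_continuous: "continuous_on {0..} (\<lambda>t. B (u t))"
  unfolding B_def by (rule admissible_continuous[OF admissible_F])

lemma v_bochner: "bochner_L2 (H) norm2 {0<..} v"
  using weak unfolding weak_solution_with_def time_intervals by blast

lemma v_Lp2: "AE \<tau> in lebesgue. 0 < \<tau> \<longrightarrow> v \<tau> \<in> H"
  using v_bochner unfolding bochner_L2_def by (auto simp: AE_restrict_space_iff)

lemma AE_lebesgue_neq: "AE x in lebesgue. x \<noteq> (c::real)"
  using AE_lborel_singleton[of c] by (simp add: AE_completion_iff)

lemma q_integrable: "set_integrable lebesgue {0..} q"
proof -
  have "integrable (lebesgue_on {0<..}) q"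
    using v_bochner unfolding bochner_L2_def q_def by blast
  then have i: "integrable lebesgue (\<lambda>t. indicator {0<..} t *\<^sub>R q t)"
    by (subst (asm) integrable_restrict_space) auto
  \<comment> \<open>Integrability is given on the open half line and used on the closed one; time 0
    is a null set.\<close>
  have ae: "AE t in lebesgue. indicator {0<..} t *\<^sub>R q t = indicator {0..} t *\<^sub>R q t"
    using AE_lebesgue_neq[of 0] by eventually_elim (auto simp: indicator_def)
  have m: "(\<lambda>t. indicator {0..} t *\<^sub>R q t) \<in> borel_measurable lebesgue"
    by (rule borel_measurable_AE[OF _ ae]) (use i in simp)
  show ?thesis
    unfolding set_integrable_def using integrable_cong_AE[OF _ m ae] i by simp
qed

lemma q_integrable_subset: "S \<subseteq> {0..} \<Longrightarrow> S \<in> sets lebesgue \<Longrightarrow> set_integrable lebesgue S q"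
  by (rule set_integrable_subset[OF q_integrable])

lemma q_integrable_on: "0 \<le> a \<Longrightarrow> q integrable_on {a..b}"
  by (rule set_lebesgue_integral_eq_integral(1)[OF q_integrable_subset]) auto

lemma q_nonneg: "0 \<le> q \<tau>" by (simp add: q_def)

lemma E_eq_integral: "0 \<le> t \<Longrightarrow> E (u t) = E (u 0) - integral {0..t} q"
proof -
  assume t: "0 \<le> t"
  have "(\<integral>\<tau>. q \<tau> \<partial>lebesgue_on {0..t}) = (LINT \<tau>:{0..t}|lebesgue. q \<tau>)"
    unfolding set_lebesgue_integral_def by (rule integral_restrict_space) simp
  also have "\<dots> = integral {0..t} q"
    by (rule set_lebesgue_integral_eq_integral(2)[OF q_integrable_subset]) auto
  finally show ?thesis using energy_identity[OF t] by (simp add: q_def)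
qed

lemma E_diff: "0 \<le> a \<Longrightarrow> a \<le> b \<Longrightarrow> E (u a) - E (u b) = integral {a..b} q"
  using E_eq_integral[of a] E_eq_integral[of b] Henstock_Kurzweil_Integration.integral_combine[of 0 a b q]
    q_integrable_on[of 0 b] by simp

lemma E_antimono: "0 \<le> a \<Longrightarrow> a \<le> b \<Longrightarrow> E (u b) \<le> E (u a)"
  using E_diff[of a b] integral_nonneg[OF q_integrable_on[of a b]] q_nonneg by simp

lemma E_continuous: "continuous_on {0..} (\<lambda>t. E (u t))"
proof (rule continuous_on_atLeast_local)
  fix T
  have "continuous_on {0..T} (\<lambda>t. E (u 0) - integral {0..t} q)"
    by (rule continuous_on_diff[OF continuous_on_const indefinite_integral_continuous_1[OF q_integrable_on]]) simp
  then show "continuous_on {0..T} (\<lambda>t. E (u t))"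
    by (rule continuous_on_eq) (rule E_eq_integral[symmetric], simp)
qed

lemma W_continuous: "continuous_on {0..} (\<lambda>t. W (u t))"
proof -
  have "continuous_on {0..} (\<lambda>t. E (u t) + B (u t))"
    by (rule continuous_on_add[OF E_continuous B_continuous])
  then show ?thesis by (simp add: E_eq)
qed

lemma I_continuous: "continuous_on {0..} (\<lambda>t. I (u t))"
  unfolding I_eq by (rule continuous_on_diff[OF W_continuous A_continuous])

text \<open>The solution is continuous in \<open>L\<^sup>\<kappa>\<close> only below the critical
  exponent, which equals 2 when \<open>N = 2s\<close>. Therefore \<open>g\<close> is truncated at
  height \<open>k\<close>: the bounded part is paired with convergence in \<open>L\<^sup>1\<close>,
  and the remainder is small in \<open>L\<^sup>2\<close> against a bound for
  \<open>norm2 (u y)\<close> on compact times, which \<open>W_continuous\<close> and the Sobolev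
  inequality provide.\<close>

lemma ip_u_continuous:
  assumes g: "g \<in> H"
  shows "continuous_on {0..} (\<lambda>t. ip (u t) g)"
  unfolding continuous_on_sequentially
proof (intro allI ballI impI, elim conjE)
  fix \<tau> :: "nat \<Rightarrow> real" and t assume t: "t \<in> {0..}" and \<tau>: "\<forall>n. \<tau> n \<in> {0..}" "\<tau> \<longlonglongrightarrow> t"
  obtain S where S: "0 < S" "\<And>w. w \<in> X \<Longrightarrow> S * norm2 w \<le> W w" by (rule Sobolev_L2) (rule that)
  obtain T where T: "\<And>n. \<bar>\<tau> n\<bar> \<le> T" using convergent_imp_Bseq[of \<tau>] \<tau>(2) by (auto simp: convergent_def Bseq_def)
  have tT: "t \<le> T" by (rule LIMSEQ_le_const2[OF \<tau>(2)]) (use T abs_le_D1 in blast)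
  have "compact ((\<lambda>t. W (u t)) ` {0..T})"
    by (intro compact_continuous_image continuous_on_subset[OF W_continuous]) auto
  then obtain M0 where M0: "\<And>y. y \<in> {0..T} \<Longrightarrow> \<bar>W (u y)\<bar> \<le> M0"
    using compact_imp_bounded[of "(\<lambda>t. W (u t)) ` {0..T}"] unfolding bounded_iff by fastforce
  define M where "M = M0 / S"
  have M: "norm2 (u y) \<le> M" if "y \<in> {0..T}" for y
  proof -
    have "S * norm2 (u y) \<le> M0" using S(2)[OF u_Ws1, of y] M0[OF that] that by auto
    then show ?thesis using S(1) by (simp add: M_def field_simps)
  qed
  have in_T: "\<tau> n \<in> {0..T}" for n using T[of n] \<tau>(1) by (simp add: abs_le_iff)
  define gk where "gk k x = max (- real k) (min (real k) (g x))" for k x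
  have gm[measurable]: "g \<in> borel_measurable L" and g2: "integrable L (\<lambda>x. (g x)\<^sup>2)" using g by (auto simp: Lp2_iff)
  have gk_le: "\<bar>gk k x\<bar> \<le> real k" "\<bar>gk k x\<bar> \<le> \<bar>g x\<bar>" "\<bar>g x - gk k x\<bar> \<le> \<bar>g x\<bar>" for k x
    by (auto simp: gk_def)
  have gkm[measurable]: "gk k \<in> borel_measurable L" for k unfolding gk_def by measurable
  have gk2: "gk k \<in> H" for k
    unfolding Lp2_iff
    by (intro conjI gkm Bochner_Integration.integrable_bound[OF g2])
       (use gk_le(2) in \<open>auto intro!: AE_I2 simp: abs_le_square_iff\<close>)
  have dk2: "(\<lambda>x. g x - gk k x) \<in> H" for k by (rule Lp2_diff[OF g gk2])
  have "(\<lambda>k. \<integral>x. (g x - gk k x)\<^sup>2 \<partial>L) \<longlonglongrightarrow> (\<integral>x. 0 \<partial>L)"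
  proof (rule integral_dominated_convergence[where w = "\<lambda>x. (g x)\<^sup>2"])
    show "AE x in L. (\<lambda>k. (g x - gk k x)\<^sup>2) \<longlonglongrightarrow> 0"
    proof (rule AE_I2)
      fix x
      have "\<forall>\<^sub>F k in sequentially. \<bar>g x\<bar> \<le> real k"
        using filterlim_real_sequentially unfolding filterlim_at_top by blast
      then have "\<forall>\<^sub>F k in sequentially. 0 = (g x - gk k x)\<^sup>2"
        by eventually_elim (auto simp: gk_def)
      then show "(\<lambda>k. (g x - gk k x)\<^sup>2) \<longlonglongrightarrow> 0" by (rule Lim_transform_eventually[OF tendsto_const])
    qed
    show "AE x in L. norm ((g x - gk k x)\<^sup>2) \<le> (g x)\<^sup>2" for k
      using gk_le(3) by (intro AE_I2) (simp add: abs_le_square_iff)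
  qed (use g2 in simp_all)
  then have "(\<lambda>k. norm2 (\<lambda>x. g x - gk k x)) \<longlonglongrightarrow> 0"
    unfolding Lp2_norm using tendsto_real_sqrt by fastforce
  then have lim: "(\<lambda>k. 2 * M * norm2 (\<lambda>x. g x - gk k x)) \<longlonglongrightarrow> 0"
    by (rule tendsto_mult_right_zero)
  have "(\<lambda>n. ip (u (\<tau> n)) g) \<longlonglongrightarrow> ip (u t) g"
    unfolding LIMSEQ_iff
  proof (intro allI impI)
    fix e :: real assume e: "0 < e"
    then have "\<forall>\<^sub>F k in sequentially. 2 * M * norm2 (\<lambda>x. g x - gk k x) < e / 2"
      using order_tendstoD(2)[OF lim, of "e / 2"] by simp
    then obtain k where k: "2 * M * norm2 (\<lambda>x. g x - gk k x) < e / 2"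
      by (auto simp: eventually_sequentially)
    have l1: "(\<lambda>n. \<integral>x. \<bar>u (\<tau> n) x - u t x\<bar> \<partial>L) \<longlonglongrightarrow> 0"
      using u_continuous_seq[of 1 \<tau> t] one_less_critical \<tau> t by simp
    then have "(\<lambda>n. real k * (\<integral>x. \<bar>u (\<tau> n) x - u t x\<bar> \<partial>L)) \<longlonglongrightarrow> 0"
      by (rule tendsto_mult_right_zero)
    then have "\<forall>\<^sub>F n in sequentially. real k * (\<integral>x. \<bar>u (\<tau> n) x - u t x\<bar> \<partial>L) < e / 2"
      using e order_tendstoD(2)[of _ 0 sequentially "e / 2"] by simp
    then obtain n0 where n0: "\<And>n. n0 \<le> n \<Longrightarrow> real k * (\<integral>x. \<bar>u (\<tau> n) x - u t x\<bar> \<partial>L) < e / 2"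
      by (auto simp: eventually_sequentially)
    have "norm (ip (u (\<tau> n)) g - ip (u t) g) < e" if n: "n0 \<le> n" for n
    proof -
      let ?d = "\<lambda>x. u (\<tau> n) x - u t x"
      have un: "u (\<tau> n) \<in> H" "u t \<in> H" using u_Lp2 in_T[of n] t by auto
      have dd: "?d \<in> H" by (rule Lp2_diff[OF un])
      have i1: "integrable L (\<lambda>x. \<bar>?d x\<bar>)"
        using Ws1_integrable_powr[OF u_Ws1, of "\<tau> n" 1] Ws1_integrable_powr[OF u_Ws1, of t 1]
          one_less_critical \<tau>(1) t Ws1_measurable[OF u_Ws1, of "\<tau> n"] Ws1_measurable[OF u_Ws1, of t]
        by (auto simp: integrable_abs_iff)
      have "ip (u (\<tau> n)) g - ip (u t) g
          = (ip (u (\<tau> n)) (\<lambda>x. g x - gk k x) - ip (u t) (\<lambda>x. g x - gk k x)) + ip ?d (gk k)"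
        using ip_diff_right[OF g gk2 un(1), of k] ip_diff_right[OF g gk2 un(2), of k] ip_diff_left[OF un gk2, of k] by simp
      moreover have "\<bar>ip (u (\<tau> n)) (\<lambda>x. g x - gk k x)\<bar> \<le> M * norm2 (\<lambda>x. g x - gk k x)"
        using ip_le[OF un(1) dk2, of k] mult_right_mono[OF M[OF in_T[of n]] norm2_nonneg[of "\<lambda>x. g x - gk k x"]] by linarith
      moreover have "\<bar>ip (u t) (\<lambda>x. g x - gk k x)\<bar> \<le> M * norm2 (\<lambda>x. g x - gk k x)"
        using ip_le[OF un(2) dk2, of k] mult_right_mono[OF M[of t] norm2_nonneg[of "\<lambda>x. g x - gk k x"]] t tT by simp
      moreover have "\<bar>ip ?d (gk k)\<bar> \<le> real k * (\<integral>x. \<bar>?d x\<bar> \<partial>L)"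
      proof -
        have "\<bar>ip ?d (gk k)\<bar> \<le> (\<integral>x. \<bar>?d x * gk k x\<bar> \<partial>L)" unfolding ip_def by (rule integral_abs_bound)
        also have "\<dots> \<le> (\<integral>x. real k * \<bar>?d x\<bar> \<partial>L)"
        proof (rule integral_mono)
          show "integrable L (\<lambda>x. \<bar>?d x * gk k x\<bar>)" by (rule integrable_abs[OF Lp2_mult_integrable[OF dd gk2]])
          show "\<bar>?d x * gk k x\<bar> \<le> real k * \<bar>?d x\<bar>" for x
            using mult_right_mono[OF gk_le(1)[of k x] abs_ge_zero[of "?d x"]] by (simp add: abs_mult mult.commute)
        qed (use i1 in simp)
        finally show ?thesis by simp
      qed
      ultimately show ?thesis using k n0[OF n] by simp
    qed
    then show "\<exists>n0. \<forall>n\<ge>n0. norm (ip (u (\<tau> n)) g - ip (u t) g) < e" by blast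
  qed
  then show "((\<lambda>t. ip (u t) g) \<circ> \<tau>) \<longlonglongrightarrow> ip (u t) g" by (simp add: o_def)
qed

lemma ip_v_integrable:
  assumes g: "g \<in> H"
  shows "set_integrable lebesgue {0..T} (\<lambda>\<tau>. ip (v \<tau>) g)"
proof -
  have "(\<lambda>\<tau>. indicator {0<..} \<tau> * ip (v \<tau>) g) \<in> borel_measurable lebesgue"
  proof (rule strongly_measurable_functional[where X = "H" and Y = "H" and nrm = norm2
        and K = "norm2 g" and \<phi> = "\<lambda>a. ip a g"])
    show "strongly_measurable (H) norm2 {0<..} v" "AE \<tau> in lebesgue_on {0<..}. v \<tau> \<in> H"
      using v_bochner by (auto simp: bochner_L2_def)
    show "\<bar>ip a g - ip b g\<bar> \<le> norm2 g * norm2 (\<lambda>x. a x - b x)" if "a \<in> H" "b \<in> H" for a b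
      using ip_diff_left[OF that g] ip_le[OF Lp2_diff[OF that] g] by (simp add: mult.commute)
  qed simp
  then have "(\<lambda>\<tau>. indicator {0..T} \<tau> * (indicator {0<..} \<tau> * ip (v \<tau>) g)) \<in> borel_measurable lebesgue"
    by (rule borel_measurable_times[OF borel_measurable_indicator, rotated]) simp
  moreover have "AE \<tau> in lebesgue. indicator {0..T} \<tau> * (indicator {0<..} \<tau> * ip (v \<tau>) g) = indicator {0..T} \<tau> *\<^sub>R ip (v \<tau>) g"
    using AE_lebesgue_neq[of 0] by eventually_elim (auto simp: indicator_def)
  ultimately have m: "(\<lambda>\<tau>. indicator {0..T} \<tau> *\<^sub>R ip (v \<tau>) g) \<in> borel_measurable lebesgue"
    by (rule borel_measurable_AE)
  have "integrable lebesgue (\<lambda>\<tau>. indicator {0..T} \<tau> *\<^sub>R q \<tau> + (norm2 g)\<^sup>2 * indicator {0..T} \<tau>)"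
    using q_integrable_subset[of "{0..T}"]
    by (intro Bochner_Integration.integrable_add integrable_mult_right integrable_real_indicator)
      (auto simp: set_integrable_def emeasure_lborel_Icc_eq)
  then show ?thesis
    unfolding set_integrable_def
  proof (rule Bochner_Integration.integrable_bound[OF _ m])
    show "AE \<tau> in lebesgue. norm (indicator {0..T} \<tau> *\<^sub>R ip (v \<tau>) g)
       \<le> norm (indicator {0..T} \<tau> *\<^sub>R q \<tau> + (norm2 g)\<^sup>2 * indicator {0..T} \<tau>)"
      using v_Lp2 AE_lebesgue_neq[of 0]
    proof eventually_elim
      case (elim \<tau>)
      show ?case
      proof (cases "\<tau> \<in> {0..T}")
        case True
        then have "\<bar>ip (v \<tau>) g\<bar> \<le> norm2 (v \<tau>) * norm2 g" using elim by (intro ip_le g) auto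
        also have "\<dots> \<le> (norm2 (v \<tau>))\<^sup>2 + (norm2 g)\<^sup>2"
          using zero_le_power2[of "norm2 (v \<tau>) - norm2 g"] zero_le_power2[of "norm2 (v \<tau>)"] zero_le_power2[of "norm2 g"]
          unfolding power2_diff by linarith
        finally show ?thesis using True by (simp add: q_def)
      qed simp
    qed
  qed
qed

text \<open>The weak time derivative is stated through inner products with fixed functions, so each
  \<open>g\<close> reduces to the scalar result on the half line.\<close>

lemma ip_increment:
  assumes g: "g \<in> H" and ab: "0 < a" "a < b"
  shows "ip (u b) g - ip (u a) g = (LINT \<tau>:{a..b}|lebesgue. ip (v \<tau>) g)"
proof (rule weak_derivative_imp_increment[OF ip_u_continuous[OF g] ip_v_integrable[OF g] _ ab])
  fix \<psi> assume "test_function {0<..} \<psi>"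
  moreover have "weak_time_derivative \<Omega> {0<..} u v"
    using weak unfolding weak_solution_with_def time_intervals by blast
  ultimately show "(\<integral>t. deriv \<psi> t * ip (u t) g \<partial>lebesgue_on {0<..}) = - (\<integral>t. \<psi> t * ip (v t) g \<partial>lebesgue_on {0<..})"
    using g unfolding weak_time_derivative_def ip_def by blast
qed

end

section \<open>The evolution of the squared norm\<close>

context nehari_setting
begin

text \<open>The restriction to \<open>Qset \<Omega>\<close> is built in, so that \<open>dq\<close>
  is linear in \<open>w\<close>, integrals run over the whole product space, and \<open>W\<close> is
  an \<open>L\<^sup>1\<close> norm.\<close>

definition dq :: "(real^'n \<Rightarrow> real) \<Rightarrow> (real^'n) \<times> (real^'n) \<Rightarrow> real" where
  "dq w z = indicator (Qset \<Omega>) z * ((w (fst z) - w (snd z)) / kernel s (fst z) (snd z))"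

lemma abs_dq: "\<bar>dq w z\<bar> = indicator (Qset \<Omega>) z * (\<bar>w (fst z) - w (snd z)\<bar> / kernel s (fst z) (snd z))"
  by (simp add: dq_def abs_mult kernel_nonneg)

lemma dq_diff: "dq (\<lambda>x. a x - b x) z = dq a z - dq b z"
  by (simp add: dq_def diff_divide_distrib right_diff_distrib)

lemma W_dq: "W w = (\<integral>z. \<bar>dq w z\<bar> \<partial>lebesgue)"
  by (simp add: Ws1_norm_def set_lebesgue_integral_def case_prod_beta abs_dq)

lemma Qset_borel: "Qset \<Omega> \<in> sets borel"
  unfolding Qset_def using domain(1) by (intro borel_open open_Diff closed_Times) (auto simp: closed_def Compl_eq_Diff_UNIV[symmetric])

lemma dq_measurable:
  assumes "w \<in> X"
  shows "(\<lambda>z. dq w z) \<in> borel_measurable lebesgue"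
proof -
  have "(\<lambda>x. indicator \<Omega> x * w x) \<in> borel_measurable lebesgue"
    using borel_measurable_restrict_space_iff[OF \<Omega>_sets, of w] Ws1_measurable[OF assms] by simp
  then obtain w' where w': "w' \<in> borel_measurable borel" "AE x in lborel. indicator \<Omega> x * w x = w' x"
    using completion_ex_borel_measurable_real by fastforce
  have "AE x in lebesgue. w x = w' x"
    using w'(2) Ws1_zero_outside[OF assms] unfolding AE_completion_iff
    by eventually_elim (auto simp: indicator_def split: if_splits)
  from AE_pair_lebesgue[OF this]
  have ae: "AE z in lebesgue. dq w' z = dq w z"
    by eventually_elim (simp add: dq_def)
  have "fst \<in> (borel :: ((real^'n) \<times> (real^'n)) measure) \<rightarrow>\<^sub>M borel"
    "snd \<in> (borel :: ((real^'n) \<times> (real^'n)) measure) \<rightarrow>\<^sub>M borel"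
    by (simp_all add: measurable_fst' borel_prod[symmetric])
  from this[THEN measurable_compose, OF w'(1)]
  have "(\<lambda>z. dq w' z) \<in> borel_measurable borel"
    unfolding dq_def using Qset_borel by (intro borel_measurable_times borel_measurable_divide borel_measurable_diff
        borel_measurable_kernel borel_measurable_indicator)
  then show ?thesis using ae by (intro borel_measurable_AE[OF measurable_completion]) auto
qed

lemma dq_integrable:
  assumes "w \<in> X"
  shows "integrable lebesgue (\<lambda>z. dq w z)"
proof (rule integrable_abs_cancel)
  show "integrable lebesgue (\<lambda>z. \<bar>dq w z\<bar>)"
    using assms by (simp add: Ws1_def set_integrable_def case_prod_beta abs_dq)
qed (rule dq_measurable[OF assms])

lemma Ws1_diff:
  assumes a: "a \<in> X" and b: "b \<in> X"
  shows "(\<lambda>x. a x - b x) \<in> X"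
proof -
  have "integrable L (\<lambda>x. a x - b x)"
    using a b by (auto simp: Ws1_def Lp_def integrable_abs_iff)
  moreover have "integrable lebesgue (\<lambda>z. dq (\<lambda>x. a x - b x) z)"
    using Bochner_Integration.integrable_diff[OF dq_integrable[OF a] dq_integrable[OF b]]
    by (simp add: dq_diff)
  then have "integrable lebesgue (\<lambda>z. \<bar>dq (\<lambda>x. a x - b x) z\<bar>)"
    by (rule integrable_abs)
  moreover have "AE x in lebesgue. x \<notin> \<Omega> \<longrightarrow> a x - b x = 0"
    using Ws1_zero_outside[OF a] Ws1_zero_outside[OF b] by eventually_elim auto
  ultimately show ?thesis
    using a b by (auto simp: Ws1_def Lp_def set_integrable_def case_prod_beta abs_dq)
qed

lemma dq_pairing_le:
  fixes \<eta> :: "(real^'n) \<times> (real^'n) \<Rightarrow> real"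
  assumes \<eta>: "\<eta> \<in> borel_measurable lebesgue" "AE z in lebesgue. \<bar>\<eta> z\<bar> \<le> 1" and w: "w \<in> X"
  shows "integrable lebesgue (\<lambda>z. \<eta> z * dq w z)"
    and "\<bar>\<integral>z. \<eta> z * dq w z \<partial>lebesgue\<bar> \<le> W w"
proof -
  have le: "AE z in lebesgue. \<bar>\<eta> z * dq w z\<bar> \<le> \<bar>dq w z\<bar>"
    using \<eta>(2)
  proof eventually_elim
    case (elim z)
    then show ?case using mult_right_mono[OF elim abs_ge_zero[of "dq w z"]] by (simp add: abs_mult)
  qed
  have i: "integrable lebesgue (\<lambda>z. \<bar>dq w z\<bar>)" by (rule integrable_abs[OF dq_integrable[OF w]])
  have m: "(\<lambda>z. \<eta> z * dq w z) \<in> borel_measurable lebesgue"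
    using \<eta>(1) dq_measurable[OF w] by (rule borel_measurable_times)
  show int: "integrable lebesgue (\<lambda>z. \<eta> z * dq w z)"
    by (rule Bochner_Integration.integrable_bound[OF i m]) (use le in \<open>eventually_elim, auto\<close>)
  have "\<bar>\<integral>z. \<eta> z * dq w z \<partial>lebesgue\<bar>
      \<le> (\<integral>z. \<bar>\<eta> z * dq w z\<bar> \<partial>lebesgue)"
    by (rule integral_abs_bound)
  also have "\<dots> \<le> W w"
    unfolding W_dq by (rule integral_mono_AE[OF integrable_abs[OF int] i le])
  finally show "\<bar>\<integral>z. \<eta> z * dq w z \<partial>lebesgue\<bar> \<le> W w" .
qed

text \<open>The bound on \<open>r\<close> says that \<open>2 * (r - 1)\<close> stays below the
  critical exponent, so the growth condition makes the square of \<open>f x (w x)\<close>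
  integrable.\<close>

lemma f_in_Lp2:
  assumes w: "w \<in> X" and sub: "r < 1 + real CARD('n) / (2 * (real CARD('n) - s))"
  shows "(\<lambda>x. f x (w x)) \<in> Lp 2 \<Omega>"
proof -
  let ?p = "real CARD('n) / (real CARD('n) - s)"
  have m: "(\<lambda>x. f x (w x)) \<in> borel_measurable L"
    by (rule measurable_Caratheodory[OF f_meas _ Ws1_measurable[OF w]]) (simp add: space_L f_cont)
  have p: "2 * (r - 1) \<le> ?p" using sub s_less_N by (simp add: field_simps)
  have one: "integrable L (\<lambda>x. 1 :: real)"
    unfolding integrable_restrict_space[OF \<Omega>_sets]
    using lmeasurable_open[OF domain(2,1)] by (auto intro!: integrable_real_indicator simp: fmeasurable_def)
  have "integrable L (\<lambda>x. C\<^sup>2 * (1 + \<bar>w x\<bar> powr ?p))"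
    using Ws1_integrable_powr[OF w less_imp_le[OF one_less_critical] order_refl] one by simp
  moreover have "norm ((f x (w x))\<^sup>2) \<le> norm (C\<^sup>2 * (1 + \<bar>w x\<bar> powr ?p))" if "x \<in> \<Omega>" for x
  proof -
    have "\<bar>f x (w x)\<bar>\<^sup>2 \<le> (C * \<bar>w x\<bar> powr (r - 1))\<^sup>2"
      by (rule power_mono[OF f_growth[OF that]]) simp
    also have "\<dots> = C\<^sup>2 * \<bar>w x\<bar> powr (2 * (r - 1))"
      by (simp add: power_mult_distrib power2_eq_square flip: powr_add)
    also have "\<bar>w x\<bar> powr (2 * (r - 1)) \<le> 1 + \<bar>w x\<bar> powr ?p"
    proof (cases "\<bar>w x\<bar> \<le> 1")
      case True
      then have "\<bar>w x\<bar> powr (2 * (r - 1)) \<le> 1" using r by (intro powr_le1) auto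
      then show ?thesis by (simp add: add_increasing2)
    next
      case False
      then have "\<bar>w x\<bar> powr (2 * (r - 1)) \<le> \<bar>w x\<bar> powr ?p" using p by (intro powr_mono) auto
      then show ?thesis by simp
    qed
    finally show ?thesis by (simp add: mult_left_mono)
  qed
  ultimately have "integrable L (\<lambda>x. (f x (w x))\<^sup>2)"
    by (elim Bochner_Integration.integrable_bound) (use m in \<open>auto intro!: AE_I2 simp: space_L\<close>)
  then show ?thesis using m by (simp add: Lp2_iff)
qed

end

context evolution
begin

text \<open>By strong measurability \<open>u\<close> is almost everywhere a limit of values from a countable set of
  test functions, so a single null set of times serves all of them.\<close>

lemma weak_equation_tested: "AE t in lebesgue. 0 < t \<longrightarrow> ip (v t) (u t) = - I (u t)"
proof -
  let ?X = "X \<inter> H" and ?nrm = "\<lambda>\<phi>. W \<phi> + norm2 \<phi>"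
  have half: "{0<..} \<inter> space lebesgue \<in> sets (lebesgue :: real measure)"
    "{0..} \<inter> space lebesgue \<in> sets (lebesgue :: real measure)" by auto
  obtain \<eta> :: "real^'n \<Rightarrow> real^'n \<Rightarrow> real \<Rightarrow> real" where
    \<eta>1: "AE t in lebesgue_on {0..}. (\<lambda>(x, y). \<eta> x y t) \<in> borel_measurable lebesgue \<and>
           (AE (x, y) in lebesgue. \<eta> x y t = - \<eta> y x t) \<and> (AE (x, y) in lebesgue. \<bar>\<eta> x y t\<bar> \<le> 1)"
    and \<eta>2: "AE (x, y, t) in lebesgue. t \<in> {0..} \<longrightarrow> \<eta> x y t \<in> multi_sign (u t x - u t y)"
    and eq: "\<And>\<phi>. \<phi> \<in> ?X \<Longrightarrow> AE t in lebesgue_on {0..}.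
           (\<integral>x. v t x * \<phi> x \<partial>L) + set_lebesgue_integral lebesgue (Qset \<Omega>)
             (\<lambda>(x, y). \<eta> x y t * ((\<phi> x - \<phi> y) / kernel s x y)) = (\<integral>x. f x (u t x) * \<phi> x \<partial>L)"
    using weak unfolding weak_solution_with_def satisfies_weak_equation_def time_intervals by blast
  define h where "h t z = \<eta> (fst z) (snd z) t" for t z
  define P where "P t \<phi> = (\<integral>z. h t z * dq \<phi> z \<partial>lebesgue)" for t \<phi>
  have eq': "AE t in lebesgue. 0 < t \<longrightarrow> ip (v t) \<phi> + P t \<phi> = ip (\<lambda>x. f x (u t x)) \<phi>" if "\<phi> \<in> ?X" for \<phi>
  proof -
    have "set_lebesgue_integral lebesgue (Qset \<Omega>) (\<lambda>(x, y). \<eta> x y t * ((\<phi> x - \<phi> y) / kernel s x y)) = P t \<phi>" for t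
      by (simp add: P_def set_lebesgue_integral_def h_def dq_def case_prod_beta mult.left_commute)
    then show ?thesis
      using eq[OF that] unfolding AE_restrict_space_iff[OF half(2)] ip_def
      by (auto elim!: eventually_mono)
  qed
  have "bochner_Linf ?X ?nrm {0<..} u"
    using weak unfolding weak_solution_with_def time_intervals by blast
  then obtain S where S: "\<And>k. simple_function (lebesgue_on {0<..}) (S k)" "\<And>k. S k ` {0<..} \<subseteq> ?X"
    "AE t in lebesgue_on {0<..}. (\<lambda>k::nat. ?nrm (\<lambda>x. S k t x - u t x)) \<longlonglongrightarrow> 0"
    unfolding bochner_Linf_def strongly_measurable_def by blast
  define D where "D = (\<Union>k. S k ` {0<..})"
  have D: "countable D" "D \<subseteq> ?X"
  proof -
    have "finite (S k ` {0<..})" for k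
      using simple_functionD(1)[OF S(1)[of k]] by (simp add: space_restrict_space)
    then show "countable D" unfolding D_def by (intro countable_UN) (auto intro: countable_finite)
    show "D \<subseteq> ?X" using S(2) by (auto simp: D_def)
  qed
  have eqD: "AE t in lebesgue. \<forall>\<phi>\<in>D. 0 < t \<longrightarrow> ip (v t) \<phi> + P t \<phi> = ip (\<lambda>x. f x (u t x)) \<phi>"
    by (rule AE_ball_countable'[OF eq']) (use D in auto)
  have \<eta>1': "AE t in lebesgue. t \<in> {0..} \<longrightarrow> (\<lambda>(x, y). \<eta> x y t) \<in> borel_measurable lebesgue \<and>
           (AE (x, y) in lebesgue. \<eta> x y t = - \<eta> y x t) \<and> (AE (x, y) in lebesgue. \<bar>\<eta> x y t\<bar> \<le> 1)"
    using \<eta>1 unfolding AE_restrict_space_iff[OF half(2)] .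
  have S3: "AE t in lebesgue. t \<in> {0<..} \<longrightarrow> (\<lambda>k. ?nrm (\<lambda>x. S k t x - u t x)) \<longlonglongrightarrow> 0"
    using S(3) unfolding AE_restrict_space_iff[OF half(1)] .
  show ?thesis
    using eqD \<eta>1' AE_lebesgue_triple[OF \<eta>2] S3 v_Lp2
  proof eventually_elim
    case (elim t)
    show ?case
    proof
      assume t: "0 < t"
      have hm: "h t \<in> borel_measurable lebesgue" and h1: "AE z in lebesgue. \<bar>h t z\<bar> \<le> 1"
        and hs: "AE z in lebesgue. h t z \<in> multi_sign (u t (fst z) - u t (snd z))"
      proof -
        have "(\<lambda>(x, y). \<eta> x y t) = h t" by (simp add: fun_eq_iff h_def)
        then show "h t \<in> borel_measurable lebesgue" using elim(2) t by simp
      qed (use elim(2,3) t in \<open>simp_all add: h_def case_prod_beta\<close>)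
      have lim: "(\<lambda>k. ?nrm (\<lambda>x. S k t x - u t x)) \<longlonglongrightarrow> 0" and v: "v t \<in> H" using elim t by auto
      have ut: "u t \<in> X" "u t \<in> H" using u_Ws1 u_Lp2 t by auto
      have fu: "(\<lambda>x. f x (u t x)) \<in> H" by (rule f_in_Lp2[OF ut(1) r_subcritical])
      \<comment> \<open>The defect of the equation at time \<open>t\<close>: linear in
        \<open>\<phi>\<close>, bounded by \<open>K\<close> times the norm, and zero at every
        approximant \<open>S k t\<close>, hence zero at their limit \<open>u t\<close>.\<close>
      let ?T = "\<lambda>\<phi>. ip (v t) \<phi> + P t \<phi> - ip (\<lambda>x. f x (u t x)) \<phi>"
      define K where "K = norm2 (v t) + 1 + norm2 (\<lambda>x. f x (u t x))"
      have T0: "?T (S k t) = 0" for k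
      proof -
        have "S k t \<in> D" using t by (auto simp: D_def)
        then show ?thesis using elim(1) t by simp
      qed
      have bound: "norm (?T (u t)) \<le> K * ?nrm (\<lambda>x. S k t x - u t x)" for k
      proof -
        let ?d = "\<lambda>x. S k t x - u t x"
        have Sk: "S k t \<in> X" "S k t \<in> H" using S(2)[of k] t by auto
        have d: "?d \<in> X" "?d \<in> H" using Ws1_diff[OF Sk(1) ut(1)] Lp2_diff[OF Sk(2) ut(2)] by auto
        have "P t ?d = P t (S k t) - P t (u t)"
          unfolding P_def dq_diff right_diff_distrib
          by (rule Bochner_Integration.integral_diff[OF dq_pairing_le(1)[OF hm h1 Sk(1)] dq_pairing_le(1)[OF hm h1 ut(1)]])
        then have "?T ?d = ?T (S k t) - ?T (u t)"
          using ip_diff_right[OF Sk(2) ut(2) v] ip_diff_right[OF Sk(2) ut(2) fu] by simp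
        then have "?T (u t) = - ?T ?d" using T0[of k] by simp
        moreover have "\<bar>ip (v t) ?d\<bar> \<le> norm2 (v t) * ?nrm ?d"
          using ip_le[OF v d(2)] mult_left_mono[of "norm2 ?d" "?nrm ?d" "norm2 (v t)"]
            W_nonneg[of ?d] norm2_nonneg[of "v t"] by linarith
        moreover have "\<bar>ip (\<lambda>x. f x (u t x)) ?d\<bar> \<le> norm2 (\<lambda>x. f x (u t x)) * ?nrm ?d"
          using ip_le[OF fu d(2)] mult_left_mono[of "norm2 ?d" "?nrm ?d" "norm2 (\<lambda>x. f x (u t x))"]
            W_nonneg[of ?d] norm2_nonneg[of "\<lambda>x. f x (u t x)"] by linarith
        moreover have "\<bar>P t ?d\<bar> \<le> 1 * ?nrm ?d"
          unfolding P_def mult_1 by (rule add_increasing2[OF Lp_norm_nonneg dq_pairing_le(2)[OF hm h1 d(1)]])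
        moreover have "K * ?nrm ?d = norm2 (v t) * ?nrm ?d + 1 * ?nrm ?d + norm2 (\<lambda>x. f x (u t x)) * ?nrm ?d"
          unfolding K_def by (simp only: distrib_right)
        ultimately show ?thesis unfolding real_norm_def by linarith
      qed
      have "(\<lambda>k. K * ?nrm (\<lambda>x. S k t x - u t x)) \<longlonglongrightarrow> 0" by (rule tendsto_mult_right_zero[OF lim])
      then have "norm (?T (u t)) \<le> 0"
        by (rule LIMSEQ_le_const) (use bound in blast)
      then have "ip (v t) (u t) = A (u t) - P t (u t)" by (simp add: A_def ip_def)
      moreover have "P t (u t) = W (u t)"
        unfolding P_def W_dq
      proof (rule integral_cong_AE)
        \<comment> \<open>Where the two values of \<open>u t\<close> differ the selection is their
          sign; where they agree both sides are zero, whatever the selection is.\<close>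
        show "AE z in lebesgue. h t z * dq (u t) z = \<bar>dq (u t) z\<bar>"
          using hs
        proof eventually_elim
          case (elim z)
          then have "h t z * (u t (fst z) - u t (snd z)) = \<bar>u t (fst z) - u t (snd z)\<bar>"
            by (auto simp: multi_sign_def sgn_if split: if_splits)
          then show ?case unfolding abs_dq by (simp add: dq_def mult.left_commute)
        qed
        show "(\<lambda>z. h t z * dq (u t) z) \<in> borel_measurable lebesgue"
          using dq_pairing_le(1)[OF hm h1 ut(1)] by (rule borel_measurable_integrable)
        show "(\<lambda>z. \<bar>dq (u t) z\<bar>) \<in> borel_measurable lebesgue"
          by (rule borel_measurable_integrable[OF integrable_abs[OF dq_integrable[OF ut(1)]]])
      qed
      ultimately show "ip (v t) (u t) = - I (u t)" by (simp add: I_eq)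
    qed
  qed
qed

section \<open>Increments of the squared norm\<close>

lemma cancel_half: "h * (k / (2 * h)) = k / 2" if "h \<noteq> 0" for h k :: real
  using that by simp

lemma scaled_AM_GM:
  fixes a b c :: real
  assumes "0 < c"
  shows "a * b \<le> c / 2 * a\<^sup>2 + b\<^sup>2 / (2 * c)"
proof -
  have "0 \<le> (c * a - b)\<^sup>2 / (2 * c)" using assms by simp
  also have "\<dots> = c / 2 * a\<^sup>2 + b\<^sup>2 / (2 * c) - a * b"
    using assms by (simp add: power2_diff power2_eq_square field_simps)
  finally show ?thesis by simp
qed

lemma affine_q_integral:
  assumes "0 \<le> a" "a \<le> b"
  shows "set_integrable lebesgue {a..b} (\<lambda>\<tau>. c * q \<tau> + k)"
    and "(LINT \<tau>:{a..b}|lebesgue. c * q \<tau> + k) = c * (E (u a) - E (u b)) + (b - a) * k"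
proof -
  have q: "set_integrable lebesgue {a..b} q" by (rule q_integrable_subset) (use assms in auto)
  have k: "set_integrable lebesgue {a..b} (\<lambda>\<tau>. k)"
    by (rule absolutely_integrable_on_const) simp
  show i: "set_integrable lebesgue {a..b} (\<lambda>\<tau>. c * q \<tau> + k)"
    by (intro set_integral_add set_integrable_mult_right q k)
  have "(LINT \<tau>:{a..b}|lebesgue. c * q \<tau> + k) = integral {a..b} (\<lambda>\<tau>. c * q \<tau> + k)"
    by (rule set_lebesgue_integral_eq_integral(2)[OF i])
  also have "\<dots> = integral {a..b} (\<lambda>\<tau>. c * q \<tau>) + integral {a..b} (\<lambda>\<tau>. k)"
    by (intro integral_add set_lebesgue_integral_eq_integral(1) set_integrable_mult_right q k)
  finally show "(LINT \<tau>:{a..b}|lebesgue. c * q \<tau> + k) = c * (E (u a) - E (u b)) + (b - a) * k"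
    using assms by (simp add: E_diff)
qed

lemma ip_v_integrable_Icc: "g \<in> H \<Longrightarrow> 0 \<le> a \<Longrightarrow> set_integrable lebesgue {a..b} (\<lambda>\<tau>. ip (v \<tau>) g)"
  by (rule set_integrable_subset[OF ip_v_integrable[of g b]]) auto

text \<open>Inequality of Young with weight \<open>c\<close> splits the pairing into dissipation,
  which integrates to the energy drop, and the norm of \<open>g\<close>. The case
  \<open>a = 0\<close>, which \<open>ip_increment\<close> does not cover, follows by continuity in
  \<open>a\<close>.\<close>

lemma ip_increment_le:
  assumes g: "g \<in> H" and ab: "0 \<le> a" "a < b" and c: "0 < c"
  shows "ip (u b) g - ip (u a) g \<le> c / 2 * (E (u a) - E (u b)) + (b - a) * ((norm2 g)\<^sup>2 / (2 * c))"
proof -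
  let ?G = "\<lambda>a. c / 2 * (E (u a) - E (u b)) + (b - a) * ((norm2 g)\<^sup>2 / (2 * c)) - (ip (u b) g - ip (u a) g)"
  have pos: "0 \<le> ?G a" if a: "0 < a" "a < b" for a
  proof -
    have "(LINT \<tau>:{a..b}|lebesgue. ip (v \<tau>) g) \<le> (LINT \<tau>:{a..b}|lebesgue. c / 2 * q \<tau> + (norm2 g)\<^sup>2 / (2 * c))"
    proof (rule set_integral_mono_AE)
      show "AE \<tau>\<in>{a..b} in lebesgue. ip (v \<tau>) g \<le> c / 2 * q \<tau> + (norm2 g)\<^sup>2 / (2 * c)"
        using v_Lp2
      proof eventually_elim
        case (elim \<tau>)
        show ?case
        proof
          assume "\<tau> \<in> {a..b}"
          then have "ip (v \<tau>) g \<le> norm2 (v \<tau>) * norm2 g"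
            using ip_le[of "v \<tau>" g] elim a g by auto
          also have "\<dots> \<le> c / 2 * q \<tau> + (norm2 g)\<^sup>2 / (2 * c)"
            unfolding q_def by (rule scaled_AM_GM[OF c])
          finally show "ip (v \<tau>) g \<le> c / 2 * q \<tau> + (norm2 g)\<^sup>2 / (2 * c)" .
        qed
      qed
    qed (use ip_v_integrable_Icc[OF g, of a b] affine_q_integral(1)[of a b "c / 2" "(norm2 g)\<^sup>2 / (2 * c)"] a in simp_all)
    then show ?thesis
      using ip_increment[OF g a] affine_q_integral(2)[of a b "c / 2" "(norm2 g)\<^sup>2 / (2 * c)"] a by linarith
  qed
  have cl: "closure {0<..<b} = {0..b}" using ab by (intro closure_greaterThanLessThan) simp
  have "0 \<le> ?G a"
  proof (rule continuous_ge_on_closure[where S = "{0<..<b}" and f = ?G and a = 0])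
    show "continuous_on (closure {0<..<b}) ?G"
      unfolding cl by (intro continuous_on_add continuous_on_diff continuous_on_mult continuous_on_const continuous_on_id
          continuous_on_subset[OF E_continuous] continuous_on_subset[OF ip_u_continuous[OF g]]) auto
  qed (use ab cl pos in auto)
  then show ?thesis by simp
qed

abbreviation "gap y t \<equiv> (norm2 (\<lambda>x. u y x - u t x))\<^sup>2"

text \<open>The increment itself is taken as \<open>g\<close>, with weight \<open>c = b - a\<close>;
  half of the squared norm is then absorbed on the left.\<close>

lemma gap_le:
  assumes ab: "0 \<le> a" "a \<le> b"
  shows "gap b a \<le> (b - a) * (E (u a) - E (u b))"
proof (cases "a = b")
  case True
  then show ?thesis by (simp add: Lp2_norm)
next
  case False
  then have ab: "0 \<le> a" "a < b" "0 \<le> b" using ab by auto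
  let ?g = "\<lambda>x. u b x - u a x"
  have g: "?g \<in> H" using u_Lp2 ab by (intro Lp2_diff) auto
  have "(norm2 ?g)\<^sup>2 = ip (u b) ?g - ip (u a) ?g"
    using ip_diff_left[OF u_Lp2 u_Lp2 g, of b a] ab by (simp add: ip_self)
  also have "\<dots> \<le> (b - a) / 2 * (E (u a) - E (u b)) + (b - a) * ((norm2 ?g)\<^sup>2 / (2 * (b - a)))"
    using ab by (intro ip_increment_le g) auto
  also have "(b - a) * ((norm2 ?g)\<^sup>2 / (2 * (b - a))) = (norm2 ?g)\<^sup>2 / 2"
    using ab by (intro cancel_half) simp
  finally show ?thesis by (simp add: field_simps)
qed

definition "M t = (norm2 (u t))\<^sup>2"

lemma M_expand:
  assumes "0 \<le> t" "0 \<le> y"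
  shows "M y = gap y t + 2 * ip (u y) (u t) - M t"
proof -
  have "gap y t = ip (u y) (u y) - ip (u y) (u t) - (ip (u t) (u y) - ip (u t) (u t))"
    using ip_diff_left[OF u_Lp2 u_Lp2 Lp2_diff[OF u_Lp2 u_Lp2], of y t y t]
      ip_diff_right[OF u_Lp2 u_Lp2 u_Lp2, of y t y] ip_diff_right[OF u_Lp2 u_Lp2 u_Lp2, of y t t] assms
    by (simp add: ip_self)
  then show ?thesis using ip_commute[of "u t" "u y"] by (simp add: M_def ip_self)
qed

text \<open>\<open>M_expand\<close> writes \<open>M y\<close> as a gap that tends to zero by
  \<open>gap_le\<close> plus a pairing with the fixed function \<open>u t\<close>. The initial time
  is included, where no derivative of \<open>M\<close> is available.\<close>

lemma M_continuous: "continuous_on {0..} M"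
  unfolding continuous_on_def
proof
  fix t :: real assume t: "t \<in> {0..}"
  have Et: "((\<lambda>y. E (u y)) \<longlongrightarrow> E (u t)) (at t within {0..})"
    using E_continuous t by (simp add: continuous_on_def)
  have ipt: "((\<lambda>y. ip (u y) (u t)) \<longlongrightarrow> ip (u t) (u t)) (at t within {0..})"
    using ip_u_continuous[OF u_Lp2] t by (simp add: continuous_on_def)
  have "((\<lambda>y. \<bar>y - t\<bar> * \<bar>E (u y) - E (u t)\<bar>) \<longlongrightarrow> \<bar>t - t\<bar> * \<bar>E (u t) - E (u t)\<bar>) (at t within {0..})"
    by (intro tendsto_mult tendsto_rabs tendsto_diff Et tendsto_const tendsto_ident_at)
  then have lim: "((\<lambda>y. \<bar>y - t\<bar> * \<bar>E (u y) - E (u t)\<bar>) \<longlongrightarrow> 0) (at t within {0..})" by simp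
  have "((\<lambda>y. gap y t) \<longlongrightarrow> 0) (at t within {0..})"
  proof (rule Lim_null_comparison[OF _ lim])
    have "norm (gap y t) \<le> \<bar>y - t\<bar> * \<bar>E (u y) - E (u t)\<bar>" if y: "0 \<le> y" for y
    proof (cases "t \<le> y")
      case True
      then show ?thesis using gap_le[of t y] t E_antimono[of t y] by (simp add: abs_minus_commute)
    next
      case False
      have "gap y t = gap t y"
        by (simp add: Lp2_norm_sq power2_commute)
      then show ?thesis using gap_le[of y t] False y E_antimono[of y t] by simp
    qed
    then show "\<forall>\<^sub>F y in at t within {0..}. norm (gap y t) \<le> \<bar>y - t\<bar> * \<bar>E (u y) - E (u t)\<bar>"
      by (auto simp: eventually_at_filter)
  qed
  then have "((\<lambda>y. gap y t + 2 * ip (u y) (u t) - M t) \<longlongrightarrow> 0 + 2 * ip (u t) (u t) - M t) (at t within {0..})"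
    by (intro tendsto_add tendsto_diff tendsto_mult tendsto_const ipt)
  then have "((\<lambda>y. gap y t + 2 * ip (u y) (u t) - M t) \<longlongrightarrow> M t) (at t within {0..})"
    by (simp add: ip_self M_def)
  moreover have "gap y t + 2 * ip (u y) (u t) - M t = M y" if "y \<in> {0..}" for y
    by (rule M_expand[symmetric]) (use t that in auto)
  then have "\<forall>\<^sub>F y in at t within {0..}. gap y t + 2 * ip (u y) (u t) - M t = M y"
    unfolding eventually_at_filter by (intro always_eventually allI impI)
  ultimately show "(M \<longlongrightarrow> M t) (at t within {0..})"
    by (rule Lim_transform_eventually)
qed

lemma I_integrable_Icc: "0 \<le> a \<Longrightarrow> set_integrable lebesgue {a..b} (\<lambda>\<tau>. I (u \<tau>))"
  by (intro absolutely_integrable_continuous_real continuous_on_subset[OF I_continuous]) auto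

text \<open>Pairing with the fixed function \<open>u b + u a\<close> produces
  \<open>M b - M a\<close>. At an intermediate time this function is \<open>2 * u \<tau>\<close>
  plus \<open>u b - u \<tau>\<close> minus \<open>u \<tau> - u a\<close>; the first part is covered
  by \<open>weak_equation_tested\<close>, and the two differences are small by
  \<open>gap_le\<close>.\<close>

lemma M_increment:
  assumes ab: "0 < a" "a < b"
  shows "\<bar>M b - M a + 2 * integral {a..b} (\<lambda>\<tau>. I (u \<tau>))\<bar> \<le> 2 * (b - a) * (E (u a) - E (u b))"
proof -
  define \<Delta> where "\<Delta> = E (u a) - E (u b)"
  let ?g = "\<lambda>x. u b x + u a x"
  have ua: "u a \<in> H" and ub: "u b \<in> H" using u_Lp2 ab by auto
  have g: "?g \<in> H" by (rule Lp2_add[OF ub ua])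
  have iv: "set_integrable lebesgue {a..b} (\<lambda>\<tau>. ip (v \<tau>) ?g)" using ip_v_integrable_Icc[OF g] ab by simp
  have iI: "set_integrable lebesgue {a..b} (\<lambda>\<tau>. 2 * I (u \<tau>))"
    using I_integrable_Icc[of a b] ab by (intro set_integrable_mult_right) simp
  have sum: "M b - M a + 2 * integral {a..b} (\<lambda>\<tau>. I (u \<tau>)) = (LINT \<tau>:{a..b}|lebesgue. ip (v \<tau>) ?g + 2 * I (u \<tau>))"
  proof -
    have "M b - M a = ip (u b) ?g - ip (u a) ?g"
      using ip_add_right[OF ub ua ub] ip_add_right[OF ub ua ua] ip_commute[of "u a" "u b"] by (simp add: M_def ip_self)
    also have "\<dots> = (LINT \<tau>:{a..b}|lebesgue. ip (v \<tau>) ?g)" by (rule ip_increment[OF g ab])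
    finally have "M b - M a = (LINT \<tau>:{a..b}|lebesgue. ip (v \<tau>) ?g)" .
    moreover have "2 * integral {a..b} (\<lambda>\<tau>. I (u \<tau>)) = (LINT \<tau>:{a..b}|lebesgue. 2 * I (u \<tau>))"
      using set_lebesgue_integral_eq_integral(2)[OF I_integrable_Icc[of a b]] ab by simp
    ultimately show ?thesis using set_integral_add(2)[OF iv iI] by simp
  qed
  have near: "gap b \<tau> \<le> (b - a) * \<Delta>" "gap \<tau> a \<le> (b - a) * \<Delta>"
    if \<tau>: "\<tau> \<in> {a..b}" for \<tau>
  proof -
    have E1: "E (u b) \<le> E (u \<tau>)" "E (u \<tau>) \<le> E (u a)" using E_antimono \<tau> ab by auto
    have "(b - \<tau>) * (E (u \<tau>) - E (u b)) \<le> (b - a) * \<Delta>" "(\<tau> - a) * (E (u a) - E (u \<tau>)) \<le> (b - a) * \<Delta>"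
      using \<tau> ab E1 by (auto simp: \<Delta>_def intro!: mult_mono)
    then show "gap b \<tau> \<le> (b - a) * \<Delta>" "gap \<tau> a \<le> (b - a) * \<Delta>"
      using gap_le[of \<tau> b] gap_le[of a \<tau>] \<tau> ab by auto
  qed
  have pw: "AE \<tau>\<in>{a..b} in lebesgue. \<bar>ip (v \<tau>) ?g + 2 * I (u \<tau>)\<bar> \<le> (b - a) * q \<tau> + \<Delta>"
    using v_Lp2 weak_equation_tested
  proof eventually_elim
    case (elim \<tau>)
    show ?case
    proof
      assume \<tau>: "\<tau> \<in> {a..b}"
      then have v: "v \<tau> \<in> H" and ut: "u \<tau> \<in> H" and I: "ip (v \<tau>) (u \<tau>) = - I (u \<tau>)"
        using elim u_Lp2 ab by auto
      have "ip (v \<tau>) ?g + 2 * I (u \<tau>) = ip (v \<tau>) (\<lambda>x. u b x - u \<tau> x) - ip (v \<tau>) (\<lambda>x. u \<tau> x - u a x)"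
        using ip_add_right[OF ub ua v] ip_diff_right[OF ub ut v] ip_diff_right[OF ut ua v] I by simp
      moreover have "\<bar>ip (v \<tau>) d\<bar> \<le> (b - a) / 2 * q \<tau> + \<Delta> / 2" if d: "d \<in> H" "(norm2 d)\<^sup>2 \<le> (b - a) * \<Delta>" for d
      proof -
        have "\<bar>ip (v \<tau>) d\<bar> \<le> norm2 (v \<tau>) * norm2 d" by (rule ip_le[OF v d(1)])
        \<comment> \<open>The weight \<open>b - a\<close> is chosen so that a squared norm of at
          most \<open>(b - a) * \<Delta>\<close> costs exactly \<open>\<Delta> / 2\<close>.\<close>
        also have "\<dots> \<le> (b - a) / 2 * q \<tau> + (norm2 d)\<^sup>2 / (2 * (b - a))"
          unfolding q_def using ab by (intro scaled_AM_GM) simp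
        also have "(norm2 d)\<^sup>2 / (2 * (b - a)) \<le> (b - a) * \<Delta> / (2 * (b - a))"
          using d(2) ab by (intro divide_right_mono) auto
        also have "(b - a) * \<Delta> / (2 * (b - a)) = (b - a) * (\<Delta> / (2 * (b - a)))" by simp
        also have "\<dots> = \<Delta> / 2" using ab by (intro cancel_half) simp
        finally show ?thesis by simp
      qed
      from this[OF Lp2_diff[OF ub ut] near(1)[OF \<tau>]] this[OF Lp2_diff[OF ut ua] near(2)[OF \<tau>]]
      have "\<bar>ip (v \<tau>) (\<lambda>x. u b x - u \<tau> x)\<bar> \<le> (b - a) / 2 * q \<tau> + \<Delta> / 2"
        "\<bar>ip (v \<tau>) (\<lambda>x. u \<tau> x - u a x)\<bar> \<le> (b - a) / 2 * q \<tau> + \<Delta> / 2" .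
      moreover have "(b - a) * q \<tau> = (b - a) / 2 * q \<tau> + (b - a) / 2 * q \<tau>" by simp
      ultimately show "\<bar>ip (v \<tau>) ?g + 2 * I (u \<tau>)\<bar> \<le> (b - a) * q \<tau> + \<Delta>" by linarith
    qed
  qed
  have iw: "set_integrable lebesgue {a..b} (\<lambda>\<tau>. ip (v \<tau>) ?g + 2 * I (u \<tau>))" by (rule set_integral_add(1)[OF iv iI])
  have "\<bar>LINT \<tau>:{a..b}|lebesgue. ip (v \<tau>) ?g + 2 * I (u \<tau>)\<bar> \<le> (LINT \<tau>:{a..b}|lebesgue. \<bar>ip (v \<tau>) ?g + 2 * I (u \<tau>)\<bar>)"
    using set_integral_norm_bound[OF iw] by simp
  also have "\<dots> \<le> (LINT \<tau>:{a..b}|lebesgue. (b - a) * q \<tau> + \<Delta>)"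
    using ab by (intro set_integral_mono_AE[OF set_integrable_abs[OF iw] affine_q_integral(1) pw]) auto
  also have "\<dots> = 2 * (b - a) * \<Delta>"
    using affine_q_integral(2)[of a b "b - a" \<Delta>] ab by (simp add: \<Delta>_def)
  finally show ?thesis unfolding sum \<Delta>_def .
qed

text \<open>The error in \<open>M_increment\<close> is \<open>b - a\<close> times an energy drop
  that tends to zero, so \<open>M\<close> plus twice the integral of \<open>I\<close> has derivative
  zero.\<close>

lemma M_derivative:
  assumes t: "0 < t"
  shows "(M has_real_derivative - 2 * I (u t)) (at t)"
proof -
  let ?J = "\<lambda>y. integral {0..y} (\<lambda>\<tau>. I (u \<tau>))"
  let ?\<Phi> = "\<lambda>y. M y + 2 * ?J y"
  have io: "(\<lambda>\<tau>. I (u \<tau>)) integrable_on {0..y}" for y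
    by (intro integrable_continuous_real continuous_on_subset[OF I_continuous]) auto
  have est: "\<bar>?\<Phi> b - ?\<Phi> a\<bar> \<le> 2 * (b - a) * (E (u a) - E (u b))" if "0 < a" "a < b" for a b
    using M_increment[OF that] Henstock_Kurzweil_Integration.integral_combine[of 0 a b "\<lambda>\<tau>. I (u \<tau>)"] io[of b] that
    by (simp add: algebra_simps)
  have isE: "isCont (\<lambda>y. E (u y)) t"
    by (rule continuous_on_interior[OF E_continuous]) (use t in simp)
  then have "((\<lambda>y. 2 * \<bar>E (u y) - E (u t)\<bar>) \<longlongrightarrow> 2 * \<bar>E (u t) - E (u t)\<bar>) (at t)"
    by (intro tendsto_mult tendsto_rabs tendsto_diff tendsto_const) (simp add: isCont_def)
  then have lim: "((\<lambda>y. 2 * \<bar>E (u y) - E (u t)\<bar>) \<longlongrightarrow> 0) (at t)" by simp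
  have "((\<lambda>y. (?\<Phi> y - ?\<Phi> t) / (y - t)) \<longlongrightarrow> 0) (at t)"
  proof (rule Lim_null_comparison[OF _ lim])
    have "norm ((?\<Phi> y - ?\<Phi> t) / (y - t)) \<le> 2 * \<bar>E (u y) - E (u t)\<bar>" if y: "0 < y" "y \<noteq> t" for y
    proof -
      have "\<bar>?\<Phi> y - ?\<Phi> t\<bar> \<le> 2 * \<bar>y - t\<bar> * \<bar>E (u y) - E (u t)\<bar>"
      proof (cases "t < y")
        case True
        then have "\<bar>y - t\<bar> = y - t" "\<bar>E (u y) - E (u t)\<bar> = E (u t) - E (u y)" using E_antimono[of t y] t by auto
        then show ?thesis using est[OF t True] by (simp only:)
      next
        case False
        then have yt: "y < t" using y by simp
        then have "\<bar>y - t\<bar> = t - y" "\<bar>E (u y) - E (u t)\<bar> = E (u y) - E (u t)" using E_antimono[of y t] y by auto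
        then show ?thesis using est[OF y(1) yt] abs_minus_commute[of "?\<Phi> y" "?\<Phi> t"] by (simp only:)
      qed
      then have "\<bar>?\<Phi> y - ?\<Phi> t\<bar> \<le> 2 * \<bar>E (u y) - E (u t)\<bar> * \<bar>y - t\<bar>" by (simp only: ac_simps)
      then show ?thesis using y(2) by (simp only: real_norm_def abs_divide) (simp add: pos_divide_le_eq)
    qed
    moreover have "\<forall>\<^sub>F y in at t. 0 < y" using t order_tendstoD(1)[OF tendsto_ident_at, of 0 t UNIV] by simp
    ultimately show "\<forall>\<^sub>F y in at t. norm ((?\<Phi> y - ?\<Phi> t) / (y - t)) \<le> 2 * \<bar>E (u y) - E (u t)\<bar>"
      unfolding eventually_at_filter by (auto elim!: eventually_mono)
  qed
  then have d\<Phi>: "(?\<Phi> has_real_derivative 0) (at t)" by (simp add: has_field_derivative_iff)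
  have "(?J has_real_derivative I (u t)) (at t within {0..t + 1})"
    by (rule integral_has_real_derivative) (use t continuous_on_subset[OF I_continuous] in auto)
  moreover have "at t within {0..t + 1} = at t" by (rule at_within_interior) (use t in simp)
  ultimately have dJ: "(?J has_real_derivative I (u t)) (at t)" by simp
  have "((\<lambda>y. ?\<Phi> y - 2 * ?J y) has_real_derivative 0 - 2 * I (u t)) (at t)"
    by (rule DERIV_diff[OF d\<Phi> DERIV_cmult[OF dJ]])
  then show ?thesis by simp
qed

end

section \<open>Decay below the mountain pass level\<close>

context evolution
begin

lemma zero_if_below_depth:
  assumes "w \<in> X" "I w = 0" "E w < depth"
  shows "vanishes w"
  using depth_le[of w] assms by (force simp: nehari_manifold_iff)

text \<open>Below the mountain pass level the set \<open>{I < 0}\<close> is open and closed along the trajectory,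
  because it stays away from the origin.\<close>

lemma sign_dichotomy:
  assumes t0: "0 \<le> t0" "E (u t0) < depth"
  shows "(\<forall>t\<ge>t0. I (u t) < 0) \<or> (\<forall>t\<ge>t0. 0 \<le> I (u t))"
proof -
  obtain c where c: "0 < c" "\<And>w. w \<in> X \<Longrightarrow> \<not> vanishes w \<Longrightarrow> I w \<le> 0 \<Longrightarrow> c \<le> W w"
    by (rule W_lower_bound) (rule that)
  let ?S = "{t0..}"
  have cI: "continuous_on ?S (\<lambda>t. I (u t))" and cW: "continuous_on ?S (\<lambda>t. W (u t))"
    using t0(1) by (auto intro: continuous_on_subset[OF I_continuous] continuous_on_subset[OF W_continuous])
  define T where "T = ?S \<inter> (\<lambda>t. I (u t)) -` {..<0}"
  have op: "openin (top_of_set ?S) T"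
    unfolding T_def by (rule continuous_openin_preimage_gen[OF cI]) simp
  \<comment> \<open>The same set written with closed conditions: below the depth,
    \<open>I (u t) = 0\<close> forces \<open>u t\<close> to vanish, which
    \<open>c \<le> W (u t)\<close> forbids.\<close>
  have "T = (?S \<inter> (\<lambda>t. I (u t)) -` {..0}) \<inter> (?S \<inter> (\<lambda>t. W (u t)) -` {c..})"
  proof (rule set_eqI)
    fix t
    show "t \<in> T \<longleftrightarrow> t \<in> (?S \<inter> (\<lambda>t. I (u t)) -` {..0}) \<inter> (?S \<inter> (\<lambda>t. W (u t)) -` {c..})"
    proof (cases "t0 \<le> t")
      case True
      then have ut: "u t \<in> X" "E (u t) < depth"
        using u_Ws1[of t] E_antimono[OF t0(1) True] t0 by auto
      have "I (u t) < 0 \<longleftrightarrow> I (u t) \<le> 0 \<and> c \<le> W (u t)"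
      proof
        assume "I (u t) < 0"
        then show "I (u t) \<le> 0 \<and> c \<le> W (u t)"
          using c(2)[OF ut(1)] zero_values(2)[OF ut(1)] by fastforce
      next
        assume *: "I (u t) \<le> 0 \<and> c \<le> W (u t)"
        then have "I (u t) \<noteq> 0"
          using zero_if_below_depth[OF ut(1) _ ut(2)] zero_values(1)[OF ut(1)] c(1) by fastforce
        with * show "I (u t) < 0" by simp
      qed
      then show ?thesis using True by (simp add: T_def)
    qed (simp add: T_def)
  qed
  then have "closedin (top_of_set ?S) T"
    using continuous_closedin_preimage[OF cI closed_atMost[of 0]] continuous_closedin_preimage[OF cW closed_atLeast[of c]]
    by (simp add: closedin_Int)
  with op have "T = {} \<or> T = ?S"
    using connected_clopen[of ?S] connected_Ici[of t0] by blast
  then show ?thesis unfolding T_def by (force simp: not_less)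
qed

text \<open>The gap at energy \<open>E (u t0)\<close> persists because the energy does not increase,
  and it gives \<open>I \<ge> k * norm2\<close> with \<open>k = (1 - \<delta>) * S\<close>. With
  \<open>M\<close> having derivative \<open>- 2 * I\<close>, the square root of \<open>M\<close>
  decreases at rate at least \<open>k\<close> as long as it is positive.\<close>

lemma decay:
  assumes S: "0 < S" "\<And>w. w \<in> X \<Longrightarrow> S * norm2 w \<le> W w"
    and t0: "0 \<le> t0" "E (u t0) < depth" "0 \<le> I (u t0)"
  obtains \<delta> where "0 < \<delta>" "\<delta> < 1"
    "\<And>t. t0 \<le> t \<Longrightarrow> norm2 (u t) \<le> max (norm2 (u t0) + (\<delta> - 1) * S * (t - t0)) 0"
    "\<And>t. t0 + norm2 (u t0) / ((1 - \<delta>) * S) \<le> t \<Longrightarrow> vanishes (u t)"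
proof -
  obtain \<delta> where \<delta>: "0 < \<delta>" "\<delta> < 1"
    "\<And>w. w \<in> X \<Longrightarrow> 0 \<le> I w \<Longrightarrow> E w \<le> E (u t0) \<Longrightarrow> (1 - \<delta>) * W w \<le> I w"
    by (rule stable_gap[OF t0(2)]) (rule that)
  define k where "k = (1 - \<delta>) * S"
  have k: "0 < k" using \<delta> S by (simp add: k_def)
  have I_ge: "k * norm2 (u t) \<le> I (u t)" if t: "t0 \<le> t" for t
  proof -
    have "0 \<le> I (u t)" using sign_dichotomy[OF t0(1,2)] t t0(3) by fastforce
    moreover have ut: "u t \<in> X" using t t0 by (intro u_Ws1) simp
    ultimately have "(1 - \<delta>) * W (u t) \<le> I (u t)" using \<delta>(3) E_antimono[OF t0(1) t] by blast
    moreover have "(1 - \<delta>) * (S * norm2 (u t)) \<le> (1 - \<delta>) * W (u t)"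
      using S(2)[OF ut] \<delta> by (intro mult_left_mono) auto
    ultimately show ?thesis by (simp add: k_def mult.assoc)
  qed
  have M_cont: "continuous_on {t0..t} M" for t
    using t0 by (intro continuous_on_subset[OF M_continuous]) auto
  have norm2_M: "norm2 (u t) = sqrt (M t)" for t by (simp add: M_def Lp_norm_nonneg)
  have bound: "norm2 (u t) \<le> max (norm2 (u t0) - k * (t - t0)) 0" if t: "t0 \<le> t" for t
  proof (cases "norm2 (u t) = 0 \<or> t = t0")
    case True
    then show ?thesis by auto
  next
    case False
    then have pos: "0 < norm2 (u t)" using norm2_nonneg[of "u t"] by auto
    \<comment> \<open>The square root is differentiated only where \<open>M\<close> is positive; as
      \<open>M\<close> is nonincreasing, positivity at the final time \<open>t\<close> extends back
      to \<open>t0\<close>.\<close>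
    have M_pos: "0 < M y" if y: "t0 \<le> y" "y \<le> t" for y
    proof -
      have "M t \<le> M y"
      proof (cases "y = t")
        case False
        then show ?thesis
        proof (intro DERIV_nonpos_imp_decreasing_open[of y t M])
          fix x assume "y < x" "x < t"
          then have x: "t0 \<le> x" "0 < x" using y t0 by auto
          have "0 \<le> k * norm2 (u x)" using k norm2_nonneg[of "u x"] by simp
          then have "0 \<le> I (u x)" using I_ge[OF x(1)] by linarith
          then show "\<exists>z. (M has_real_derivative z) (at x) \<and> z \<le> 0"
            using M_derivative[OF x(2)] by (intro exI conjI) auto
        next
          show "continuous_on {y..t} M" using y by (intro continuous_on_subset[OF M_cont]) auto
        qed (use y in auto)
      qed simp
      moreover have "0 < M t" using pos by (simp add: M_def)
      ultimately show ?thesis by simp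
    qed
    let ?\<psi> = "\<lambda>y. sqrt (M y) + k * (y - t0)"
    have "?\<psi> t \<le> ?\<psi> t0"
    proof (rule DERIV_nonpos_imp_decreasing_open[OF t])
      fix x assume x: "t0 < x" "x < t"
      have Mx: "0 < M x" using M_pos x by simp
      have "((\<lambda>y. sqrt (M y)) has_real_derivative (- 2 * I (u x)) * (inverse (sqrt (M x)) / 2)) (at x)"
        using DERIV_chain2[OF DERIV_real_sqrt[OF Mx] M_derivative] x t0 by (simp add: mult.commute)
      moreover have "((\<lambda>y. k * (y - t0)) has_real_derivative k) (at x)"
        by (auto intro!: derivative_eq_intros)
      ultimately have "(?\<psi> has_real_derivative (- 2 * I (u x)) * (inverse (sqrt (M x)) / 2) + k) (at x)"
        by (rule DERIV_add)
      moreover have "(- 2 * I (u x)) * (inverse (sqrt (M x)) / 2) + k \<le> 0"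
        using I_ge[of x] x Mx by (simp add: norm2_M field_simps)
      ultimately show "\<exists>z. (?\<psi> has_real_derivative z) (at x) \<and> z \<le> 0" by blast
    next
      show "continuous_on {t0..t} ?\<psi>"
        by (intro continuous_on_add continuous_on_real_sqrt M_cont continuous_on_mult continuous_on_diff
            continuous_on_const continuous_on_id)
    qed
    then show ?thesis by (simp add: norm2_M)
  qed
  show thesis
  proof (rule that[OF \<delta>(1,2)])
    show "norm2 (u t) \<le> max (norm2 (u t0) + (\<delta> - 1) * S * (t - t0)) 0" if "t0 \<le> t" for t
      using bound[OF that] by (simp add: k_def algebra_simps)
    show "vanishes (u t)" if t: "t0 + norm2 (u t0) / ((1 - \<delta>) * S) \<le> t" for t
    proof -
      have "norm2 (u t0) / k \<le> t - t0" using t by (simp add: k_def)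
      then have "norm2 (u t0) \<le> k * (t - t0)" using k by (simp add: pos_divide_le_eq mult.commute)
      moreover have "0 \<le> norm2 (u t0) / k" using k norm2_nonneg[of "u t0"] by simp
      then have "t0 \<le> t" using \<open>norm2 (u t0) / k \<le> t - t0\<close> by linarith
      ultimately have "norm2 (u t) = 0" using bound[of t] norm2_nonneg[of "u t"] by simp
      then show ?thesis using \<open>t0 \<le> t\<close> t0 by (intro Lp2_norm_zero u_Ws1) auto
    qed
  qed
qed

text \<open>On the unstable side the squared norm grows at least linearly, which contradicts the uniform
  bound contained in the notion of a global solution.\<close>

lemma not_unstable:
  assumes t1: "0 \<le> t1" "E (u t1) < depth"
  shows "0 \<le> I (u t1)"
proof (rule ccontr)
  assume "\<not> 0 \<le> I (u t1)"
  then have I_neg: "I (u t) < 0" if "t1 \<le> t" for t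
    using sign_dichotomy[OF t1] that by fastforce
  define \<epsilon> where "\<epsilon> = depth - E (u t1)"
  have \<epsilon>: "0 < \<epsilon>" using t1 by (simp add: \<epsilon>_def)
  have I_le: "\<epsilon> \<le> - I (u t)" if t: "t1 \<le> t" for t
    using unstable_gap[OF u_Ws1 I_neg[OF t]] E_antimono[OF t1(1) t] t t1(1) by (simp add: \<epsilon>_def)
  have growth: "2 * \<epsilon> * (t - t1) \<le> M t" if t: "t1 < t" for t
  proof -
    have "M t1 - 2 * \<epsilon> * t1 \<le> M t - 2 * \<epsilon> * t"
    proof (rule DERIV_nonneg_imp_increasing_open[OF less_imp_le[OF t]])
      fix x assume x: "t1 < x" "x < t"
      have "((\<lambda>y. M y - 2 * \<epsilon> * y) has_real_derivative - 2 * I (u x) - 2 * \<epsilon>) (at x)"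
        using x t1 by (intro DERIV_diff M_derivative) (auto intro!: derivative_eq_intros)
      then show "\<exists>z. ((\<lambda>y. M y - 2 * \<epsilon> * y) has_real_derivative z) (at x) \<and> 0 \<le> z"
        using I_le[of x] x by (intro exI conjI) auto
    next
      show "continuous_on {t1..t} (\<lambda>y. M y - 2 * \<epsilon> * y)"
        using t1 by (intro continuous_on_diff continuous_on_mult continuous_on_const continuous_on_id
            continuous_on_subset[OF M_continuous]) auto
    qed
    moreover have "0 \<le> M t1" by (simp add: M_def)
    ultimately show ?thesis by (simp add: algebra_simps)
  qed
  have "bochner_Linf (X \<inter> H) (\<lambda>\<phi>. W \<phi> + norm2 \<phi>) {0<..} u"
    using weak unfolding weak_solution_with_def time_intervals by blast
  then obtain K where "AE t in lebesgue_on {0<..}. W (u t) + norm2 (u t) \<le> K"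
    unfolding bochner_Linf_def by blast
  then have K: "AE t in lebesgue. 0 < t \<longrightarrow> W (u t) + norm2 (u t) \<le> K"
    by (subst (asm) AE_restrict_space_iff) auto
  \<comment> \<open>After \<open>T\<close> the linear lower bound exceeds \<open>K\<^sup>2\<close>.
    The upper bound holds only almost everywhere, so the contradiction is drawn from a whole
    interval of times.\<close>
  define T where "T = t1 + K\<^sup>2 / (2 * \<epsilon>)"
  have "AE t in lborel. t \<notin> {T<..<T + 1}"
    using K unfolding AE_completion_iff
  proof eventually_elim
    case (elim t)
    show ?case
    proof
      assume t: "t \<in> {T<..<T + 1}"
      have "0 \<le> K\<^sup>2 / (2 * \<epsilon>)" using \<epsilon> by simp
      then have tt: "t1 < t" using t by (simp add: T_def)
      then have "norm2 (u t) \<le> K" using elim t1 W_nonneg[of "u t"] by simp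
      then have "M t \<le> K\<^sup>2" unfolding M_def using norm2_nonneg[of "u t"] by (rule power_mono)
      then have "2 * \<epsilon> * (t - t1) \<le> K\<^sup>2" using growth[OF tt] by linarith
      moreover have "K\<^sup>2 / (2 * \<epsilon>) < t - t1" using t by (simp add: T_def)
      then have "K\<^sup>2 < (t - t1) * (2 * \<epsilon>)" using \<epsilon> by (simp add: pos_divide_less_eq)
      ultimately show False by (simp add: mult.commute)
    qed
  qed
  then have "{T<..<T + 1} \<in> null_sets lborel" by (subst AE_iff_null_sets) auto
  then show False by (simp add: null_sets_def)
qed

text \<open>By \<open>gap_le\<close>, no loss of energy means no motion in \<open>L\<^sup>2\<close>;
  then \<open>M\<close> is constant, and its derivative shows that \<open>I\<close> is zero.\<close>

lemma constant_energy_imp_stationary: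
  assumes "\<And>t. 0 \<le> t \<Longrightarrow> E (u t) = E (u 0)" and t: "0 < t"
  shows "I (u t) = 0" "norm2 (u t) = norm2 (u 0)"
proof -
  have M0: "M y = M 0" if y: "0 \<le> y" for y
  proof -
    let ?d = "\<lambda>x. u y x - u 0 x"
    have "(norm2 ?d)\<^sup>2 \<le> 0" using gap_le[of 0 y] assms(1)[OF y] y by simp
    then have d0: "norm2 ?d = 0" by simp
    have "?d \<in> H" using y by (intro Lp2_diff u_Lp2) auto
    then have "AE x in L. ?d x = 0" using d0 by (rule Lp2_norm_eq_0_imp)
    then have "AE x in L. u y x = u 0 x" by simp
    from AE_eq_imp(4)[OF u_Ws1 u_Ws1 this] show ?thesis using y by (simp add: M_def)
  qed
  show "norm2 (u t) = norm2 (u 0)"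
    using M0[OF less_imp_le[OF t]] unfolding M_def
    by (rule power2_eq_imp_eq[OF _ Lp_norm_nonneg Lp_norm_nonneg])
  have "\<forall>\<^sub>F y in nhds t. M y = M 0"
  proof (rule eventually_mono[OF eventually_nhds_in_open[of "{0<..}"]])
    show "M y = M 0" if "y \<in> {0<..}" for y by (rule M0) (use that in simp)
  qed (use t in auto)
  then have "(M has_real_derivative 0) (at t)"
    using DERIV_cong_ev[OF refl _ refl, of M "\<lambda>_. M 0" t 0] by simp
  from DERIV_unique[OF M_derivative[OF t] this] show "I (u t) = 0" by simp
qed

lemma threshold_alternative:
  assumes E0: "E (u 0) = depth" and t1: "0 \<le> t1" "E (u t1) \<noteq> depth"
  obtains t0 where "0 < t0" "E (u t0) < depth" "0 < I (u t0)"
proof -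
  have E1: "E (u t1) < depth" using E_antimono[of 0 t1] t1 E0 by simp
  \<comment> \<open>Were the manifold empty, every \<open>u t\<close> would vanish, as otherwise it
    could be scaled onto it; the energy would then be constant.\<close>
  have "NM \<noteq> {}"
  proof
    assume empty: "NM = {}"
    have "vanishes (u t)" if "0 \<le> t" for t
    proof (rule ccontr)
      assume nz: "\<not> vanishes (u t)"
      have ut: "u t \<in> X" using that by (rule u_Ws1)
      consider "I (u t) < 0" | "I (u t) = 0" | "0 < I (u t)" by linarith
      then show False
      proof cases
        case 1
        then show False using nehari_ray_down[OF ut] empty by blast
      next
        case 2
        then show False using ut nz empty nehari_manifold_iff[of "u t"] by blast
      next
        case 3
        then show False using nehari_ray_up[OF ut _ nz] empty by blast
      qed
    qed
    then have "E (u t1) = E (u 0)"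
      using zero_values(3)[OF u_Ws1] t1(1) by simp
    then show False using E0 t1(2) by simp
  qed
  then have d: "0 < depth" by (rule depth_pos)
  \<comment> \<open>A level strictly between 0 and \<open>depth\<close> that the energy must cross:
    a positive energy excludes the zero function, and a value below \<open>depth\<close> excludes
    the manifold, so \<open>I\<close> cannot be zero there.\<close>
  define y where "y = (max 0 (E (u t1)) + depth) / 2"
  have y: "0 < y" "E (u t1) \<le> y" "y < depth" using d E1 by (auto simp: y_def max_def)
  have "\<exists>t\<ge>0. t \<le> t1 \<and> E (u t) = y"
    using t1 y E0 by (intro IVT2' continuous_on_subset[OF E_continuous]) auto
  then obtain t0 where t0: "0 \<le> t0" "E (u t0) = y" by blast
  have ut: "u t0 \<in> X" using t0(1) by (rule u_Ws1)
  have "t0 \<noteq> 0" using t0 y E0 by auto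
  moreover have "0 \<le> I (u t0)" using not_unstable[OF t0(1)] t0 y by simp
  moreover have "I (u t0) \<noteq> 0"
    using zero_if_below_depth[OF ut] zero_values(3)[OF ut] t0 y by fastforce
  ultimately show thesis using that[of t0] t0 y by simp
qed

end

theorem theorem2p11:
  fixes s :: real and \<Omega> :: "(real^'n) set" and f :: "real^'n \<Rightarrow> real \<Rightarrow> real"
    and r C \<theta> \<Theta> :: real
    and u0 :: "real^'n \<Rightarrow> real" and u :: "real \<Rightarrow> real^'n \<Rightarrow> real"
  assumes s: "0 < s" "s < 1"
    and dim: "real CARD('n) \<le> 2 * s"
    and domain: "bounded_lipschitz_domain \<Omega>"
    and car: "caratheodory \<Omega> f"
    and a: "1 < r" "r < real CARD('n) / (real CARD('n) - s)" "C > 0"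
      "\<forall>x\<in>\<Omega>. \<forall>t. \<bar>f x t\<bar> \<le> C * \<bar>t\<bar> powr (r - 1)"
    and b: "\<theta> > 1"
      "\<forall>x\<in>\<Omega>. \<forall>t. t \<noteq> 0 \<longrightarrow> 0 < \<theta> * primitive f x t \<and> \<theta> * primitive f x t \<le> t * f x t"
    and c: "\<forall>x\<in>\<Omega>. f x C1_differentiable_on UNIV" "\<Theta> > 1"
      "\<forall>x\<in>\<Omega>. \<forall>t. t \<noteq> 0 \<longrightarrow> (\<Theta> - 1) * f x t * t < t\<^sup>2 * deriv (f x) t"
    and d: "r < 1 + real CARD('n) / (2 * (real CARD('n) - s))"
    and u0: "u0 \<in> Ws1 s \<Omega>"
    and u: "strong_solution s \<Omega> f \<infinity> u0 u"
  shows "\<exists>\<delta>' C\<^sub>S\<^sub>o\<^sub>b :: real. 0 < \<delta>' \<and> \<delta>' < 1 \<and> 0 < C\<^sub>S\<^sub>o\<^sub>b \<and>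
    (energy s \<Omega> f u0 < well_depth s \<Omega> f \<and> nehari_functional s \<Omega> f u0 > 0 \<longrightarrow>
       (\<forall>t\<ge>0. Lp_norm 2 \<Omega> (u t) \<le> max (Lp_norm 2 \<Omega> u0 + (\<delta>' - 1) * C\<^sub>S\<^sub>o\<^sub>b * t) 0) \<and>
       (\<forall>t \<ge> Lp_norm 2 \<Omega> u0 / ((1 - \<delta>') * C\<^sub>S\<^sub>o\<^sub>b). AE x in lebesgue. u t x = 0)) \<and>
    (energy s \<Omega> f u0 = well_depth s \<Omega> f \<longrightarrow>
       (\<forall>t>0. nehari_functional s \<Omega> f (u t) = 0 \<and> Lp_norm 2 \<Omega> (u t) = Lp_norm 2 \<Omega> u0) \<or>
       (\<exists>t0>0. nehari_functional s \<Omega> f (u t0) > 0 \<and>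
          (\<forall>t\<ge>t0. Lp_norm 2 \<Omega> (u t) \<le>
             max (Lp_norm 2 \<Omega> (u t0) + (\<delta>' - 1) * C\<^sub>S\<^sub>o\<^sub>b * (t - t0)) 0) \<and>
          (\<forall>t \<ge> t0 + Lp_norm 2 \<Omega> (u t0) / ((1 - \<delta>') * C\<^sub>S\<^sub>o\<^sub>b). AE x in lebesgue. u t x = 0)))"
proof -
  have dom: "open \<Omega>" "bounded \<Omega>" using domain by (auto simp: bounded_lipschitz_domain_def)
  obtain v where v: "weak_solution_with s \<Omega> f \<infinity> u0 u v"
    and strong: "\<forall>t\<in>half_open_time \<infinity>. u t \<in> Ws1 s \<Omega> \<and>
           (\<integral>\<tau>. (Lp_norm 2 \<Omega> (v \<tau>))\<^sup>2 \<partial>lebesgue_on {0..t}) + energy s \<Omega> f (u t) = energy s \<Omega> f (u 0)"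
    using u unfolding strong_solution_def by blast
  have half: "t \<in> half_open_time \<infinity>" if "0 \<le> t" for t using that by (simp add: half_open_time_def)
  interpret evolution s \<Omega> f r C \<theta> \<Theta> u0 u v
  proof (unfold_locales)
    show "(\<lambda>x. f x t) \<in> borel_measurable (lebesgue_on \<Omega>)" for t
      using car by (simp add: caratheodory_def)
    show "u t \<in> Ws1 s \<Omega>" if "0 \<le> t" for t using strong half[OF that] by blast
    show "(\<integral>\<tau>. (Lp_norm 2 \<Omega> (v \<tau>))\<^sup>2 \<partial>lebesgue_on {0..t}) + energy s \<Omega> f (u t) = energy s \<Omega> f (u 0)" if "0 \<le> t" for t
      using strong half[OF that] by blast
  qed (use s dim dom a b c d v in blast)+
  \<comment> \<open>The initial datum is attained only almost everywhere, so its norm and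
    functionals are carried over to \<open>u 0\<close>.\<close>
  have "AE x in L. u 0 x = u0 x" using v by (simp add: weak_solution_with_def)
  from AE_eq_imp[OF u_Ws1[OF order_refl] u0 this]
  have u00: "I u0 = I (u 0)" "E u0 = E (u 0)" "norm2 u0 = norm2 (u 0)" by simp_all
  obtain S where S: "0 < S" "\<And>w. w \<in> Ws1 s \<Omega> \<Longrightarrow> S * norm2 w \<le> W w"
    by (rule Sobolev_L2) (rule that)
  consider "E u0 < depth" "0 < I u0" | "E u0 = depth" "\<forall>t\<ge>0. E (u t) = depth"
    | "E u0 = depth" "\<exists>t\<ge>0. E (u t) \<noteq> depth" | "\<not> (E u0 < depth \<and> 0 < I u0)" "E u0 \<noteq> depth"
    by blast
  then show ?thesis
  proof cases
    case 1
    then have "E (u 0) < depth" "0 \<le> I (u 0)" using u00 by auto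
    from decay[OF S order_refl this] obtain \<delta> where "0 < \<delta>" "\<delta> < 1"
      "\<And>t. 0 \<le> t \<Longrightarrow> norm2 (u t) \<le> max (norm2 (u 0) + (\<delta> - 1) * S * (t - 0)) 0"
      "\<And>t. 0 + norm2 (u 0) / ((1 - \<delta>) * S) \<le> t \<Longrightarrow> AE x in lebesgue. u t x = 0" by blast
    then show ?thesis using S(1) 1(1) u00(3) by (intro exI[of _ \<delta>] exI[of _ S]) simp
  next
    case 2
    then have "I (u t) = 0" "norm2 (u t) = norm2 u0" if "0 < t" for t
      using constant_energy_imp_stationary[of t] that u00 by auto
    \<comment> \<open>No decay is claimed for a stationary solution, so \<open>1 / 2\<close> is a
      placeholder.\<close>
    then show ?thesis using 2(1) S(1) by (intro exI[of _ "1 / 2"] exI[of _ S]) simp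
  next
    case 3
    then obtain t1 where t1: "0 \<le> t1" "E (u t1) \<noteq> depth" by blast
    have "E (u 0) = depth" using 3(1) u00(2) by simp
    from threshold_alternative[OF this t1] obtain t0 where t0: "0 < t0" "E (u t0) < depth" "0 < I (u t0)" by blast
    from decay[OF S less_imp_le[OF t0(1)] t0(2) less_imp_le[OF t0(3)]] obtain \<delta> where "0 < \<delta>" "\<delta> < 1"
      "\<And>t. t0 \<le> t \<Longrightarrow> norm2 (u t) \<le> max (norm2 (u t0) + (\<delta> - 1) * S * (t - t0)) 0"
      "\<And>t. t0 + norm2 (u t0) / ((1 - \<delta>) * S) \<le> t \<Longrightarrow> AE x in lebesgue. u t x = 0" by blast
    then show ?thesis using S(1) 3(1) t0 by (intro exI[of _ \<delta>] exI[of _ S]) auto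
  next
    case 4
    then show ?thesis using S(1) by (intro exI[of _ "1 / 2"] exI[of _ S]) auto
  qed
qed

end
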